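(* Let $M$ be a connected compact $3$-dimensional manifold without boundary and let $A$ be an elliptic self-adjoint first order differential operator with smooth coefficients acting on columns of two complex-valued half-densities over $M$, with trace-free principal symbol $A_1(x,\xi)$. Let $h^+$ be the positive eigenvalue of $A_1$, $v^+$ the corresponding normalised eigenvector, and let $$b(x)=-n\int_{h^+(x,\xi)<1}\Bigl([v^+]^*A_{\mathrm{sub}}v^+-\frac i2\{[v^+]^*,A_1-h^+,v^+\}+\frac i{n-1}h^+\{[v^+]^*,v^+\}\Bigr)(x,\xi)\,(2\pi)^{-n}d\xi,\qquad n=3,$$ be the second asymptotic coefficient of the spectral function of $A$. Then $$b(x)=\frac1{8\pi^2}\Bigl(\bigl(\mathbf c\operatorname{tr}\overset{*}T-2\operatorname{tr}A_{\mathrm{sub}}\bigr)\sqrt{\det g_{\alpha\beta}}\Bigr)(x),$$ where $g$ is the metric, $\mathbf c=\pm1$ the relative orientation, and $\overset{*}T$ the (Hodge-dualised) torsion of the teleparallel connection determined by $A_1$, and $\operatorname{tr}\overset{*}T:=\overset{*}T{}^\alpha{}_\alpha$.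
   Context: Summation over repeated indices is used; $^*$ on columns/matrices is Hermitian conjugation; subscripts $x^\alpha$, $\xi_\alpha$ denote partial derivatives. Ellipticity: $\det A_1(x,\xi)\ne0$ for $\xi\neq0$. In local coordinates the full symbol of $A$ is $A_1(x,\xi)+A_0(x)$ and $A_{\mathrm{sub}}:=A_0+\frac i2(A_1)_{x^\alpha\xi_\alpha}$, a function of $x$ only. $v^+$ is chosen locally smoothly; it is defined up to a phase factor, which does not affect $b(x)$. $\{P,R\}:=P_{x^\alpha}R_{\xi_\alpha}-P_{\xi_\alpha}R_{x^\alpha}$, $\{P,Q,R\}:=P_{x^\alpha}QR_{\xi_\alpha}-P_{\xi_\alpha}QR_{x^\alpha}$. Metric: $\det A_1(x,\xi)=-g^{\alpha\beta}(x)\xi_\alpha\xi_\beta$ defines a Riemannian metric; indices are raised and lowered with it. Frame: write $A_1(x,\xi)=\sigma^\alpha(x)\xi_\alpha$ with trace-free Hermitian $2\times2$ matrices $\sigma^\alpha$, and let $V_1{}^\alpha:=\operatorname{Re}(\sigma^\alpha)_{12}$, $V_2{}^\alpha:=-\operatorname{Im}(\sigma^\alpha)_{12}$, $V_3{}^\alpha:=(\sigma^\alpha)_{11}$. The vector fields $V_1,V_2,V_3$ form a global $g$-orthonormal frame on $M$ (so $M$ is parallelizable and orientable). Fix an orientation and work only in local coordinates with that orientation. Coframe: $\mathbf V_{k\beta}:=g_{\beta\gamma}V_k{}^\gamma$. Relative orientation: $\mathbf c:=\operatorname{sgn}\det V_j{}^\alpha$, equivalently $\mathbf c=-\frac i2\sqrt{\det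 g_{\alpha\beta}}\operatorname{tr}\bigl((A_1)_{\xi_1}(A_1)_{\xi_2}(A_1)_{\xi_3}\bigr)$. Teleparallel connection: the affine connection with $\nabla_\mu V_j{}^\alpha=0$, where $\nabla_\mu v^\alpha=\partial v^\alpha/\partial x^\mu+\Gamma^\alpha{}_{\mu\beta}v^\beta$, so that $\Gamma^\alpha{}_{\mu\beta}=V_k{}^\alpha\,\partial\mathbf V_{k\beta}/\partial x^\mu$. Torsion: $T^\alpha{}_{\beta\gamma}:=\Gamma^\alpha{}_{\beta\gamma}-\Gamma^\alpha{}_{\gamma\beta}$. Hodge-dualised torsion: $\overset{*}T{}^\alpha{}_\beta:=\frac12T^{\alpha\gamma\delta}\varepsilon_{\gamma\delta\beta}\sqrt{\det g_{\mu\nu}}$, with $\varepsilon$ totally antisymmetric, $\varepsilon_{123}=+1$. *)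

theory Defs
  imports "HOL-Analysis.Analysis"
begin

section \<open>Smooth maps\<close>

primrec Ck_on :: "nat \<Rightarrow> ('a::real_normed_vector \<Rightarrow> 'b::real_normed_vector) \<Rightarrow> 'a set \<Rightarrow> bool"
  where
    "Ck_on 0 f S = continuous_on S f"
  | "Ck_on (Suc k) f S =
      ((\<forall>x\<in>S. f differentiable (at x)) \<and>
       (\<forall>u. Ck_on k (\<lambda>x. frechet_derivative f (at x) u) S))"

text \<open>Only used for open sets in finite-dimensional spaces, where controlling all
  directional derivatives of all orders is the same as being of class \<open>C\<^sup>\<infinity>\<close>.\<close>

definition smooth_on :: "('a::real_normed_vector \<Rightarrow> 'b::real_normed_vector) \<Rightarrow> 'a set \<Rightarrow> bool"
  where "smooth_on f S \<longleftrightarrow> (\<forall>k. Ck_on k f S)"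

definition pderiv_at :: "3 \<Rightarrow> (real^3 \<Rightarrow> 'b::real_normed_vector) \<Rightarrow> real^3 \<Rightarrow> 'b"
  where "pderiv_at \<alpha> f x = frechet_derivative f (at x) (axis \<alpha> 1)"


section \<open>Smooth 3-manifolds without boundary\<close>

text \<open>A chart is a domain together with a coordinate map, of which only the values on the domain
  matter.  The manifold is a subset \<open>M\<close> of a Hausdorff space with the subspace topology.\<close>

type_synonym 'm chart = "'m set \<times> ('m \<Rightarrow> real^3)"

definition cod :: "'m chart \<Rightarrow> (real^3) set"
  where "cod c = snd c ` fst c"

definition is_chart :: "'m::topological_space set \<Rightarrow> 'm chart \<Rightarrow> bool"
  where "is_chart M c \<longleftrightarrow>
    openin (top_of_set M) (fst c) \<and> open (cod c) \<and>
    (\<exists>\<psi>. homeomorphism (fst c) (cod c) (snd c) \<psi>)"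

definition transition :: "'m chart \<Rightarrow> 'm chart \<Rightarrow> real^3 \<Rightarrow> real^3"
  where "transition c d = snd d \<circ> inv_into (fst c) (snd c)"

definition jacobian_det :: "'m chart \<Rightarrow> 'm chart \<Rightarrow> real^3 \<Rightarrow> real"
  where "jacobian_det c d x = det (matrix (frechet_derivative (transition c d) (at x)))"

definition compatible :: "'m chart \<Rightarrow> 'm chart \<Rightarrow> bool"
  where "compatible c d \<longleftrightarrow>
    smooth_on (transition c d) (snd c ` (fst c \<inter> fst d)) \<and>
    smooth_on (transition d c) (snd d ` (fst c \<inter> fst d))"

text \<open>A smooth structure is a maximal atlas.\<close>

definition smooth_structure :: "'m::topological_space set \<Rightarrow> 'm chart set \<Rightarrow> bool"
  where "smooth_structure M \<A> \<longleftrightarrow>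
    (\<forall>c\<in>\<A>. is_chart M c) \<and>
    (\<Union>c\<in>\<A>. fst c) = M \<and>
    (\<forall>c\<in>\<A>. \<forall>d\<in>\<A>. compatible c d) \<and>
    (\<forall>c. is_chart M c \<and> (\<forall>d\<in>\<A>. compatible c d) \<longrightarrow> c \<in> \<A>)"

definition orientation :: "'m set \<Rightarrow> 'm chart set \<Rightarrow> 'm chart set \<Rightarrow> bool"
  where "orientation M \<A> \<O> \<longleftrightarrow>
    \<O> \<subseteq> \<A> \<and> (\<Union>c\<in>\<O>. fst c) = M \<and>
    (\<forall>c\<in>\<O>. \<forall>d\<in>\<O>. \<forall>p\<in>fst c \<inter> fst d. jacobian_det c d (snd c p) > 0)"


section \<open>Half-densities\<close>

text \<open>Geometric objects are given by their coordinate representations, one for every chart;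
  the values outside the range \<open>cod c\<close> of the chart are irrelevant.\<close>

definition half_density :: "'m chart set \<Rightarrow> ('m chart \<Rightarrow> real^3 \<Rightarrow> complex^2) \<Rightarrow> bool"
  where "half_density \<A> v \<longleftrightarrow>
    (\<forall>c\<in>\<A>. \<forall>d\<in>\<A>. \<forall>p\<in>fst c \<inter> fst d.
       v c (snd c p) = sqrt \<bar>jacobian_det c d (snd c p)\<bar> *\<^sub>R v d (snd d p))"

definition smooth_half_density ::
    "'m chart set \<Rightarrow> ('m chart \<Rightarrow> real^3 \<Rightarrow> complex^2) \<Rightarrow> bool"
  where "smooth_half_density \<A> v \<longleftrightarrow>
    half_density \<A> v \<and> (\<forall>c\<in>\<A>. smooth_on (v c) (cod c))"

text \<open>Integral of a 1-density over a compact manifold: cut \<open>M\<close> into finitely many pieces, each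
  contained in a chart domain (here: a finite chart cover, made disjoint), and add up the coordinate
  integrals.  By the change of variables formula the choice of the cover does not matter.\<close>

definition density_integral ::
    "'m set \<Rightarrow> 'm chart set \<Rightarrow> ('m chart \<Rightarrow> real^3 \<Rightarrow> complex) \<Rightarrow> complex"
  where "density_integral M \<A> \<rho> =
    (let cs = (SOME cs. set cs \<subseteq> \<A> \<and> M \<subseteq> (\<Union>c\<in>set cs. fst c)) in
     \<Sum>k<length cs.
       integral (snd (cs ! k) ` (fst (cs ! k) - (\<Union>c\<in>set (take k cs). fst c))) (\<rho> (cs ! k)))"

definition vcnj :: "complex^'n \<Rightarrow> complex^'n"
  where "vcnj v = (\<chi> i. cnj (v $ i))"

text \<open>Row times column, without conjugation.\<close>

definition rowcol :: "complex^'n \<Rightarrow> complex^'n \<Rightarrow> complex"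
  where "rowcol u w = (\<Sum>i\<in>UNIV. u $ i * w $ i)"

definition hd_inner ::
    "'m set \<Rightarrow> 'm chart set \<Rightarrow> ('m chart \<Rightarrow> real^3 \<Rightarrow> complex^2) \<Rightarrow>
     ('m chart \<Rightarrow> real^3 \<Rightarrow> complex^2) \<Rightarrow> complex"
  where "hd_inner M \<A> v w = density_integral M \<A> (\<lambda>c x. rowcol (vcnj (w c x)) (v c x))"


section \<open>First order differential operators and their symbols\<close>

definition cscale :: "complex \<Rightarrow> complex^'n^'m \<Rightarrow> complex^'n^'m"
  where "cscale a A = (\<chi> i j. a * A $ i $ j)"

text \<open>In each chart \<open>c\<close> the operator is \<open>F c \<alpha> \<partial>/\<partial>x\<^sup>\<alpha> + G c\<close>.\<close>

definition diff_op ::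
    "('m chart \<Rightarrow> 3 \<Rightarrow> real^3 \<Rightarrow> complex^2^2) \<Rightarrow> ('m chart \<Rightarrow> real^3 \<Rightarrow> complex^2^2) \<Rightarrow>
     ('m chart \<Rightarrow> real^3 \<Rightarrow> complex^2) \<Rightarrow> 'm chart \<Rightarrow> real^3 \<Rightarrow> complex^2"
  where "diff_op F G v c x =
    (\<Sum>\<alpha>\<in>UNIV. F c \<alpha> x *v pderiv_at \<alpha> (v c) x) + G c x *v v c x"

definition first_order_operator ::
    "'m chart set \<Rightarrow> ('m chart \<Rightarrow> 3 \<Rightarrow> real^3 \<Rightarrow> complex^2^2) \<Rightarrow>
     ('m chart \<Rightarrow> real^3 \<Rightarrow> complex^2^2) \<Rightarrow> bool"
  where "first_order_operator \<A> F G \<longleftrightarrow>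
    (\<forall>c\<in>\<A>. (\<forall>\<alpha>. smooth_on (F c \<alpha>) (cod c)) \<and> smooth_on (G c) (cod c)) \<and>
    (\<forall>v. smooth_half_density \<A> v \<longrightarrow> half_density \<A> (diff_op F G v))"

definition self_adjoint ::
    "'m set \<Rightarrow> 'm chart set \<Rightarrow> ('m chart \<Rightarrow> 3 \<Rightarrow> real^3 \<Rightarrow> complex^2^2) \<Rightarrow>
     ('m chart \<Rightarrow> real^3 \<Rightarrow> complex^2^2) \<Rightarrow> bool"
  where "self_adjoint M \<A> F G \<longleftrightarrow>
    (\<forall>v w. smooth_half_density \<A> v \<longrightarrow> smooth_half_density \<A> w \<longrightarrow>
       hd_inner M \<A> (diff_op F G v) w = hd_inner M \<A> v (diff_op F G w))"

text \<open>The full symbol arises from \<open>\<partial>/\<partial>x\<^sup>\<alpha> \<mapsto> \<i> \<xi>\<^sub>\<alpha>\<close>; its part of degree 1 in \<open>\<xi>\<close> is the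
  principal symbol, and its part of degree 0 is \<open>G c x\<close>.\<close>

definition principal_symbol ::
    "(3 \<Rightarrow> real^3 \<Rightarrow> complex^2^2) \<Rightarrow> real^3 \<Rightarrow> real^3 \<Rightarrow> complex^2^2"
  where "principal_symbol Fc x \<xi> = (\<Sum>\<alpha>\<in>UNIV. cscale (\<i> * of_real (\<xi> $ \<alpha>)) (Fc \<alpha> x))"

definition elliptic ::
    "'m chart set \<Rightarrow> ('m chart \<Rightarrow> 3 \<Rightarrow> real^3 \<Rightarrow> complex^2^2) \<Rightarrow> bool"
  where "elliptic \<A> F \<longleftrightarrow>
    (\<forall>c\<in>\<A>. \<forall>x\<in>cod c. \<forall>\<xi>. \<xi> \<noteq> 0 \<longrightarrow> det (principal_symbol (F c) x \<xi>) \<noteq> 0)"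

definition trace_free_symbol ::
    "'m chart set \<Rightarrow> ('m chart \<Rightarrow> 3 \<Rightarrow> real^3 \<Rightarrow> complex^2^2) \<Rightarrow> bool"
  where "trace_free_symbol \<A> F \<longleftrightarrow>
    (\<forall>c\<in>\<A>. \<forall>x\<in>cod c. \<forall>\<xi>. trace (principal_symbol (F c) x \<xi>) = 0)"

text \<open>From here on everything happens in one fixed chart, with \<open>A1\<close> the principal symbol and
  \<open>A0\<close> the zero order part of the full symbol.\<close>

text \<open>\<open>A1\<close> is linear in \<open>\<xi>\<close>, so its \<open>\<xi>\<close>-derivatives may be taken at \<open>\<xi> = 0\<close>.\<close>

definition subprincipal ::
    "(real^3 \<Rightarrow> real^3 \<Rightarrow> complex^2^2) \<Rightarrow> (real^3 \<Rightarrow> complex^2^2) \<Rightarrow> real^3 \<Rightarrow> complex^2^2"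
  where "subprincipal A1 A0 x =
    A0 x + cscale (\<i> / 2) (\<Sum>\<alpha>\<in>UNIV. pderiv_at \<alpha> (\<lambda>y. pderiv_at \<alpha> (A1 y) 0) x)"


section \<open>Brackets\<close>

definition dx :: "3 \<Rightarrow> ((real^3) \<times> (real^3) \<Rightarrow> 'b::real_normed_vector) \<Rightarrow> real^3 \<Rightarrow> real^3 \<Rightarrow> 'b"
  where "dx \<alpha> P x \<xi> = pderiv_at \<alpha> (\<lambda>y. P (y, \<xi>)) x"

definition dxi :: "3 \<Rightarrow> ((real^3) \<times> (real^3) \<Rightarrow> 'b::real_normed_vector) \<Rightarrow> real^3 \<Rightarrow> real^3 \<Rightarrow> 'b"
  where "dxi \<alpha> P x \<xi> = pderiv_at \<alpha> (\<lambda>\<eta>. P (x, \<eta>)) \<xi>"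

text \<open>The first argument is row-valued, the last one column-valued.\<close>

definition poisson ::
    "((real^3) \<times> (real^3) \<Rightarrow> complex^2) \<Rightarrow> ((real^3) \<times> (real^3) \<Rightarrow> complex^2) \<Rightarrow>
     real^3 \<Rightarrow> real^3 \<Rightarrow> complex"
  where "poisson P R x \<xi> =
    (\<Sum>\<alpha>\<in>UNIV. rowcol (dx \<alpha> P x \<xi>) (dxi \<alpha> R x \<xi>) - rowcol (dxi \<alpha> P x \<xi>) (dx \<alpha> R x \<xi>))"

definition gen_poisson ::
    "((real^3) \<times> (real^3) \<Rightarrow> complex^2) \<Rightarrow> ((real^3) \<times> (real^3) \<Rightarrow> complex^2^2) \<Rightarrow>
     ((real^3) \<times> (real^3) \<Rightarrow> complex^2) \<Rightarrow> real^3 \<Rightarrow> real^3 \<Rightarrow> complex"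
  where "gen_poisson P Q R x \<xi> =
    (\<Sum>\<alpha>\<in>UNIV. rowcol (dx \<alpha> P x \<xi>) (Q (x, \<xi>) *v dxi \<alpha> R x \<xi>)
           - rowcol (dxi \<alpha> P x \<xi>) (Q (x, \<xi>) *v dx \<alpha> R x \<xi>))"


section \<open>The second asymptotic coefficient\<close>

definition hplus :: "(real^3 \<Rightarrow> real^3 \<Rightarrow> complex^2^2) \<Rightarrow> real^3 \<Rightarrow> real^3 \<Rightarrow> real"
  where "hplus A1 x \<xi> =
    (THE h. h > 0 \<and> (\<exists>u. u \<noteq> 0 \<and> A1 x \<xi> *v u = of_real h *s u))"

text \<open>The normalised eigenvector field need not have a smooth choice on all of \<open>\<xi> \<noteq> 0\<close>, so it is
  chosen smoothly near each single point.  The phase factor left open by the choice does not affect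
  the integrand of \<open>b_coeff\<close>.\<close>

definition vplus_near ::
    "(real^3 \<Rightarrow> real^3 \<Rightarrow> complex^2^2) \<Rightarrow> real^3 \<Rightarrow> real^3 \<Rightarrow> ((real^3) \<times> (real^3) \<Rightarrow> complex^2)"
  where "vplus_near A1 x \<xi> =
    (SOME v. \<exists>N. open N \<and> (x, \<xi>) \<in> N \<and> smooth_on v N \<and>
       (\<forall>(y, \<eta>)\<in>N. A1 y \<eta> *v v (y, \<eta>) = of_real (hplus A1 y \<eta>) *s v (y, \<eta>) \<and>
                    norm (v (y, \<eta>)) = 1))"

definition b_integrand ::
    "(real^3 \<Rightarrow> real^3 \<Rightarrow> complex^2^2) \<Rightarrow> (real^3 \<Rightarrow> complex^2^2) \<Rightarrow> real^3 \<Rightarrow> real^3 \<Rightarrow> complex"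
  where "b_integrand A1 A0 x \<xi> =
    (let v = vplus_near A1 x \<xi>;
         v' = (\<lambda>z. vcnj (v z));
         h = of_real (hplus A1 x \<xi>);
         Q = (\<lambda>(y, \<eta>). A1 y \<eta> - mat (of_real (hplus A1 y \<eta>)))
     in rowcol (v' (x, \<xi>)) (subprincipal A1 A0 x *v v (x, \<xi>))
        - \<i> / 2 * gen_poisson v' Q v x \<xi>
        + \<i> / (3 - 1) * h * poisson v' v x \<xi>)"

text \<open>The point \<open>\<xi> = 0\<close>, where \<open>A1\<close> has no positive eigenvalue, is a null set.\<close>

definition b_coeff ::
    "(real^3 \<Rightarrow> real^3 \<Rightarrow> complex^2^2) \<Rightarrow> (real^3 \<Rightarrow> complex^2^2) \<Rightarrow> real^3 \<Rightarrow> complex"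
  where "b_coeff A1 A0 x =
    - 3 * integral {\<xi>. \<xi> \<noteq> 0 \<and> hplus A1 x \<xi> < 1}
            (\<lambda>\<xi>. b_integrand A1 A0 x \<xi> * of_real (1 / (2 * pi) ^ 3))"


section \<open>Metric, frame and torsion\<close>

text \<open>The contravariant metric tensor \<open>g\<^sup>\<alpha>\<^sup>\<beta>\<close>.\<close>

definition metric_contra :: "(real^3 \<Rightarrow> real^3 \<Rightarrow> complex^2^2) \<Rightarrow> real^3 \<Rightarrow> real^3^3"
  where "metric_contra A1 x =
    (THE G. transpose G = G \<and>
       (\<forall>\<xi>. det (A1 x \<xi>) = - of_real (\<Sum>\<alpha>\<in>UNIV. \<Sum>\<beta>\<in>UNIV. G $ \<alpha> $ \<beta> * \<xi> $ \<alpha> * \<xi> $ \<beta>)))"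

definition metric_cov :: "(real^3 \<Rightarrow> real^3 \<Rightarrow> complex^2^2) \<Rightarrow> real^3 \<Rightarrow> real^3^3"
  where "metric_cov A1 x = matrix_inv (metric_contra A1 x)"

text \<open>\<open>frame A1 x $ j $ \<alpha>\<close> is \<open>V\<^sub>j\<^sup>\<alpha>(x)\<close>; the matrix \<open>\<sigma>\<^sup>\<alpha>\<close> is \<open>A1 x (axis \<alpha> 1)\<close>.\<close>

definition frame :: "(real^3 \<Rightarrow> real^3 \<Rightarrow> complex^2^2) \<Rightarrow> real^3 \<Rightarrow> real^3^3"
  where "frame A1 x = (\<chi> j \<alpha>. let \<sigma> = A1 x (axis \<alpha> 1) in
    if j = 1 then Re (\<sigma> $ 1 $ 2) else if j = 2 then - Im (\<sigma> $ 1 $ 2) else Re (\<sigma> $ 1 $ 1))"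

definition rel_orientation :: "(real^3 \<Rightarrow> real^3 \<Rightarrow> complex^2^2) \<Rightarrow> real^3 \<Rightarrow> real"
  where "rel_orientation A1 x = sgn (det (frame A1 x))"

text \<open>Connection coefficients and (1,2)-tensors are indexed as \<open>\<Gamma> \<alpha> \<mu> \<beta>\<close> for
  \<open>\<Gamma>\<^sup>\<alpha>\<^sub>\<mu>\<^sub>\<beta>\<close>.\<close>

definition covariant_deriv ::
    "(3 \<Rightarrow> 3 \<Rightarrow> 3 \<Rightarrow> real) \<Rightarrow> 3 \<Rightarrow> (real^3 \<Rightarrow> real^3) \<Rightarrow> real^3 \<Rightarrow> 3 \<Rightarrow> real"
  where "covariant_deriv \<Gamma> \<mu> v x \<alpha> =
    pderiv_at \<mu> (\<lambda>y. v y $ \<alpha>) x + (\<Sum>\<beta>\<in>UNIV. \<Gamma> \<alpha> \<mu> \<beta> * v x $ \<beta>)"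

definition teleparallel ::
    "(real^3 \<Rightarrow> real^3 \<Rightarrow> complex^2^2) \<Rightarrow> real^3 \<Rightarrow> 3 \<Rightarrow> 3 \<Rightarrow> 3 \<Rightarrow> real"
  where "teleparallel A1 x =
    (THE \<Gamma>. \<forall>\<mu> j \<alpha>. covariant_deriv \<Gamma> \<mu> (\<lambda>y. frame A1 y $ j) x \<alpha> = 0)"

definition torsion ::
    "(real^3 \<Rightarrow> real^3 \<Rightarrow> complex^2^2) \<Rightarrow> real^3 \<Rightarrow> 3 \<Rightarrow> 3 \<Rightarrow> 3 \<Rightarrow> real"
  where "torsion A1 x \<alpha> \<beta> \<gamma> = teleparallel A1 x \<alpha> \<beta> \<gamma> - teleparallel A1 x \<alpha> \<gamma> \<beta>"

definition torsion_raised ::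
    "(real^3 \<Rightarrow> real^3 \<Rightarrow> complex^2^2) \<Rightarrow> real^3 \<Rightarrow> 3 \<Rightarrow> 3 \<Rightarrow> 3 \<Rightarrow> real"
  where "torsion_raised A1 x \<alpha> \<gamma> \<delta> =
    (\<Sum>\<mu>\<in>UNIV. \<Sum>\<nu>\<in>UNIV.
       metric_contra A1 x $ \<gamma> $ \<mu> * metric_contra A1 x $ \<delta> $ \<nu> * torsion A1 x \<alpha> \<mu> \<nu>)"

definition levi_civita :: "3 \<Rightarrow> 3 \<Rightarrow> 3 \<Rightarrow> real"
  where "levi_civita a b c =
    (if (a, b, c) \<in> {(1, 2, 3), (2, 3, 1), (3, 1, 2)} then 1
     else if (a, b, c) \<in> {(2, 1, 3), (1, 3, 2), (3, 2, 1)} then - 1 else 0)"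

definition dual_torsion :: "(real^3 \<Rightarrow> real^3 \<Rightarrow> complex^2^2) \<Rightarrow> real^3 \<Rightarrow> real^3^3"
  where "dual_torsion A1 x = (\<chi> \<alpha> \<beta>.
    1 / 2 * (\<Sum>\<gamma>\<in>UNIV. \<Sum>\<delta>\<in>UNIV. torsion_raised A1 x \<alpha> \<gamma> \<delta> * levi_civita \<gamma> \<delta> \<beta>)
      * sqrt (det (metric_cov A1 x)))"

end

theory Submission
  imports Defs
begin

text \<open>Self-adjointness makes the coefficients of the derivatives skew-Hermitian, so in a chart
  \<open>A\<^sub>1(x, \<xi>) = \<sigma>\<^sub>j w\<^sub>j\<close> with the Pauli matrices \<open>\<sigma>\<^sub>j\<close>, \<open>w = V(x) \<xi>\<close> and \<open>V\<close> the frame; hence \<open>h\<^sup>+ = |w|\<close>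
  and \<open>v\<^sup>+\<close> is the spinor with Bloch vector \<open>w/|w|\<close>.  Both brackets reduce to the Berry curvature of
  \<open>v\<^sup>+\<close>, which is a triple product of the Bloch vector and its derivatives, and the integrand of \<open>b\<close>
  becomes half the trace of \<open>A\<^sub>s\<^sub>u\<^sub>b\<close>, plus an odd function of \<open>w\<close>, minus three quarters of
  \<open>w \<cdot> (w\<^sub>x \<times> w\<^sub>\<xi>) / |w|\<^sup>2\<close>.  After the substitution \<open>\<xi> \<mapsto> w\<close> the last term is a quadratic form in the
  direction of \<open>w\<close>, whose average over the ball is a third of its trace, and this trace is the trace of
  the dual torsion up to the sign of \<open>det V\<close>.\<close>

section \<open>Calculus of smooth maps\<close>

text \<open>Two objects are given only as unknown choices. One is the finite cover inside
  \<open>density_integral\<close>, through which self-adjointness is expressed: its pieces may cut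
  through any chart domain. Test half-densities are therefore supported in an open set lying in a
  single piece, where an inner product is one coordinate integral of a continuous function with
  compact support. The other is the eigenvector. It has no smooth choice on all of \<xi> \<noteq> 0,
  since over the sphere of directions it spans a nontrivial line bundle, so only its first
  derivatives at one point are used. They are traced back to w = |w| n with n the Bloch vector: a
  derivative of w fixes that of n up to a multiple of n, and triple products with n do not see such
  multiples. This removes the eigenvector together with its phase and leaves an expression in
  \<open>V\<close> and its first derivatives. That expression is homogeneous of degree 0 in w, like
  the expectation of the subprincipal symbol, so only averages over directions matter.\<close>

lemma Ck_on_imp_continuous_on: "Ck_on k f S \<Longrightarrow> continuous_on S f"
  by (cases k) (auto intro!: continuous_at_imp_continuous_on differentiable_imp_continuous_within)

lemma Ck_on_SucD: "Ck_on (Suc k) f S \<Longrightarrow> Ck_on k f S"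
proof (induction k arbitrary: f)
  case 0
  then show ?case using Ck_on_imp_continuous_on[of "Suc 0" f S] by simp
next
  case (Suc k)
  then show ?case by simp
qed

lemma Ck_on_subset: "Ck_on k f S \<Longrightarrow> T \<subseteq> S \<Longrightarrow> Ck_on k f T"
  by (induction k arbitrary: f) (auto intro: continuous_on_subset)

lemma has_derivative_cong_open:
  assumes "open S" "x \<in> S" "\<And>y. y \<in> S \<Longrightarrow> f y = g y"
  shows "(f has_derivative D) (at x) \<longleftrightarrow> (g has_derivative D) (at x)"
  using has_derivative_transform_within_open[OF _ assms(1,2), of f D UNIV g]
    has_derivative_transform_within_open[OF _ assms(1,2), of g D UNIV f] assms(3)
  by auto

lemma differentiable_cong_open:
  assumes "open S" "x \<in> S" "\<And>y. y \<in> S \<Longrightarrow> f y = g y"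
  shows "f differentiable (at x) \<longleftrightarrow> g differentiable (at x)"
proof -
  have "(f has_derivative D) (at x) \<longleftrightarrow> (g has_derivative D) (at x)" for D
    by (rule has_derivative_cong_open[OF assms])
  then show ?thesis by (simp add: differentiable_def)
qed

lemma frechet_derivative_cong_open:
  assumes "open S" "x \<in> S" "\<And>y. y \<in> S \<Longrightarrow> f y = g y"
  shows "frechet_derivative f (at x) = frechet_derivative g (at x)"
proof -
  have "(f has_derivative D) (at x) \<longleftrightarrow> (g has_derivative D) (at x)" for D
    by (rule has_derivative_cong_open[OF assms])
  then show ?thesis by (simp add: frechet_derivative_def)
qed

text \<open>\<open>Ck_on\<close> takes derivatives over full neighbourhoods, hence depends only on
  germs at the points of \<open>S\<close>. This lets functions pieced together by \<open>if\<close>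
  be treated piece by piece.\<close>

lemma Ck_on_local:
  assumes "\<And>x. x \<in> S \<Longrightarrow> \<exists>N g. open N \<and> x \<in> N \<and> Ck_on k g N \<and> (\<forall>y\<in>N. f y = g y)"
  shows "Ck_on k f S"
  using assms
proof (induction k arbitrary: f)
  case 0
  show ?case unfolding Ck_on.simps
  proof (rule continuous_at_imp_continuous_on, rule ballI)
    fix x assume "x \<in> S"
    from 0[OF this] obtain N g where "open N" "x \<in> N" "continuous_on N g" "\<forall>y\<in>N. f y = g y"
      unfolding Ck_on.simps by blast
    then have "continuous_on N f" using continuous_on_cong[of N N f g] by simp
    then show "isCont f x"
      using \<open>open N\<close> \<open>x \<in> N\<close> continuous_on_eq_continuous_at by blast
  qed
next
  case (Suc k)
  show ?case unfolding Ck_on.simps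
  proof (intro conjI ballI allI)
    fix x assume "x \<in> S"
    then obtain N g where "open N" "x \<in> N" "Ck_on (Suc k) g N" "\<forall>y\<in>N. f y = g y"
      using Suc.prems by blast
    then show "f differentiable at x"
      using differentiable_cong_open[of N x f g] by auto
  next
    fix u
    show "Ck_on k (\<lambda>x. frechet_derivative f (at x) u) S"
    proof (rule Suc.IH)
      fix x assume "x \<in> S"
      then obtain N g where "open N" "x \<in> N" "Ck_on (Suc k) g N" "\<forall>y\<in>N. f y = g y"
        using Suc.prems by blast
      then show "\<exists>N g. open N \<and> x \<in> N \<and> Ck_on k g N \<and> (\<forall>y\<in>N. frechet_derivative f (at y) u = g y)"
        using frechet_derivative_cong_open[of N _ f g]
        by (intro exI[of _ N] exI[of _ "\<lambda>y. frechet_derivative g (at y) u"]) auto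
    qed
  qed
qed

lemma Ck_on_cong:
  assumes "open S" "Ck_on k g S" "\<And>x. x \<in> S \<Longrightarrow> f x = g x"
  shows "Ck_on k f S"
  using assms by (intro Ck_on_local) blast

text \<open>Inductions over \<open>k\<close> go through this rule: an explicit derivative, built
  from terms the induction hypothesis covers, takes the place of
  \<open>frechet_derivative\<close>.\<close>

lemma Ck_on_SucI:
  assumes "open S" "\<And>x. x \<in> S \<Longrightarrow> (f has_derivative D x) (at x)"
    and "\<And>u. Ck_on k (\<lambda>x. D x u) S"
  shows "Ck_on (Suc k) f S"
  unfolding Ck_on.simps
proof (intro conjI ballI allI)
  fix x assume "x \<in> S" then show "f differentiable at x"
    using assms(2) differentiable_def by blast
next
  fix u show "Ck_on k (\<lambda>x. frechet_derivative f (at x) u) S"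
    by (rule Ck_on_cong[OF assms(1) assms(3)[of u]])
      (metis assms(2) frechet_derivative_at)
qed

lemma Ck_on_has_derivative:
  assumes "Ck_on (Suc k) f S" "x \<in> S"
  shows "(f has_derivative frechet_derivative f (at x)) (at x)"
  using assms by (simp add: frechet_derivative_works)

lemma Ck_on_const: "open S \<Longrightarrow> Ck_on k (\<lambda>x. c) S"
proof (induction k arbitrary: c)
  case (Suc k)
  then show ?case by (intro Ck_on_SucI[where D="\<lambda>x u. 0"]) auto
qed simp

lemma Ck_on_bounded_linear:
  assumes "bounded_linear L" "open S" shows "Ck_on k L S"
proof (cases k)
  case 0
  then show ?thesis using assms(1) linear_continuous_on by auto
next
  case (Suc m)
  show ?thesis unfolding Suc
    by (rule Ck_on_SucI[where D="\<lambda>x. L"])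
      (auto simp: assms bounded_linear_imp_has_derivative Ck_on_const)
qed

lemma Ck_on_add:
  assumes "open S" "Ck_on k f S" "Ck_on k g S"
  shows "Ck_on k (\<lambda>x. f x + g x) S"
  using assms(2,3)
proof (induction k arbitrary: f g)
  case 0 then show ?case by (auto intro: continuous_on_add)
next
  case (Suc k)
  show ?case
    by (rule Ck_on_SucI[where D="\<lambda>x u. frechet_derivative f (at x) u + frechet_derivative g (at x) u"])
      (use Suc assms(1) in \<open>auto intro!: derivative_intros Ck_on_has_derivative\<close>)
qed

lemma Ck_on_sum:
  assumes "open S" "\<And>i. i \<in> I \<Longrightarrow> Ck_on k (f i) S"
  shows "Ck_on k (\<lambda>x. \<Sum>i\<in>I. f i x) S"
  using assms(2)
  by (induction I rule: infinite_finite_induct) (auto intro: Ck_on_add Ck_on_const assms(1))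

lemma Ck_on_bilinear:
  assumes B: "bounded_bilinear B" and S: "open S" and "Ck_on k f S" "Ck_on k g S"
  shows "Ck_on k (\<lambda>x. B (f x) (g x)) S"
  using assms(3,4)
proof (induction k arbitrary: f g)
  case 0 then show ?case by (auto intro: bounded_bilinear.continuous_on[OF B])
next
  case (Suc k)
  show ?case
  proof (rule Ck_on_SucI[where D="\<lambda>x u. B (f x) (frechet_derivative g (at x) u) +
        B (frechet_derivative f (at x) u) (g x)"], fact)
    fix x assume "x \<in> S"
    then show "((\<lambda>x. B (f x) (g x)) has_derivative
         (\<lambda>u. B (f x) (frechet_derivative g (at x) u) + B (frechet_derivative f (at x) u) (g x))) (at x)"
      by (intro bounded_bilinear.FDERIV[OF B] Ck_on_has_derivative[OF Suc.prems(1)]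
          Ck_on_has_derivative[OF Suc.prems(2)])
  next
    fix u
    show "Ck_on k (\<lambda>x. B (f x) (frechet_derivative g (at x) u) +
        B (frechet_derivative f (at x) u) (g x)) S"
      by (intro Ck_on_add Suc.IH S Ck_on_SucD[OF Suc.prems(1)] Ck_on_SucD[OF Suc.prems(2)])
        (use Suc.prems in auto)
  qed
qed

text \<open>The chain rule is written as a finite sum over a basis because \<open>Ck_on\<close>
  controls \<open>g\<close> in fixed directions only. Each
  \<open>frechet_derivative g (at (f x)) b\<close> is again a composite with \<open>f\<close>, so
  the induction runs over all \<open>g\<close>.\<close>

lemma Ck_on_compose:
  fixes f :: "'a::real_normed_vector \<Rightarrow> 'b::euclidean_space"
  assumes S: "open S" and fS: "f ` S \<subseteq> T" and "Ck_on k f S" "Ck_on k g T"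
  shows "Ck_on k (\<lambda>x. g (f x)) S"
  using assms(3,4)
proof (induction k arbitrary: g)
  case 0 then show ?case using continuous_on_compose2[OF _ _ fS] by auto
next
  case (Suc k)
  let ?D = "\<lambda>x u. \<Sum>b\<in>Basis. (frechet_derivative f (at x) u \<bullet> b) *\<^sub>R frechet_derivative g (at (f x)) b"
  show ?case
  proof (rule Ck_on_SucI[where D="?D"], fact)
    fix x assume x: "x \<in> S"
    have g: "(g has_derivative frechet_derivative g (at (f x))) (at (f x))"
      by (rule Ck_on_has_derivative[OF Suc.prems(2)]) (use x fS in auto)
    have f: "(f has_derivative frechet_derivative f (at x)) (at x)"
      by (rule Ck_on_has_derivative[OF Suc.prems(1) x])
    have e: "frechet_derivative g (at (f x)) y = (\<Sum>b\<in>Basis. (y \<bullet> b) *\<^sub>R frechet_derivative g (at (f x)) b)" for y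
      by (subst (1) euclidean_representation[of y, symmetric])
        (simp add: linear_sum[OF has_derivative_linear[OF g]] linear_scale[OF has_derivative_linear[OF g]])
    show "((\<lambda>x. g (f x)) has_derivative ?D x) (at x)"
      by (rule has_derivative_eq_rhs[OF has_derivative_compose[OF f g]]) (intro ext, rule e)
  next
    fix u
    show "Ck_on k (\<lambda>x. ?D x u) S"
    proof (intro Ck_on_sum S Ck_on_bilinear[OF bounded_bilinear_scaleR])
      fix b :: 'b
      show "Ck_on k (\<lambda>x. frechet_derivative f (at x) u \<bullet> b) S"
        by (rule Ck_on_bilinear[OF bounded_bilinear_inner]) (use Suc.prems S Ck_on_const in auto)
      show "Ck_on k (\<lambda>x. frechet_derivative g (at (f x)) b) S"
        by (rule Suc.IH) (use Suc.prems Ck_on_SucD in auto)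
    qed
  qed
qed

section \<open>Closure properties of smooth maps\<close>

lemma smooth_on_imp_continuous_on: "smooth_on f S \<Longrightarrow> continuous_on S f"
  using Ck_on_imp_continuous_on smooth_on_def by blast

lemma smooth_on_has_derivative:
  "smooth_on f S \<Longrightarrow> x \<in> S \<Longrightarrow> (f has_derivative frechet_derivative f (at x)) (at x)"
  using Ck_on_has_derivative smooth_on_def by blast

lemma smooth_on_frechet_derivative:
  "smooth_on f S \<Longrightarrow> smooth_on (\<lambda>x. frechet_derivative f (at x) u) S"
  unfolding smooth_on_def by (metis Ck_on.simps(2))

lemma smooth_on_subset: "smooth_on f S \<Longrightarrow> T \<subseteq> S \<Longrightarrow> smooth_on f T"
  unfolding smooth_on_def by (auto intro: Ck_on_subset)

lemma smooth_on_local: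
  assumes "\<And>x. x \<in> S \<Longrightarrow> \<exists>N g. open N \<and> x \<in> N \<and> smooth_on g N \<and> (\<forall>y\<in>N. f y = g y)"
  shows "smooth_on f S"
  unfolding smooth_on_def
proof (intro allI Ck_on_local)
  fix k x assume "x \<in> S"
  from assms[OF this] show "\<exists>N g. open N \<and> x \<in> N \<and> Ck_on k g N \<and> (\<forall>y\<in>N. f y = g y)"
    unfolding smooth_on_def by blast
qed

lemma smooth_on_cong:
  assumes "open S" "smooth_on g S" "\<And>x. x \<in> S \<Longrightarrow> f x = g x"
  shows "smooth_on f S"
  using assms(2,3) Ck_on_cong[OF assms(1), of _ g f] unfolding smooth_on_def by blast

lemma smooth_on_const: "open S \<Longrightarrow> smooth_on (\<lambda>x. c) S"
  by (simp add: smooth_on_def Ck_on_const)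

lemma smooth_on_bounded_linear: "bounded_linear L \<Longrightarrow> open S \<Longrightarrow> smooth_on L S"
  by (simp add: smooth_on_def Ck_on_bounded_linear)

lemma smooth_on_add: "open S \<Longrightarrow> smooth_on f S \<Longrightarrow> smooth_on g S \<Longrightarrow> smooth_on (\<lambda>x. f x + g x) S"
  by (simp add: smooth_on_def Ck_on_add)

lemma smooth_on_sum:
  "open S \<Longrightarrow> (\<And>i. i \<in> I \<Longrightarrow> smooth_on (f i) S) \<Longrightarrow> smooth_on (\<lambda>x. \<Sum>i\<in>I. f i x) S"
  by (simp add: smooth_on_def Ck_on_sum)

lemma smooth_on_bilinear:
  "bounded_bilinear B \<Longrightarrow> open S \<Longrightarrow> smooth_on f S \<Longrightarrow> smooth_on g S \<Longrightarrow> smooth_on (\<lambda>x. B (f x) (g x)) S"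
  by (simp add: smooth_on_def Ck_on_bilinear)

lemmas smooth_on_scaleR = smooth_on_bilinear[OF bounded_bilinear_scaleR]
lemmas smooth_on_mult = smooth_on_bilinear[OF bounded_bilinear_mult]

lemma smooth_on_compose:
  fixes f :: "'a::real_normed_vector \<Rightarrow> 'b::euclidean_space"
  shows "open S \<Longrightarrow> f ` S \<subseteq> T \<Longrightarrow> smooth_on f S \<Longrightarrow> smooth_on g T \<Longrightarrow> smooth_on (\<lambda>x. g (f x)) S"
  by (simp add: smooth_on_def Ck_on_compose)

lemma smooth_on_linear_compose:
  fixes f :: "'a::real_normed_vector \<Rightarrow> 'b::euclidean_space"
  shows "open S \<Longrightarrow> bounded_linear L \<Longrightarrow> smooth_on f S \<Longrightarrow> smooth_on (\<lambda>x. L (f x)) S"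
  using smooth_on_compose[of S f UNIV L] smooth_on_bounded_linear by auto

lemma smooth_on_uminus:
  "open S \<Longrightarrow> smooth_on f S \<Longrightarrow> smooth_on (\<lambda>x. - f x :: 'b::euclidean_space) S"
  by (rule smooth_on_linear_compose[of S uminus f]) (auto intro: bounded_linear_minus bounded_linear_ident)

lemma smooth_on_diff:
  fixes f g :: "'a::real_normed_vector \<Rightarrow> 'b::euclidean_space"
  shows "open S \<Longrightarrow> smooth_on f S \<Longrightarrow> smooth_on g S \<Longrightarrow> smooth_on (\<lambda>x. f x - g x) S"
  using smooth_on_add[of S f "\<lambda>x. - g x"] smooth_on_uminus[of S g] by simp

text \<open>The derivative is again a power up to a constant, so the exponent is generalised. The
  exponents 1/2, 1/4 and -1/2 later give norms, square roots of Jacobians and normalisation.\<close>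

lemma Ck_on_powr: "Ck_on k (\<lambda>t::real. t powr a) {0<..}"
proof (induction k arbitrary: a)
  case 0 show ?case by (auto intro!: continuous_intros)
next
  case (Suc k)
  show ?case
  proof (rule Ck_on_SucI[where D="\<lambda>t u. (a * t powr (a - 1)) * u"])
    fix t :: real assume "t \<in> {0<..}"
    then show "((\<lambda>t. t powr a) has_derivative (\<lambda>u. (a * t powr (a - 1)) * u)) (at t)"
      using has_real_derivative_powr[of t a] by (simp add: has_field_derivative_def)
  next
    fix u show "Ck_on k (\<lambda>t. a * t powr (a - 1) * u) {0<..}"
      by (intro Ck_on_bilinear[OF bounded_bilinear_mult] Suc Ck_on_const) auto
  qed auto
qed

lemma smooth_on_powr:
  fixes f :: "'a::real_normed_vector \<Rightarrow> real"
  assumes "open S" "smooth_on f S" "\<And>x. x \<in> S \<Longrightarrow> f x > 0"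
  shows "smooth_on (\<lambda>x. f x powr a) S"
  using smooth_on_compose[of S f "{0<..}" "\<lambda>t. t powr a"] assms Ck_on_powr
  by (auto simp: smooth_on_def)

lemma smooth_on_vec_lambda:
  fixes f :: "'i::finite \<Rightarrow> 'a::real_normed_vector \<Rightarrow> 'b::euclidean_space"
  assumes "open S" "\<And>i. smooth_on (f i) S"
  shows "smooth_on (\<lambda>x. \<chi> i. f i x) S"
proof -
  have "(\<chi> i. f i x) = (\<Sum>i\<in>UNIV. axis i (f i x))" for x
    by (simp add: vec_eq_iff axis_def if_distrib cong: if_cong)
  moreover have "bounded_linear (axis i :: 'b \<Rightarrow> 'b^'i)" for i
    by (intro linear_conv_bounded_linear[THEN iffD1] linearI)
      (auto simp: vec_eq_iff axis_def)
  ultimately show ?thesis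
    by (simp only:) (intro smooth_on_sum assms(1) smooth_on_linear_compose[of S "axis _"] assms(2))
qed

lemma smooth_on_vec_nth:
  fixes f :: "'a::real_normed_vector \<Rightarrow> 'b::euclidean_space^'i::finite"
  shows "open S \<Longrightarrow> smooth_on f S \<Longrightarrow> smooth_on (\<lambda>x. f x $ i) S"
  by (rule smooth_on_linear_compose[of S "\<lambda>v. v $ i" f]) (auto intro: bounded_linear_vec_nth)

section \<open>A smooth bump function\<close>

text \<open>The polynomial factor in 1/t makes the family closed under differentiation;
  \<open>p = 1\<close> is the classical function exp(-1/t), flat at 0.\<close>

definition flat_exp :: "real poly \<Rightarrow> real \<Rightarrow> real"
  where "flat_exp p t = (if t > 0 then poly p (1 / t) * exp (- (1 / t)) else 0)"

lemma flat_exp_tendsto_0: "(flat_exp p \<longlongrightarrow> 0) (at_right 0)"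
proof -
  have "((\<lambda>s. poly p s * exp (- s)) \<longlongrightarrow> 0) at_top"
  proof -
    have "((\<lambda>s::real. \<Sum>i\<le>degree p. coeff p i * (s ^ i / exp s)) \<longlongrightarrow> (\<Sum>i\<le>degree p. coeff p i * 0)) at_top"
      by (intro tendsto_intros tendsto_power_div_exp_0)
    then show ?thesis
      by (simp add: poly_altdef exp_minus sum_divide_distrib divide_inverse[symmetric])
  qed
  then have "((\<lambda>t. poly p (1/t) * exp (- (1/t))) \<longlongrightarrow> 0) (at_right 0)"
    using filterlim_compose[OF _ filterlim_inverse_at_top_right, of "\<lambda>s. poly p s * exp (- s)"]
    by (simp add: inverse_eq_divide)
  then show ?thesis
    by (rule Lim_transform_eventually) (auto simp: flat_exp_def eventually_at_right_less eventually_at_filter)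
qed

text \<open>For t > 0 both p(1/t) and exp(-1/t) produce a factor 1/t^2, with opposite signs;
  together this is \<open>(p - pderiv p) * [:0, 0, 1:]\<close> evaluated at 1/t.\<close>

lemma flat_exp_deriv:
  "(flat_exp p has_real_derivative flat_exp ((p - pderiv p) * [:0, 0, 1:]) t) (at t)"
proof -
  let ?q = "(p - pderiv p) * [:0, 0, 1:]"
  consider "t > 0" | "t < 0" | "t = 0" by linarith
  then show ?thesis
  proof cases
    case 1
    have "((\<lambda>t. poly p (1 / t) * exp (- (1 / t))) has_real_derivative flat_exp ?q t) (at t)"
      using 1 by (auto intro!: derivative_eq_intros simp: flat_exp_def power2_eq_square field_simps)
    then show ?thesis
      by (rule has_field_derivative_transform_within_open[where S="{0<..}"])
        (use 1 in \<open>auto simp: flat_exp_def\<close>)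
  next
    case 2
    have "((\<lambda>t. 0) has_real_derivative flat_exp ?q t) (at t)"
      using 2 by (auto simp: flat_exp_def)
    then show ?thesis
      by (rule has_field_derivative_transform_within_open[where S="{..<0}"])
        (use 2 in \<open>auto simp: flat_exp_def\<close>)
  next
    case 3
    have "((\<lambda>y. (flat_exp p y - flat_exp p 0) / (y - 0)) \<longlongrightarrow> 0) (at 0)"
      unfolding filterlim_at_split
    proof
      show "((\<lambda>y. (flat_exp p y - flat_exp p 0) / (y - 0)) \<longlongrightarrow> 0) (at_left 0)"
        by (rule Lim_transform_eventually[OF tendsto_const])
          (auto simp: flat_exp_def eventually_at_filter)
      \<comment> \<open>Dividing by \<open>y\<close> multiplies the polynomial by its variable, so
        the right difference quotient is again in the family and tends to 0.\<close>
      show "((\<lambda>y. (flat_exp p y - flat_exp p 0) / (y - 0)) \<longlongrightarrow> 0) (at_right 0)"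
        by (rule Lim_transform_eventually[OF flat_exp_tendsto_0[of "p * [:0, 1:]"]])
          (auto simp: flat_exp_def eventually_at_filter)
    qed
    then show ?thesis using 3
      by (simp add: has_field_derivative_iff flat_exp_def)
  qed
qed

lemma smooth_on_flat_exp: "smooth_on (flat_exp p) UNIV"
proof -
  have "Ck_on k (flat_exp p) UNIV" for k
  proof (induction k arbitrary: p)
    case 0
    show ?case by (auto intro!: continuous_at_imp_continuous_on DERIV_isCont flat_exp_deriv)
  next
    case (Suc k)
    show ?case
      by (rule Ck_on_SucI[where D="\<lambda>t u. flat_exp ((p - pderiv p) * [:0, 0, 1:]) t * u"])
        (intro open_UNIV flat_exp_deriv[unfolded has_field_derivative_def]
          Ck_on_bilinear[OF bounded_bilinear_mult] Suc.IH Ck_on_const)+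
  qed
  then show ?thesis by (simp add: smooth_on_def)
qed

text \<open>The squared distance keeps the argument polynomial, hence smooth at the centre as
  well.\<close>

definition bump :: "real^3 \<Rightarrow> real \<Rightarrow> real^3 \<Rightarrow> real"
  where "bump a r y = flat_exp 1 (r\<^sup>2 - (y - a) \<bullet> (y - a))"

lemma smooth_on_bump: "smooth_on (bump a r) UNIV"
proof -
  have "smooth_on (\<lambda>y. r\<^sup>2 - (y - a) \<bullet> (y - a)) UNIV"
    by (intro smooth_on_diff smooth_on_const smooth_on_bilinear[OF bounded_bilinear_inner]
        smooth_on_bounded_linear bounded_linear_ident open_UNIV)
  from smooth_on_compose[OF _ _ this smooth_on_flat_exp]
  show ?thesis unfolding bump_def by auto
qed

lemma bump_pos: "r > 0 \<Longrightarrow> bump a r a > 0"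
  by (simp add: bump_def flat_exp_def)

lemma bump_eq_0:
  assumes "r > 0" "y \<notin> ball a r" shows "bump a r y = 0"
proof -
  have "r\<^sup>2 \<le> (norm (y - a))\<^sup>2"
    using assms by (intro power_mono) (auto simp: dist_norm norm_minus_commute)
  then show ?thesis by (simp add: bump_def flat_exp_def power2_norm_eq_inner)
qed

section \<open>Auxiliary facts on vectors and integrals\<close>

lemma rowcol_add_right: "rowcol u (v + w) = rowcol u v + rowcol u w"
  by (simp add: rowcol_def ring_distribs sum.distrib)

lemma rowcol_scaleR_right: "rowcol u (r *\<^sub>R w) = of_real r * rowcol u w"
  unfolding rowcol_def by (simp add: sum_distrib_left scaleR_conv_of_real[where 'a=complex]) (simp add: algebra_simps)

lemma rowcol_scaleR_left: "rowcol (r *\<^sub>R u) w = of_real r * rowcol u w"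
  unfolding rowcol_def by (simp add: sum_distrib_left scaleR_conv_of_real[where 'a=complex]) (simp add: algebra_simps)

lemma vcnj_scaleR: "vcnj (r *\<^sub>R u) = r *\<^sub>R vcnj u"
  by (simp add: vcnj_def vec_eq_iff)

lemma vcnj_add: "vcnj (u + v) = vcnj u + vcnj v"
  by (simp add: vcnj_def vec_eq_iff)

lemma rowcol_add_left: "rowcol (u + v) w = rowcol u w + rowcol v w"
  by (simp add: rowcol_def ring_distribs sum.distrib)

lemma rowcol_0 [simp]: "rowcol 0 w = 0" "rowcol u 0 = 0" "vcnj 0 = 0"
  by (simp_all add: rowcol_def vcnj_def vec_eq_iff)

section \<open>Continuous functions with compact support\<close>

lemma continuous_on_extend_by_0:
  assumes "open U" "compact K" "continuous_on U f" "K \<subseteq> U" "\<And>z. z \<in> U - K \<Longrightarrow> f z = 0"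
  shows "continuous_on UNIV (\<lambda>z::'a::t2_space. if z \<in> U then f z else 0 :: 'b::real_normed_vector)"
proof -
  have "continuous_on U (\<lambda>z. if z \<in> U then f z else 0)"
    by (rule continuous_on_eq[OF assms(3)]) simp
  moreover have "continuous_on (- K) (\<lambda>z. if z \<in> U then f z else 0)"
    by (rule continuous_on_eq[OF continuous_on_const[of _ 0]]) (use assms(5) in auto)
  ultimately have "continuous_on (U \<union> - K) (\<lambda>z. if z \<in> U then f z else 0)"
    using assms(1,2) by (intro continuous_on_open_Un) (auto simp: compact_imp_closed)
  moreover have "U \<union> - K = UNIV" using assms(4) by auto
  ultimately show ?thesis by simp
qed

lemma compact_support_integrable:
  fixes g :: "'a::euclidean_space \<Rightarrow> 'b::banach"
  assumes "continuous_on UNIV g" "compact K" "\<And>z. z \<notin> K \<Longrightarrow> g z = 0"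
  shows "g integrable_on UNIV"
proof -
  obtain a b where K: "K \<subseteq> cbox a b"
    using assms(2) bounded_subset_cbox_symmetric compact_imp_bounded by metis
  have "g integrable_on (cbox a b)"
    by (rule integrable_continuous) (rule continuous_on_subset[OF assms(1)], simp)
  then obtain I where "(g has_integral I) (cbox a b)" by (auto simp: integrable_on_def)
  then have "(g has_integral I) UNIV"
    by (rule has_integral_on_superset) (use K assms(3) in auto)
  then show ?thesis by (auto simp: integrable_on_def)
qed

lemma compact_support_integral_eq_0:
  fixes q :: "'a::euclidean_space \<Rightarrow> real"
  assumes "continuous_on UNIV q" "compact K" "\<And>z. z \<notin> K \<Longrightarrow> q z = 0"
    and "\<And>z. q z \<ge> 0" "integral UNIV q = 0"
  shows "q z = 0"
proof -
  \<comment> \<open>The box is taken around \<open>z\<close> as well as \<open>K\<close>: it carries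
    the whole integral and contains the point at which the function is to vanish.\<close>
  have "bounded (insert z K)" using assms(2) compact_imp_bounded by auto
  then obtain a b where K: "insert z K \<subseteq> box a b"
    using bounded_subset_box_symmetric by metis
  have i: "q integrable_on (cbox a b)"
    by (rule integrable_continuous) (rule continuous_on_subset[OF assms(1)], simp)
  then obtain I where I: "(q has_integral I) (cbox a b)" by (auto simp: integrable_on_def)
  then have "(q has_integral I) UNIV"
    by (rule has_integral_on_superset) (use K assms(3) box_subset_cbox in blast)+
  then have "I = 0" using assms(5) by (simp add: integral_unique)
  show ?thesis
  proof (rule has_integral_0_cbox_imp_0[of a b])
    show "(q has_integral 0) (cbox a b)" using I \<open>I = 0\<close> by simp
    show "z \<in> cbox a b" using K box_subset_cbox by blast
    show "box a b \<noteq> {}" using K by auto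
    show "continuous_on (cbox a b) q" by (rule continuous_on_subset[OF assms(1)]) simp
  qed (rule assms(4))
qed

section \<open>Charts and half-densities\<close>

locale manifold3 =
  fixes M :: "'m::t2_space set" and \<A> :: "'m chart set"
  assumes smooth_structure: "smooth_structure M \<A>"
begin

section \<open>Chart inverses and transition maps\<close>

lemma chart: "c \<in> \<A> \<Longrightarrow> is_chart M c"
  using smooth_structure by (simp add: smooth_structure_def)

lemma openin_domain: "c \<in> \<A> \<Longrightarrow> openin (top_of_set M) (fst c)"
  using chart by (simp add: is_chart_def)

lemma domain_subset: "c \<in> \<A> \<Longrightarrow> fst c \<subseteq> M"
  using openin_domain openin_imp_subset by blast

lemma open_cod: "c \<in> \<A> \<Longrightarrow> open (cod c)"
  using chart by (simp add: is_chart_def)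

text \<open>A chart only comes with some inverse; on \<open>cod c\<close> it agrees with
  \<open>inv_into\<close>, from which \<open>transition\<close> is built.\<close>

lemma chart_homeomorphism:
  assumes "c \<in> \<A>" shows "homeomorphism (fst c) (cod c) (snd c) (inv_into (fst c) (snd c))"
proof -
  obtain \<psi> where h: "homeomorphism (fst c) (cod c) (snd c) \<psi>"
    using chart[OF assms] by (auto simp: is_chart_def)
  then have "inv_into (fst c) (snd c) y = \<psi> y" if "y \<in> cod c" for y
    using that unfolding homeomorphism_def
    by (metis f_inv_into_f image_eqI inv_into_into)
  with h show ?thesis using homeomorphism_cong[OF h] by auto
qed

lemma chart_inv: "c \<in> \<A> \<Longrightarrow> p \<in> fst c \<Longrightarrow> inv_into (fst c) (snd c) (snd c p) = p"
  using chart_homeomorphism homeomorphism_apply1 by blast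

lemma chart_inj: "c \<in> \<A> \<Longrightarrow> p \<in> fst c \<Longrightarrow> q \<in> fst c \<Longrightarrow> snd c p = snd c q \<Longrightarrow> p = q"
  using chart_inv by metis

lemma continuous_on_chart: "c \<in> \<A> \<Longrightarrow> continuous_on (fst c) (snd c)"
  using chart_homeomorphism homeomorphism_cont1 by blast

lemma open_chart_image:
  assumes "c \<in> \<A>" "openin (top_of_set M) W" "W \<subseteq> fst c"
  shows "open (snd c ` W)"
proof -
  have "openin (top_of_set (fst c)) W"
    using openin_subset_trans[OF assms(2,3)] domain_subset[OF assms(1)] by simp
  then have "openin (top_of_set (cod c)) (snd c ` W)"
    using homeomorphism_imp_open_map[OF chart_homeomorphism[OF assms(1)]] by blast
  then show ?thesis using openin_open_eq[OF open_cod[OF assms(1)]] by blast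
qed

lemma open_overlap: "c \<in> \<A> \<Longrightarrow> d \<in> \<A> \<Longrightarrow> open (snd c ` (fst c \<inter> fst d))"
  by (intro open_chart_image) (auto intro: openin_domain)

lemma transition_apply: "c \<in> \<A> \<Longrightarrow> p \<in> fst c \<Longrightarrow> transition c d (snd c p) = snd d p"
  by (simp add: transition_def chart_inv)

lemma smooth_transition:
  "c \<in> \<A> \<Longrightarrow> d \<in> \<A> \<Longrightarrow> smooth_on (transition c d) (snd c ` (fst c \<inter> fst d))"
  using smooth_structure by (auto simp: smooth_structure_def compatible_def)

text \<open>Chain rule for the transition maps. They compose correctly only over the triple overlap,
  but this is open, so the derivatives agree there.\<close>

lemma jacobian_det_cocycle:
  assumes A: "c \<in> \<A>" "d \<in> \<A>" "e \<in> \<A>" and p: "p \<in> fst c" "p \<in> fst d" "p \<in> fst e"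
  shows "jacobian_det c e (snd c p) = jacobian_det d e (snd d p) * jacobian_det c d (snd c p)"
proof -
  let ?D1 = "frechet_derivative (transition c d) (at (snd c p))"
  let ?D2 = "frechet_derivative (transition d e) (at (snd d p))"
  have D1: "(transition c d has_derivative ?D1) (at (snd c p))"
    by (rule smooth_on_has_derivative[OF smooth_transition[OF A(1,2)]]) (use p in auto)
  have "(transition d e has_derivative ?D2) (at (snd d p))"
    by (rule smooth_on_has_derivative[OF smooth_transition[OF A(2,3)]]) (use p in auto)
  then have D2: "(transition d e has_derivative ?D2) (at (transition c d (snd c p)))"
    using A p by (simp add: transition_apply)
  have "frechet_derivative (transition c e) (at (snd c p)) =
      frechet_derivative (\<lambda>y. transition d e (transition c d y)) (at (snd c p))"
  proof (rule frechet_derivative_cong_open)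
    show "open (snd c ` (fst c \<inter> fst d \<inter> fst e))"
      by (intro open_chart_image) (auto intro!: openin_domain openin_Int A)
  qed (use p in \<open>auto simp: transition_apply A\<close>)
  also have "\<dots> = ?D2 \<circ> ?D1"
    using frechet_derivative_at[OF has_derivative_compose[OF D1 D2]] by (simp add: o_def)
  finally show ?thesis
    by (simp add: jacobian_det_def matrix_compose det_mul has_derivative_linear[OF D1]
        has_derivative_linear[OF D2])
qed

lemma jacobian_det_self:
  assumes "c \<in> \<A>" "p \<in> fst c" shows "jacobian_det c c (snd c p) = 1"
proof -
  have "frechet_derivative (transition c c) (at (snd c p)) = frechet_derivative (\<lambda>y. y) (at (snd c p))"
    by (rule frechet_derivative_cong_open[OF open_cod[OF assms(1)]])
      (use assms in \<open>auto simp: cod_def transition_apply\<close>)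
  moreover have "matrix (\<lambda>y. y) = (mat 1 :: real^3^3)"
    by (simp add: matrix_def mat_def axis_def vec_eq_iff)
  ultimately show ?thesis
    by (simp add: jacobian_det_def frechet_derivative_ident)
qed

lemma jacobian_det_nonzero:
  assumes "c \<in> \<A>" "d \<in> \<A>" "p \<in> fst c" "p \<in> fst d" shows "jacobian_det c d (snd c p) \<noteq> 0"
  using jacobian_det_cocycle[of c d c p] jacobian_det_self[of c p] assms by auto

lemma smooth_jacobian_det:
  assumes "c \<in> \<A>" "d \<in> \<A>" shows "smooth_on (jacobian_det c d) (snd c ` (fst c \<inter> fst d))"
proof -
  let ?O = "snd c ` (fst c \<inter> fst d)"
  have "smooth_on (\<lambda>x. frechet_derivative (transition c d) (at x) (axis j 1) $ i) ?O" for i j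
    by (intro smooth_on_vec_nth open_overlap assms smooth_on_frechet_derivative smooth_transition)
  then show ?thesis
    unfolding jacobian_det_def det_3 matrix_def vec_lambda_beta
    by (intro smooth_on_diff smooth_on_add smooth_on_mult open_overlap assms)
qed

text \<open>The function \<open>\<phi>\<close>, given in the coordinates of \<open>c\<close>, is
  carried to every other chart by the half-density law and continued by 0 off the domain of
  \<open>c\<close>.\<close>

definition test_half_density :: "'m chart \<Rightarrow> (real^3 \<Rightarrow> complex^2) \<Rightarrow> 'm chart \<Rightarrow> real^3 \<Rightarrow> complex^2"
  where "test_half_density c \<phi> d y =
    (if y \<in> snd d ` (fst c \<inter> fst d) then sqrt \<bar>jacobian_det d c y\<bar> *\<^sub>R \<phi> (transition d c y) else 0)"

lemma test_half_density_inside: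
  assumes "d \<in> \<A>" "p \<in> fst c" "p \<in> fst d"
  shows "test_half_density c \<phi> d (snd d p) = sqrt \<bar>jacobian_det d c (snd d p)\<bar> *\<^sub>R \<phi> (snd c p)"
  using assms by (auto simp: test_half_density_def transition_apply)

lemma test_half_density_outside:
  assumes "d \<in> \<A>" "p \<notin> fst c" "p \<in> fst d"
  shows "test_half_density c \<phi> d (snd d p) = 0"
  using assms chart_inj[of d p] by (auto simp: test_half_density_def)

lemma test_half_density_self: "c \<in> \<A> \<Longrightarrow> y \<in> cod c \<Longrightarrow> test_half_density c \<phi> c y = \<phi> y"
  by (auto simp: cod_def test_half_density_inside jacobian_det_self)

lemma test_half_density_vanishes:
  assumes "\<And>p. p \<in> fst c - K \<Longrightarrow> \<phi> (snd c p) = 0" "d \<in> \<A>" "p \<in> fst d - K"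
  shows "test_half_density c \<phi> d (snd d p) = 0"
  using assms test_half_density_outside[of d p c \<phi>] test_half_density_inside[of d p c \<phi>]
  by (cases "p \<in> fst c") auto

lemma half_density_test:
  assumes "c \<in> \<A>" shows "half_density \<A> (test_half_density c \<phi>)"
  unfolding half_density_def
proof (intro ballI)
  fix d e p assume *: "d \<in> \<A>" "e \<in> \<A>" "p \<in> fst d \<inter> fst e"
  show "test_half_density c \<phi> d (snd d p) =
      sqrt \<bar>jacobian_det d e (snd d p)\<bar> *\<^sub>R test_half_density c \<phi> e (snd e p)"
  proof (cases "p \<in> fst c")
    case True
    then show ?thesis
      using * assms jacobian_det_cocycle[of d e c p]
      by (simp add: test_half_density_inside abs_mult real_sqrt_mult mult.commute)
  next
    case False
    then show ?thesis using * by (simp add: test_half_density_outside)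
  qed
qed

text \<open>Over the domain of \<open>c\<close> the transition formula is smooth. Any other point
  lies outside \<open>K\<close>, which is closed since the space is Hausdorff, and so has a
  neighbourhood on which everything vanishes.\<close>

lemma smooth_half_density_test:
  assumes c: "c \<in> \<A>" and K: "compact K" "K \<subseteq> fst c" and "smooth_on \<phi> (cod c)"
    and 0: "\<And>p. p \<in> fst c - K \<Longrightarrow> \<phi> (snd c p) = 0"
  shows "smooth_half_density \<A> (test_half_density c \<phi>)"
  unfolding smooth_half_density_def
proof (intro conjI ballI half_density_test c)
  fix d assume d: "d \<in> \<A>"
  let ?O = "snd d ` (fst c \<inter> fst d)"
  have O: "open ?O" using open_overlap[OF d c] by (simp add: Int_commute)
  show "smooth_on (test_half_density c \<phi> d) (cod d)"
  proof (rule smooth_on_local)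
    fix y assume "y \<in> cod d"
    then obtain p where p: "p \<in> fst d" "y = snd d p" by (auto simp: cod_def)
    show "\<exists>N g. open N \<and> y \<in> N \<and> smooth_on g N \<and> (\<forall>z\<in>N. test_half_density c \<phi> d z = g z)"
    proof (cases "p \<in> fst c")
      case True
      \<comment> \<open>With J the nonvanishing Jacobian, the square root of |J| is written as J^2
        to the power 1/4, a power of a smooth positive function; this handles both signs of J at
        once.\<close>
      have "smooth_on (\<lambda>z. (jacobian_det d c z * jacobian_det d c z) powr (1/4)) ?O"
        using smooth_jacobian_det[OF d c] jacobian_det_nonzero[OF d c] O
        by (intro smooth_on_powr smooth_on_mult) (auto simp: Int_commute zero_less_mult_iff linorder_neq_iff)
      moreover have "smooth_on (\<lambda>z. \<phi> (transition d c z)) ?O"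
      proof (rule smooth_on_compose[where f="transition d c" and g=\<phi>, OF O _ _ assms(4)])
        show "smooth_on (transition d c) ?O" using smooth_transition[OF d c] by (simp add: Int_commute)
        show "transition d c ` ?O \<subseteq> cod c" by (auto simp: transition_apply d cod_def)
      qed
      ultimately have "smooth_on (\<lambda>z. (jacobian_det d c z * jacobian_det d c z) powr (1/4) *\<^sub>R \<phi> (transition d c z)) ?O"
        by (intro smooth_on_scaleR O)
      moreover have "sqrt \<bar>r\<bar> = (r * r) powr (1/4)" for r :: real
      proof -
        have "r * r = \<bar>r\<bar> powr 2" by (cases "r = 0") (auto simp: powr_numeral power2_eq_square)
        then show ?thesis by (simp only: powr_powr) (simp add: powr_half_sqrt)
      qed
      ultimately show ?thesis
        using O True p by (intro exI[of _ ?O]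
          exI[of _ "\<lambda>z. (jacobian_det d c z * jacobian_det d c z) powr (1/4) *\<^sub>R \<phi> (transition d c z)"])
          (auto simp: test_half_density_def)
    next
      case False
      have "openin (top_of_set M) (fst d - K)"
      proof -
        obtain T where T: "open T" "fst d = M \<inter> T"
          using openin_domain[OF d] by (auto simp: openin_open)
        then have "open (T - K)" using K by (auto intro: compact_imp_closed open_Diff)
        moreover have "fst d - K = M \<inter> (T - K)" using T by auto
        ultimately show ?thesis by (auto simp: openin_open)
      qed
      then have "open (snd d ` (fst d - K))" by (intro open_chart_image d) auto
      moreover have "y \<in> snd d ` (fst d - K)" using p False K by auto
      moreover have "smooth_on (\<lambda>z. 0) (snd d ` (fst d - K))"
        by (intro smooth_on_const) fact
      ultimately show ?thesis
        using test_half_density_vanishes[of c K \<phi> d, OF 0 d]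
        by (intro exI[of _ "snd d ` (fst d - K)"] exI[of _ "\<lambda>z. 0"]) auto
    qed
  qed
qed

text \<open>Take the first chart of the chosen list that meets \<open>W0\<close>. Earlier domains
  miss \<open>W0\<close>, so nothing of \<open>W\<close> has been cut away from the piece of this
  chart, and later pieces have its domain removed. For a density vanishing off \<open>W\<close>
  exactly one summand remains.\<close>

lemma density_integral_localise:
  assumes "compact M" "openin (top_of_set M) W0" "W0 \<noteq> {}"
  obtains d W where "d \<in> \<A>" "openin (top_of_set M) W" "W \<subseteq> W0" "W \<subseteq> fst d" "W \<noteq> {}"
    "\<forall>\<rho>. (\<forall>e\<in>\<A>. \<forall>p\<in>fst e - W. \<rho> e (snd e p) = 0) \<longrightarrow>
      density_integral M \<A> \<rho> = integral UNIV (\<lambda>z. if z \<in> snd d ` W then \<rho> d z else 0)"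
proof -
  define cs where "cs = (SOME cs. set cs \<subseteq> \<A> \<and> M \<subseteq> (\<Union>c\<in>set cs. fst c))"
  \<comment> \<open>Compactness provides a finite cover, so the \<open>SOME\<close> in
    \<open>density_integral\<close> does return one.\<close>
  have "\<exists>cs. set cs \<subseteq> \<A> \<and> M \<subseteq> (\<Union>c\<in>set cs. fst c)"
  proof -
    have "\<exists>T. open T \<and> fst c = M \<inter> T" if "c \<in> \<A>" for c
      using openin_domain[OF that] by (simp add: openin_open)
    then obtain T where T: "\<And>c. c \<in> \<A> \<Longrightarrow> open (T c) \<and> fst c = M \<inter> T c" by metis
    have "M \<subseteq> (\<Union>c\<in>\<A>. T c)"
      using smooth_structure T unfolding smooth_structure_def by blast
    then obtain B where B: "B \<subseteq> \<A>" "finite B" "M \<subseteq> (\<Union>c\<in>B. T c)"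
      using compactE_image[OF assms(1), of \<A> T] T by blast
    obtain cs where "set cs = B" using finite_list[OF B(2)] by blast
    moreover have "M \<subseteq> (\<Union>c\<in>B. fst c)" using B T by blast
    ultimately show ?thesis using B by blast
  qed
  from someI_ex[OF this] have cs: "set cs \<subseteq> \<A>" "M \<subseteq> (\<Union>c\<in>set cs. fst c)"
    by (simp_all add: cs_def)
  have W0M: "W0 \<subseteq> M" using assms(2) openin_imp_subset by blast
  define P where "P k \<longleftrightarrow> k < length cs \<and> W0 \<inter> fst (cs ! k) \<noteq> {}" for k
  have "\<exists>k. P k"
  proof -
    obtain p c where "p \<in> W0" "c \<in> set cs" "p \<in> fst c" using assms(3) W0M cs by blast
    then show ?thesis unfolding P_def by (metis disjoint_iff in_set_conv_nth)
  qed
  define k where "k = (LEAST k. P k)"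
  have Pk: "P k" unfolding k_def using \<open>\<exists>k. P k\<close> by (rule LeastI_ex)
  have first: "W0 \<inter> fst (cs ! l) = {}" if "l < k" for l
    using not_less_Least[of l P] that Pk by (auto simp: k_def P_def)
  define W where "W = W0 \<inter> fst (cs ! k)"
  have d: "cs ! k \<in> \<A>" using Pk cs(1) nth_mem unfolding P_def by blast
  show ?thesis
  proof (rule that[of "cs ! k" W])
    show "openin (top_of_set M) W"
      unfolding W_def by (intro openin_Int assms openin_domain d)
    show "W \<noteq> {}" using Pk by (auto simp: W_def P_def)
    show "\<forall>\<rho>. (\<forall>e\<in>\<A>. \<forall>p\<in>fst e - W. \<rho> e (snd e p) = 0) \<longrightarrow> density_integral M \<A> \<rho> =
        integral UNIV (\<lambda>z. if z \<in> snd (cs ! k) ` W then \<rho> (cs ! k) z else 0)"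
    proof (intro allI impI)
      fix \<rho> :: "'m chart \<Rightarrow> real^3 \<Rightarrow> complex"
      assume *: "\<forall>e\<in>\<A>. \<forall>p\<in>fst e - W. \<rho> e (snd e p) = 0"
      then have 0: "e \<in> \<A> \<Longrightarrow> p \<in> fst e - W \<Longrightarrow> \<rho> e (snd e p) = 0" for e p by blast
      let ?S = "\<lambda>l. fst (cs ! l) - (\<Union>c\<in>set (take l cs). fst c)"
      let ?I = "\<lambda>l. integral (snd (cs ! l) ` ?S l) (\<rho> (cs ! l))"
      have other: "?I l = 0" if l: "l < length cs" "l \<noteq> k" for l
      proof -
        have "?S l \<inter> W = {}"
        proof (cases "l < k")
          case True
          then show ?thesis using first[OF True] by (auto simp: W_def)
        next
          case False
          then have "cs ! k \<in> set (take l cs)"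
            using l Pk by (auto simp: in_set_conv_nth P_def intro!: exI[of _ k])
          then show ?thesis by (auto simp: W_def)
        qed
        moreover have "cs ! l \<in> \<A>" using l cs by auto
        ultimately have "\<rho> (cs ! l) z = 0" if "z \<in> snd (cs ! l) ` ?S l" for z
          using that 0[of "cs ! l"] by blast
        then show ?thesis using integral_cong[of "snd (cs ! l) ` ?S l" "\<rho> (cs ! l)" "\<lambda>_. 0"] by simp
      qed
      have WS: "W \<subseteq> ?S k"
      proof -
        have "fst c \<inter> W = {}" if c: "c \<in> set (take k cs)" for c
        proof -
          obtain l where "l < k" "c = cs ! l" using c by (auto simp: in_set_conv_nth)
          then show ?thesis using first[of l] by (auto simp: W_def)
        qed
        then show ?thesis by (auto simp: W_def)
      qed
      have eq: "\<rho> (cs ! k) z = 0" if z: "z \<in> snd (cs ! k) ` ?S k" "z \<notin> snd (cs ! k) ` W" for z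
        using z 0[OF d] by blast
      have "density_integral M \<A> \<rho> = (\<Sum>l<length cs. ?I l)"
        unfolding density_integral_def cs_def[symmetric] Let_def ..
      also have "\<dots> = (\<Sum>l\<in>{k}. ?I l)"
        by (rule sum.mono_neutral_right) (use Pk other in \<open>auto simp: P_def\<close>)
      \<comment> \<open>Integrals over two sets are compared as integrals over the whole space of
        integrands cut off by 0, which differ only where \<open>\<rho>\<close> is 0 anyway.\<close>
      also have "\<dots> = integral UNIV (\<lambda>z. if z \<in> snd (cs ! k) ` ?S k then \<rho> (cs ! k) z else 0)"
        by (simp add: integral_restrict_UNIV)
      also have "\<dots> = integral UNIV (\<lambda>z. if z \<in> snd (cs ! k) ` W then \<rho> (cs ! k) z else 0)"
      proof (rule integral_cong)
        fix z
        have "snd (cs ! k) ` W \<subseteq> snd (cs ! k) ` ?S k" using WS by (rule image_mono)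
        then show "(if z \<in> snd (cs ! k) ` ?S k then \<rho> (cs ! k) z else 0) =
            (if z \<in> snd (cs ! k) ` W then \<rho> (cs ! k) z else 0)"
          using eq[of z] by auto
      qed
      finally show "density_integral M \<A> \<rho> =
          integral UNIV (\<lambda>z. if z \<in> snd (cs ! k) ` W then \<rho> (cs ! k) z else 0)" .
    qed
  qed (auto simp: W_def d)
qed

text \<open>By the product rule, the commutator of the operator with the coordinate function
  \<open>z $ \<alpha>\<close> is multiplication by \<open>F c \<alpha>\<close>. The relation between
  \<open>w\<close> and \<open>u\<close> is local, as it makes sense in one chart only.\<close>

lemma diff_op_coordinate_mult:
  fixes u w :: "'m chart \<Rightarrow> real^3 \<Rightarrow> complex^2"
  assumes "open N" "y \<in> N" "u c differentiable (at y)" "\<And>z. z \<in> N \<Longrightarrow> w c z = (z $ \<alpha>) *\<^sub>R u c z"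
  shows "diff_op F G w c y = (y $ \<alpha>) *\<^sub>R diff_op F G u c y + F c \<alpha> y *v u c y"
proof -
  let ?D = "frechet_derivative (u c) (at y)"
  have D: "(u c has_derivative ?D) (at y)" using assms(3) frechet_derivative_works by blast
  have "((\<lambda>z. (z $ \<alpha>) *\<^sub>R u c z) has_derivative (\<lambda>h. (y $ \<alpha>) *\<^sub>R ?D h + (h $ \<alpha>) *\<^sub>R u c y)) (at y)"
    by (intro has_derivative_scaleR D bounded_linear_imp_has_derivative bounded_linear_vec_nth)
  moreover have "frechet_derivative (w c) (at y) = frechet_derivative (\<lambda>z. (z $ \<alpha>) *\<^sub>R u c z) (at y)"
    by (rule frechet_derivative_cong_open[OF assms(1,2,4)])
  ultimately have "frechet_derivative (w c) (at y) = (\<lambda>h. (y $ \<alpha>) *\<^sub>R ?D h + (h $ \<alpha>) *\<^sub>R u c y)"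
    using frechet_derivative_at[symmetric] by force
  then have "pderiv_at \<beta> (w c) y =
      (y $ \<alpha>) *\<^sub>R pderiv_at \<beta> (u c) y + (axis \<beta> 1 $ \<alpha>) *\<^sub>R u c y" for \<beta>
    by (simp add: pderiv_at_def)
  moreover have lin: "A *v (r *\<^sub>R v) = r *\<^sub>R (A *v v)" for A :: "complex^2^2" and r v
    by (simp add: vec_eq_iff matrix_vector_mult_def scaleR_right.sum)
  ultimately have "(\<Sum>\<beta>\<in>UNIV. F c \<beta> y *v pderiv_at \<beta> (w c) y) =
      (y $ \<alpha>) *\<^sub>R (\<Sum>\<beta>\<in>UNIV. F c \<beta> y *v pderiv_at \<beta> (u c) y) +
      (\<Sum>\<beta>\<in>UNIV. (axis \<beta> 1 $ \<alpha>) *\<^sub>R (F c \<beta> y *v u c y))"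
    by (simp add: matrix_vector_right_distrib sum.distrib scaleR_right.sum)
  also have "(\<Sum>\<beta>\<in>UNIV. (axis \<beta> 1 $ \<alpha>) *\<^sub>R (F c \<beta> y *v u c y)) = F c \<alpha> y *v u c y"
  proof -
    have "(axis \<beta> 1 $ \<alpha>) *\<^sub>R (F c \<beta> y *v u c y) = (if \<beta> = \<alpha> then F c \<beta> y *v u c y else 0)" for \<beta> :: 3
      by (auto simp: axis_def)
    then show ?thesis by simp
  qed
  finally show ?thesis
    by (simp add: diff_op_def assms(2,4) lin scaleR_right_distrib)
qed

text \<open>Each factor contributes one square root of the Jacobian, so the pairing transforms as a
  1-density.\<close>

lemma half_density_pairing:
  assumes "half_density \<A> v" "half_density \<A> w" "c \<in> \<A>" "d \<in> \<A>" "p \<in> fst c" "p \<in> fst d"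
  shows "rowcol (vcnj (w d (snd d p))) (v d (snd d p)) =
    of_real \<bar>jacobian_det d c (snd d p)\<bar> * rowcol (vcnj (w c (snd c p))) (v c (snd c p))"
proof -
  let ?J = "\<bar>jacobian_det d c (snd d p)\<bar>"
  have "v d (snd d p) = sqrt ?J *\<^sub>R v c (snd c p)" "w d (snd d p) = sqrt ?J *\<^sub>R w c (snd c p)"
    using assms unfolding half_density_def by blast+
  moreover have "complex_of_real (sqrt ?J) * (complex_of_real (sqrt ?J) * a) = of_real ?J * a" for a
    by (metis abs_ge_zero mult.assoc of_real_mult real_sqrt_mult_self abs_of_nonneg)
  ultimately show ?thesis
    by (simp only: vcnj_scaleR rowcol_scaleR_left rowcol_scaleR_right)
qed

lemma continuous_on_rowcol:
  fixes v w :: "'b::topological_space \<Rightarrow> complex^'n::finite"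
  assumes "continuous_on S v" "continuous_on S w"
  shows "continuous_on S (\<lambda>z. rowcol (vcnj (w z)) (v z))"
  unfolding rowcol_def vcnj_def vec_lambda_beta
  by (intro continuous_intros continuous_on_component assms)

lemma continuous_on_diff_op:
  assumes "first_order_operator \<A> F G" "smooth_half_density \<A> v" "c \<in> \<A>"
  shows "continuous_on (cod c) (diff_op F G v c)"
proof -
  have v: "smooth_on (v c) (cod c)" using assms by (auto simp: smooth_half_density_def)
  have mv: "continuous_on (cod c) (\<lambda>x. A x *v u x)"
    if "continuous_on (cod c) A" "continuous_on (cod c) u"
    for A :: "real^3 \<Rightarrow> complex^2^2" and u
    unfolding matrix_vector_mult_def
    by (intro continuous_on_vec_lambda continuous_intros continuous_on_component that)
  have "continuous_on (cod c) (\<lambda>x. (\<Sum>\<alpha>\<in>UNIV. F c \<alpha> x *v pderiv_at \<alpha> (v c) x) + G c x *v v c x)"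
    unfolding pderiv_at_def
    by (intro continuous_on_add continuous_on_sum mv smooth_on_imp_continuous_on
        smooth_on_frechet_derivative v)
      (use assms in \<open>auto simp: first_order_operator_def intro: smooth_on_imp_continuous_on\<close>)
  then show ?thesis by (simp add: diff_op_def[abs_def])
qed

text \<open>Commuting the operator with multiplication by a coordinate function \<open>f\<close> and using self-adjointness
  twice, \<open>\<langle>A f v, w\<rangle> - \<langle>f v, A w\<rangle> - \<langle>A v, f w\<rangle> + \<langle>v, A f w\<rangle> = 0\<close>, leaves only the coefficient of \<open>\<partial>f\<close>
  and its adjoint, without any integration by parts.\<close>

lemma self_adjoint_imp_skew_hermitian:
  assumes M: "compact M" and FG: "first_order_operator \<A> F G" and sa: "self_adjoint M \<A> F G"
    and c: "c \<in> \<A>" and x: "x \<in> cod c"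
  shows "F c \<alpha> x $ j $ i + cnj (F c \<alpha> x $ i $ j) = 0"
proof (rule ccontr)
  define H where "H y = F c \<alpha> y $ j $ i + cnj (F c \<alpha> y $ i $ j)" for y
  \<comment> \<open>Multiplying by the conjugate of \<open>H x\<close> rotates a nonzero
    \<open>H x\<close> to the positive real axis, and by continuity \<open>R\<close> stays positive
    near \<open>x\<close>. The complex identity thus becomes one about a function of fixed
    sign.\<close>
  define R where "R y = Re (cnj (H x) * H y)" for y
  assume "F c \<alpha> x $ j $ i + cnj (F c \<alpha> x $ i $ j) \<noteq> 0"
  then have "H x \<noteq> 0" by (simp add: H_def)
  then have Rx: "R x > 0"
    by (simp add: R_def complex_eq_iff sum_power2_gt_zero_iff flip: power2_eq_square)
  have "continuous_on (cod c) (F c \<alpha>)"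
    using FG c by (auto simp: first_order_operator_def intro: smooth_on_imp_continuous_on)
  then have "continuous_on (cod c) R"
    unfolding R_def H_def by (intro continuous_intros continuous_on_component)
  then have "continuous_on (fst c) (\<lambda>p. R (snd c p))"
    by (rule continuous_on_compose2[OF _ continuous_on_chart[OF c]]) (simp add: cod_def)
  then have "openin (top_of_set (fst c)) (fst c \<inter> (\<lambda>p. R (snd c p)) -` {0<..})"
    by (rule continuous_openin_preimage_gen) simp
  then have op: "openin (top_of_set M) (fst c \<inter> (\<lambda>p. R (snd c p)) -` {0<..})"
    using openin_domain[OF c] openin_trans by blast
  have ne: "fst c \<inter> (\<lambda>p. R (snd c p)) -` {0<..} \<noteq> {}"
    using x Rx by (auto simp: cod_def)
  \<comment> \<open>The chart \<open>d\<close> carries the integral, while \<open>c\<close> is the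
    chart in which the coefficient is studied. All supports are put into \<open>W\<close>, which
    lies in both domains.\<close>
  obtain d W where d: "d \<in> \<A>" and W: "openin (top_of_set M) W"
    "W \<subseteq> fst c \<inter> (\<lambda>p. R (snd c p)) -` {0<..}" "W \<subseteq> fst d" "W \<noteq> {}"
    and loc: "\<forall>\<rho>. (\<forall>e\<in>\<A>. \<forall>p\<in>fst e - W. \<rho> e (snd e p) = 0) \<longrightarrow>
      density_integral M \<A> \<rho> = integral UNIV (\<lambda>z. if z \<in> snd d ` W then \<rho> d z else 0)"
    by (rule density_integral_localise[OF M op ne], rule that; assumption)
  obtain p0 where p0: "p0 \<in> W" using W by blast
  have oc: "open (snd c ` W)" and od: "open (snd d ` W)"
    using open_chart_image[OF c W(1)] open_chart_image[OF d W(1)] W by auto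
  obtain r where r: "r > 0" "cball (snd c p0) r \<subseteq> snd c ` W"
    using oc p0 open_contains_cball by blast
  let ?inv = "inv_into (fst c) (snd c)"
  define K where "K = ?inv ` cball (snd c p0) r"
  have cballc: "cball (snd c p0) r \<subseteq> cod c" using r W by (auto simp: cod_def)
  have K: "compact K"
    unfolding K_def using homeomorphism_cont2[OF chart_homeomorphism[OF c]] cballc
    by (intro compact_continuous_image) (auto intro: continuous_on_subset)
  have KW: "K \<subseteq> W"
  proof
    fix p assume "p \<in> K"
    then obtain y where "y \<in> cball (snd c p0) r" "p = ?inv y" by (auto simp: K_def)
    moreover then obtain q where "q \<in> W" "y = snd c q" using r by blast
    ultimately show "p \<in> W" using chart_inv[OF c] W by auto
  qed
  define \<zeta> where "\<zeta> = bump (snd c p0) r"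
  have \<zeta>0: "\<zeta> (snd c p) = 0" if "p \<in> fst c - K" for p
  proof -
    have "snd c p \<notin> cball (snd c p0) r"
      using that chart_inv[OF c, of p] unfolding K_def by (metis DiffD1 DiffD2 image_eqI)
    then show ?thesis unfolding \<zeta>_def by (intro bump_eq_0) (use r in auto)
  qed
  have \<zeta>s: "smooth_on \<zeta> (cod c)"
    unfolding \<zeta>_def by (rule smooth_on_subset[OF smooth_on_bump]) simp
  \<comment> \<open>Only the component \<open>a\<close> is nonzero in the chart \<open>c\<close>, so
    the choices \<open>i\<close> and \<open>j\<close> for the two test half-densities single out one
    entry of the coefficient matrix and of its adjoint.\<close>
  define T where "T a \<phi> = test_half_density c (\<lambda>y. \<phi> y *\<^sub>R axis a (1::complex))"
    for a :: 2 and \<phi> :: "real^3 \<Rightarrow> real"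
  let ?\<psi> = "\<lambda>y. y $ \<alpha> * \<zeta> y"
  let ?A = "diff_op F G"
  have \<psi>s: "smooth_on ?\<psi> (cod c)"
    by (intro smooth_on_mult \<zeta>s open_cod c smooth_on_bounded_linear bounded_linear_vec_nth)
  have smoothT: "smooth_half_density \<A> (T a \<phi>)"
    if "smooth_on \<phi> (cod c)" "\<And>p. p \<in> fst c - K \<Longrightarrow> \<phi> (snd c p) = 0" for a \<phi>
    unfolding T_def
    by (intro smooth_half_density_test[OF c K] smooth_on_scaleR open_cod c smooth_on_const that)
      (use KW W that in auto)
  have T0: "T a \<phi> e (snd e p) = 0"
    if "\<And>p. p \<in> fst c - K \<Longrightarrow> \<phi> (snd c p) = 0" "e \<in> \<A>" "p \<in> fst e - K" for a \<phi> e p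
    unfolding T_def by (rule test_half_density_vanishes[OF _ that(2,3)]) (simp add: that(1))
  have Tc: "T a \<phi> c y = \<phi> y *\<^sub>R axis a 1" if "y \<in> cod c" for a \<phi> y
    unfolding T_def by (rule test_half_density_self[OF c that])
  have \<psi>0: "?\<psi> (snd c p) = 0" if "p \<in> fst c - K" for p using \<zeta>0[OF that] by simp
  have s1: "smooth_half_density \<A> (T a \<zeta>)" and s2: "smooth_half_density \<A> (T a ?\<psi>)" for a
    using smoothT[OF \<zeta>s] smoothT[OF \<psi>s] \<zeta>0 \<psi>0 by blast+
  have T\<zeta>: "T a \<zeta> e (snd e p) = 0" and T\<psi>: "T a ?\<psi> e (snd e p) = 0"
    if "e \<in> \<A>" "p \<in> fst e - K" for a e p
    using T0[of \<zeta>, OF _ that] T0[of ?\<psi>, OF _ that] \<zeta>0 \<psi>0 by blast+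
  define pair where "pair v w = (\<lambda>e z. rowcol (vcnj (w e z)) (v e z))"
    for v w :: "'m chart \<Rightarrow> real^3 \<Rightarrow> complex^2"
  define ext where "ext \<rho> z = (if z \<in> snd d ` W then \<rho> d z else 0)"
    for \<rho> :: "'m chart \<Rightarrow> real^3 \<Rightarrow> complex" and z
  have hdA: "half_density \<A> (?A v)" if "smooth_half_density \<A> v" for v
    using FG that by (simp add: first_order_operator_def)
  have hd: "half_density \<A> v" if "smooth_half_density \<A> v" for v
    using that by (simp add: smooth_half_density_def)
  have Wd: "snd d ` W \<subseteq> cod d" using W by (auto simp: cod_def)
  have dK: "compact (snd d ` K)"
    by (rule compact_continuous_image[OF continuous_on_subset[OF continuous_on_chart[OF d]] K])
      (use KW W in auto)
  have dKW: "snd d ` K \<subseteq> snd d ` W" using KW by (rule image_mono)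
  have ext: "hd_inner M \<A> v w = integral UNIV (ext (pair v w))"
    "continuous_on UNIV (ext (pair v w))" "\<And>z. z \<notin> snd d ` K \<Longrightarrow> ext (pair v w) z = 0"
    if c: "continuous_on (cod d) (v d)" "continuous_on (cod d) (w d)"
      and 0: "\<And>e p. e \<in> \<A> \<Longrightarrow> p \<in> fst e - K \<Longrightarrow> v e (snd e p) = 0 \<or> w e (snd e p) = 0" for v w
  proof -
    have p0: "pair v w e (snd e p) = 0" if "e \<in> \<A>" "p \<in> fst e - K" for e p
      using 0[OF that] by (auto simp: pair_def)
    show "hd_inner M \<A> v w = integral UNIV (ext (pair v w))"
      unfolding hd_inner_def ext_def[abs_def] pair_def[symmetric]
      by (rule loc[rule_format]) (use KW p0 in blast)
    show e0: "ext (pair v w) z = 0" if "z \<notin> snd d ` K" for z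
      using that p0[OF d] W by (auto simp: ext_def)
    have "continuous_on (cod d) (pair v w d)"
      unfolding pair_def by (intro continuous_on_rowcol c)
    then have "continuous_on (snd d ` W) (pair v w d)" by (rule continuous_on_subset) (rule Wd)
    moreover have "pair v w d z = 0" if "z \<in> snd d ` W - snd d ` K" for z
      using e0[of z] that by (auto simp: ext_def)
    ultimately show "continuous_on UNIV (ext (pair v w))"
      unfolding ext_def[abs_def] by (intro continuous_on_extend_by_0[OF od dK _ dKW])
  qed
  have ct: "continuous_on (cod d) (v d)" "continuous_on (cod d) (?A v d)"
    if "smooth_half_density \<A> v" for v
    using that d continuous_on_diff_op[OF FG that d]
    by (auto simp: smooth_half_density_def intro: smooth_on_imp_continuous_on)
  define \<rho>1 where "\<rho>1 = ext (pair (?A (T i ?\<psi>)) (T j \<zeta>))"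
  define \<rho>2 where "\<rho>2 = ext (pair (T i ?\<psi>) (?A (T j \<zeta>)))"
  define \<rho>3 where "\<rho>3 = ext (pair (?A (T i \<zeta>)) (T j ?\<psi>))"
  define \<rho>4 where "\<rho>4 = ext (pair (T i \<zeta>) (?A (T j ?\<psi>)))"
  have e1: "hd_inner M \<A> (?A (T i ?\<psi>)) (T j \<zeta>) = integral UNIV \<rho>1" "continuous_on UNIV \<rho>1"
      "\<And>z. z \<notin> snd d ` K \<Longrightarrow> \<rho>1 z = 0"
    unfolding \<rho>1_def by (rule ext[of "?A (T i ?\<psi>)" "T j \<zeta>", OF ct(2)[OF s2] ct(1)[OF s1]], use T\<zeta> in blast)+
  have e2: "hd_inner M \<A> (T i ?\<psi>) (?A (T j \<zeta>)) = integral UNIV \<rho>2" "continuous_on UNIV \<rho>2"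
      "\<And>z. z \<notin> snd d ` K \<Longrightarrow> \<rho>2 z = 0"
    unfolding \<rho>2_def by (rule ext[of "T i ?\<psi>" "?A (T j \<zeta>)", OF ct(1)[OF s2] ct(2)[OF s1]], use T\<psi> in blast)+
  have e3: "hd_inner M \<A> (?A (T i \<zeta>)) (T j ?\<psi>) = integral UNIV \<rho>3" "continuous_on UNIV \<rho>3"
      "\<And>z. z \<notin> snd d ` K \<Longrightarrow> \<rho>3 z = 0"
    unfolding \<rho>3_def by (rule ext[of "?A (T i \<zeta>)" "T j ?\<psi>", OF ct(2)[OF s1] ct(1)[OF s2]], use T\<psi> in blast)+
  have e4: "hd_inner M \<A> (T i \<zeta>) (?A (T j ?\<psi>)) = integral UNIV \<rho>4" "continuous_on UNIV \<rho>4"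
      "\<And>z. z \<notin> snd d ` K \<Longrightarrow> \<rho>4 z = 0"
    unfolding \<rho>4_def by (rule ext[of "T i \<zeta>" "?A (T j ?\<psi>)", OF ct(1)[OF s1] ct(2)[OF s2]], use T\<zeta> in blast)+
  have int: "\<rho>1 integrable_on UNIV" "\<rho>2 integrable_on UNIV" "\<rho>3 integrable_on UNIV" "\<rho>4 integrable_on UNIV"
    using compact_support_integrable[OF _ dK] e1 e2 e3 e4 by blast+
  have sa': "integral UNIV \<rho>1 = integral UNIV \<rho>2" "integral UNIV \<rho>3 = integral UNIV \<rho>4"
    using sa s1 s2 e1(1) e2(1) e3(1) e4(1) unfolding self_adjoint_def by metis+
  define \<rho> where "\<rho> z = (\<rho>1 z - \<rho>2 z) - (\<rho>3 z - \<rho>4 z)" for z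
  have int\<rho>: "(\<rho> has_integral 0) UNIV"
  proof -
    have "(\<rho> has_integral ((integral UNIV \<rho>1 - integral UNIV \<rho>2) - (integral UNIV \<rho>3 - integral UNIV \<rho>4))) UNIV"
      unfolding \<rho>_def[abs_def] by (intro has_integral_diff integrable_integral int)
    then show ?thesis using sa' by simp
  qed
  define q where "q z = Re (cnj (H x) * \<rho> z)" for z
  \<comment> \<open>The pairings are transported from \<open>d\<close> to \<open>c\<close>, where
    the commutator identity applies. All terms that still contain the operator cancel because the
    coordinate function is real.\<close>
  have \<rho>W: "\<rho> (snd d p) = of_real (\<bar>jacobian_det d c (snd d p)\<bar> * (\<zeta> (snd c p))\<^sup>2) * H (snd c p)"
    if p: "p \<in> W" for p
  proof -
    let ?y = "snd c p" and ?J = "complex_of_real \<bar>jacobian_det d c (snd d p)\<bar>"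
    have pcd: "p \<in> fst c" "p \<in> fst d" using p W by auto
    have y: "?y \<in> cod c" using pcd by (auto simp: cod_def)
    have A\<psi>: "?A (T a ?\<psi>) c ?y = (?y $ \<alpha>) *\<^sub>R ?A (T a \<zeta>) c ?y + F c \<alpha> ?y *v T a \<zeta> c ?y" for a
    proof (rule diff_op_coordinate_mult[OF open_cod[OF c] y])
      have "smooth_on (T a \<zeta> c) (cod c)" using s1 c by (simp add: smooth_half_density_def)
      then show "T a \<zeta> c differentiable at ?y"
        using smooth_on_has_derivative[OF _ y] differentiable_def by blast
    qed (simp add: Tc)
    have "\<rho> (snd d p) = ?J * ((pair (?A (T i ?\<psi>)) (T j \<zeta>) c ?y - pair (T i ?\<psi>) (?A (T j \<zeta>)) c ?y)
        - (pair (?A (T i \<zeta>)) (T j ?\<psi>) c ?y - pair (T i \<zeta>) (?A (T j ?\<psi>)) c ?y))"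
      unfolding \<rho>_def \<rho>1_def \<rho>2_def \<rho>3_def \<rho>4_def ext_def pair_def
      using p half_density_pairing[OF hdA[OF s2] hd[OF s1] c d pcd]
        half_density_pairing[OF hd[OF s2] hdA[OF s1] c d pcd]
        half_density_pairing[OF hdA[OF s1] hd[OF s2] c d pcd]
        half_density_pairing[OF hd[OF s1] hdA[OF s2] c d pcd]
      by (simp add: ring_distribs)
    also have "(pair (?A (T i ?\<psi>)) (T j \<zeta>) c ?y - pair (T i ?\<psi>) (?A (T j \<zeta>)) c ?y)
        - (pair (?A (T i \<zeta>)) (T j ?\<psi>) c ?y - pair (T i \<zeta>) (?A (T j ?\<psi>)) c ?y) =
        rowcol (vcnj (T j \<zeta> c ?y)) (F c \<alpha> ?y *v T i \<zeta> c ?y) +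
        rowcol (vcnj (F c \<alpha> ?y *v T j \<zeta> c ?y)) (T i \<zeta> c ?y)"
      unfolding pair_def A\<psi>
      by (simp add: Tc y rowcol_add_left rowcol_add_right vcnj_add vcnj_scaleR rowcol_scaleR_left
          rowcol_scaleR_right) (simp add: algebra_simps)
    also have "\<dots> = of_real ((\<zeta> ?y)\<^sup>2) * H ?y"
      using exhaust_2[of i] exhaust_2[of j]
      by (auto simp: Tc y H_def rowcol_def vcnj_def matrix_vector_mult_def sum_2 axis_def
          power2_eq_square algebra_simps scaleR_conv_of_real[where 'a=complex])
    finally show ?thesis by simp
  qed
  \<comment> \<open>The function \<open>q\<close> is continuous and nonnegative with integral 0,
    hence 0 everywhere; at the centre of the bump, however, every factor in its formula is
    nonzero.\<close>
  have "q (snd d p0) = 0"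
  proof (rule compact_support_integral_eq_0[OF _ dK])
    show "continuous_on UNIV q"
      unfolding q_def[abs_def] \<rho>_def[abs_def]
      by (intro continuous_intros e1 e2 e3 e4)
    show "q z = 0" if "z \<notin> snd d ` K" for z
      using e1(3)[OF that] e2(3)[OF that] e3(3)[OF that] e4(3)[OF that] by (simp add: q_def \<rho>_def)
    have "(q has_integral Re (cnj (H x) * 0)) UNIV"
      unfolding q_def by (intro has_integral_Re has_integral_mult_right int\<rho>)
    then show "integral UNIV q = 0" by (simp add: integral_unique)
    fix z show "0 \<le> q z"
    proof (cases "z \<in> snd d ` W")
      case True
      then obtain p where p: "p \<in> W" "z = snd d p" by blast
      have "R (snd c p) > 0" using p W by auto
      moreover have "q z = \<bar>jacobian_det d c (snd d p)\<bar> * (\<zeta> (snd c p))\<^sup>2 * R (snd c p)"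
        unfolding q_def p(2) \<rho>W[OF p(1)] R_def by (simp add: algebra_simps)
      ultimately show ?thesis by simp
    next
      case False
      then show ?thesis by (simp add: q_def \<rho>_def \<rho>1_def \<rho>2_def \<rho>3_def \<rho>4_def ext_def)
    qed
  qed
  moreover have "q (snd d p0) = \<bar>jacobian_det d c (snd d p0)\<bar> * (\<zeta> (snd c p0))\<^sup>2 * R (snd c p0)"
    unfolding q_def \<rho>W[OF p0] R_def by (simp add: algebra_simps)
  moreover have "R (snd c p0) > 0" using p0 W by auto
  moreover have "\<zeta> (snd c p0) > 0" unfolding \<zeta>_def by (rule bump_pos) (rule r)
  moreover have "jacobian_det d c (snd d p0) \<noteq> 0"
    using jacobian_det_nonzero[OF d c] p0 W by auto
  ultimately show False by simp
qed

end

section \<open>Spin one half\<close>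

text \<open>The combination of the three standard Pauli matrices with coefficients \<open>w\<close>.
  The minus sign in the upper right entry matches the one in \<open>frame\<close>.\<close>

definition pauli :: "real^3 \<Rightarrow> complex^2^2"
  where "pauli w = (\<chi> i j. if i = j then (if i = 1 then of_real (w $ 3) else - of_real (w $ 3))
     else if i = 1 then Complex (w $ 1) (- (w $ 2)) else Complex (w $ 1) (w $ 2))"

lemma pauli_nth [simp]:
  "pauli w $ 1 $ 1 = of_real (w $ 3)" "pauli w $ 1 $ 2 = Complex (w $ 1) (- (w $ 2))"
  "pauli w $ 2 $ 1 = Complex (w $ 1) (w $ 2)" "pauli w $ 2 $ 2 = - of_real (w $ 3)"
  by (simp_all add: pauli_def)

lemma norm_sq_vec3: "(norm (w::real^3))\<^sup>2 = (w $ 1)\<^sup>2 + (w $ 2)\<^sup>2 + (w $ 3)\<^sup>2"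
  unfolding power2_norm_eq_inner inner_vec_def by (simp add: sum_3 power2_eq_square)

lemma norm_sq_cvec2: "(norm (u::complex^2))\<^sup>2 = (Re (u $ 1))\<^sup>2 + (Im (u $ 1))\<^sup>2 + (Re (u $ 2))\<^sup>2 + (Im (u $ 2))\<^sup>2"
  unfolding norm_vec_def L2_set_def
  by (simp add: sum_2 cmod_power2 sum_nonneg)

text \<open>Splitting into real equations turns the later eigenvector computations into polynomial
  identities over the reals, which \<open>algebra\<close> decides.\<close>

lemma pauli_eigen_iff:
  "pauli w *v u = of_real h *s u \<longleftrightarrow>
    w $ 3 * Re (u $ 1) + w $ 1 * Re (u $ 2) + w $ 2 * Im (u $ 2) = h * Re (u $ 1) \<and>
    w $ 3 * Im (u $ 1) + w $ 1 * Im (u $ 2) - w $ 2 * Re (u $ 2) = h * Im (u $ 1) \<and>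
    w $ 1 * Re (u $ 1) - w $ 2 * Im (u $ 1) - w $ 3 * Re (u $ 2) = h * Re (u $ 2) \<and>
    w $ 1 * Im (u $ 1) + w $ 2 * Re (u $ 1) - w $ 3 * Im (u $ 2) = h * Im (u $ 2)"
  by (auto simp: vec_eq_iff forall_2 matrix_vector_mult_def sum_2 complex_eq_iff algebra_simps)

text \<open>The square of \<open>pauli w\<close> is |w|^2 times the identity.\<close>

lemma pauli_eigenvalue:
  assumes "pauli w *v u = of_real h *s u" "u \<noteq> 0"
  shows "h\<^sup>2 = (norm w)\<^sup>2"
proof -
  define a1 a2 b1 b2 where ab: "a1 = Re (u $ 1)" "a2 = Im (u $ 1)" "b1 = Re (u $ 2)" "b2 = Im (u $ 2)"
  define w1 w2 w3 where w: "w1 = w $ 1" "w2 = w $ 2" "w3 = w $ 3"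
  have e: "w3 * a1 + w1 * b1 + w2 * b2 = h * a1" "w3 * a2 + w1 * b2 - w2 * b1 = h * a2"
    "w1 * a1 - w2 * a2 - w3 * b1 = h * b1" "w1 * a2 + w2 * a1 - w3 * b2 = h * b2"
    using assms(1) by (simp_all add: pauli_eigen_iff ab w)
  have "(h\<^sup>2 - (w1\<^sup>2 + w2\<^sup>2 + w3\<^sup>2)) * a1 = 0" "(h\<^sup>2 - (w1\<^sup>2 + w2\<^sup>2 + w3\<^sup>2)) * a2 = 0"
    "(h\<^sup>2 - (w1\<^sup>2 + w2\<^sup>2 + w3\<^sup>2)) * b1 = 0" "(h\<^sup>2 - (w1\<^sup>2 + w2\<^sup>2 + w3\<^sup>2)) * b2 = 0"
    using e by algebra+
  moreover have "a1 \<noteq> 0 \<or> a2 \<noteq> 0 \<or> b1 \<noteq> 0 \<or> b2 \<noteq> 0"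
    using assms(2) by (auto simp: ab vec_eq_iff forall_2 complex_eq_iff)
  ultimately show ?thesis by (auto simp: norm_sq_vec3 w)
qed

text \<open>The witness is the first column of |w| + \<open>pauli w\<close>, which
  \<open>pauli w\<close> multiplies by |w|. It vanishes exactly if \<open>w $ 3 = - norm w\<close>,
  and then the second basis vector is an eigenvector.\<close>

lemma ex_pauli_eigenvector: "\<exists>u. u \<noteq> 0 \<and> pauli w *v u = of_real (norm w) *s u"
proof (cases "w $ 3 = - norm w")
  case True
  then have "w $ 1 = 0" "w $ 2 = 0" using norm_sq_vec3[of w] by (simp_all add: sum_power2_eq_zero_iff)
  then show ?thesis using True
    by (intro exI[of _ "vector [0, 1]"] conjI; simp only: pauli_eigen_iff)
      (simp_all add: vec_eq_iff forall_2)
next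
  case False
  then show ?thesis using norm_sq_vec3[of w]
    by (intro exI[of _ "vector [of_real (norm w + w $ 3), Complex (w $ 1) (w $ 2)]"] conjI;
        simp only: pauli_eigen_iff)
      (simp_all add: vec_eq_iff forall_2 complex_eq_iff algebra_simps power2_eq_square)
qed

text \<open>The components of \<open>bloch u\<close> are \<open>u\<^sup>* \<sigma>\<^sub>j u\<close> for the Pauli matrices \<open>\<sigma>\<^sub>j\<close>.\<close>

definition bloch :: "complex^2 \<Rightarrow> real^3"
  where "bloch u = vector [2 * (Re (u $ 1) * Re (u $ 2) + Im (u $ 1) * Im (u $ 2)),
    2 * (Re (u $ 1) * Im (u $ 2) - Im (u $ 1) * Re (u $ 2)),
    (Re (u $ 1))\<^sup>2 + (Im (u $ 1))\<^sup>2 - (Re (u $ 2))\<^sup>2 - (Im (u $ 2))\<^sup>2]"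

text \<open>The derivative of the quadratic map \<open>bloch\<close> at \<open>u\<close> in the
  direction \<open>v\<close>.\<close>

definition bloch_deriv :: "complex^2 \<Rightarrow> complex^2 \<Rightarrow> real^3"
  where "bloch_deriv u v = vector
   [2 * (Re (v $ 1) * Re (u $ 2) + Re (u $ 1) * Re (v $ 2) + Im (v $ 1) * Im (u $ 2) + Im (u $ 1) * Im (v $ 2)),
    2 * (Re (v $ 1) * Im (u $ 2) + Re (u $ 1) * Im (v $ 2) - Im (v $ 1) * Re (u $ 2) - Im (u $ 1) * Re (v $ 2)),
    2 * (Re (u $ 1) * Re (v $ 1) + Im (u $ 1) * Im (v $ 1) - Re (u $ 2) * Re (v $ 2) - Im (u $ 2) * Im (v $ 2))]"

text \<open>Consider the real part of the expectation in \<open>u\<close> of the k-th Pauli matrix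
  times \<open>pauli w\<close>. Products of two different Pauli matrices are anti-Hermitian and
  contribute nothing, which leaves \<open>w $ k\<close>; the eigenvalue equation evaluates the same
  expectation to \<open>h * bloch u $ k\<close>.\<close>

lemma pauli_eigen_bloch:
  assumes "pauli w *v u = of_real h *s u" "norm u = 1"
  shows "w = h *\<^sub>R bloch u"
proof -
  define a1 a2 b1 b2 where ab: "a1 = Re (u $ 1)" "a2 = Im (u $ 1)" "b1 = Re (u $ 2)" "b2 = Im (u $ 2)"
  define w1 w2 w3 where w: "w1 = w $ 1" "w2 = w $ 2" "w3 = w $ 3"
  have e: "w3 * a1 + w1 * b1 + w2 * b2 = h * a1" "w3 * a2 + w1 * b2 - w2 * b1 = h * a2"
    "w1 * a1 - w2 * a2 - w3 * b1 = h * b1" "w1 * a2 + w2 * a1 - w3 * b2 = h * b2"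
    using assms(1) by (simp_all add: pauli_eigen_iff ab w)
  have n: "a1\<^sup>2 + a2\<^sup>2 + b1\<^sup>2 + b2\<^sup>2 = 1"
    using norm_sq_cvec2[of u] assms(2) by (simp add: ab)
  have "w1 = h * (2 * (a1 * b1 + a2 * b2))" "w2 = h * (2 * (a1 * b2 - a2 * b1))"
    "w3 = h * (a1\<^sup>2 + a2\<^sup>2 - b1\<^sup>2 - b2\<^sup>2)"
    using e n by algebra+
  then show ?thesis by (simp add: vec_eq_iff forall_3 bloch_def ab w)
qed

lemma norm_bloch: "norm (bloch u) = (norm u)\<^sup>2"
proof -
  have "(norm (bloch u))\<^sup>2 = ((norm u)\<^sup>2)\<^sup>2"
    unfolding norm_sq_vec3 norm_sq_cvec2 bloch_def vector_3 by algebra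
  then show ?thesis by (rule power2_eq_imp_eq) simp_all
qed

definition triple :: "real^3 \<Rightarrow> real^3 \<Rightarrow> real^3 \<Rightarrow> real"
  where "triple u v w = (\<Sum>j\<in>UNIV. \<Sum>k\<in>UNIV. \<Sum>l\<in>UNIV. levi_civita j k l * u $ j * v $ k * w $ l)"

lemma triple_expand:
  "triple u v w = u $ 1 * (v $ 2 * w $ 3 - v $ 3 * w $ 2) + u $ 2 * (v $ 3 * w $ 1 - v $ 1 * w $ 3) +
    u $ 3 * (v $ 1 * w $ 2 - v $ 2 * w $ 1)"
  unfolding triple_def by (simp add: sum_3 levi_civita_def algebra_simps)

lemma rowcol_vcnj:
  fixes u v :: "complex^2"
  shows "Re (rowcol (vcnj u) v) = Re (u $ 1) * Re (v $ 1) + Im (u $ 1) * Im (v $ 1) +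
    Re (u $ 2) * Re (v $ 2) + Im (u $ 2) * Im (v $ 2)"
  "Im (rowcol (vcnj u) v) = Re (u $ 1) * Im (v $ 1) - Im (u $ 1) * Re (v $ 1) +
    Re (u $ 2) * Im (v $ 2) - Im (u $ 2) * Re (v $ 2)"
  by (simp_all add: rowcol_def vcnj_def sum_2)

text \<open>The Berry curvature of a spinor is half the solid angle swept out by its Bloch vector.\<close>

lemma triple_bloch:
  assumes "norm u = 1" "Re (rowcol (vcnj u) v) = 0" "Re (rowcol (vcnj u) w) = 0"
  shows "triple (bloch u) (bloch_deriv u v) (bloch_deriv u w) = 4 * Im (rowcol (vcnj v) w)"
proof -
  let ?r = "(Re (u $ 1))\<^sup>2 + (Im (u $ 1))\<^sup>2 + (Re (u $ 2))\<^sup>2 + (Im (u $ 2))\<^sup>2"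
  have "?r = 1" using norm_sq_cvec2[of u] assms(1) by simp
  \<comment> \<open>An identity for all \<open>u\<close>, before normalisation; the last two terms
    carry factors that the hypotheses make 0.\<close>
  moreover have "triple (bloch u) (bloch_deriv u v) (bloch_deriv u w) =
      4 * ?r\<^sup>2 * Im (rowcol (vcnj v) w) - 4 * ?r * Re (rowcol (vcnj u) v) * Im (rowcol (vcnj u) w)
      - 4 * ?r * Re (rowcol (vcnj u) w) * Im (rowcol (vcnj v) u)"
    unfolding triple_expand bloch_def bloch_deriv_def vector_3 rowcol_vcnj by algebra
  ultimately show ?thesis by (simp add: assms)
qed

text \<open>For unit \<open>u\<close> the matrix is -2h times the projection 1 - u u^H onto the
  complement of \<open>u\<close>. The part with u u^H gives the product of the imaginary numbers v^H
  u and u^H w, which is real and cancels in the antisymmetrisation; the rest gives the imaginary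
  part of v^H w.\<close>

lemma pauli_bloch_im:
  assumes "norm u = 1" "Re (rowcol (vcnj u) v) = 0" "Re (rowcol (vcnj u) w) = 0"
  shows "rowcol (vcnj v) ((pauli (h *\<^sub>R bloch u) - mat (of_real h)) *v w)
    - rowcol (vcnj w) ((pauli (h *\<^sub>R bloch u) - mat (of_real h)) *v v) =
    - 4 * \<i> * of_real h * of_real (Im (rowcol (vcnj v) w))" (is "?L = _")
proof -
  let ?r = "(Re (u $ 1))\<^sup>2 + (Im (u $ 1))\<^sup>2 + (Re (u $ 2))\<^sup>2 + (Im (u $ 2))\<^sup>2"
  have r: "?r = 1" using norm_sq_cvec2[of u] assms(1) by simp
  have comp: "((pauli (h *\<^sub>R bloch u) - mat (of_real h)) *v w) $ 1 =
      of_real (h * bloch u $ 3 - h) * w $ 1 + of_real h * Complex (bloch u $ 1) (- (bloch u $ 2)) * w $ 2"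
    "((pauli (h *\<^sub>R bloch u) - mat (of_real h)) *v w) $ 2 =
      of_real h * Complex (bloch u $ 1) (bloch u $ 2) * w $ 1 - of_real (h * bloch u $ 3 + h) * w $ 2" for w
    by (simp_all add: matrix_vector_mult_def sum_2 mat_def complex_eq_iff algebra_simps)
  have "Re ?L = 0"
    unfolding minus_complex.sel rowcol_vcnj comp by (simp add: algebra_simps)
  moreover have "Im ?L = 2 * h * (2 * (Re (rowcol (vcnj v) u) * Im (rowcol (vcnj u) w)
      + Im (rowcol (vcnj v) u) * Re (rowcol (vcnj u) w)) - (?r + 1) * Im (rowcol (vcnj v) w))"
    unfolding minus_complex.sel rowcol_vcnj comp unfolding bloch_def vector_3
    by (simp add: algebra_simps power2_eq_square)
  moreover have "Re (rowcol (vcnj v) u) = Re (rowcol (vcnj u) v)"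
    by (simp add: rowcol_vcnj algebra_simps)
  ultimately show ?thesis using assms r by (simp add: complex_eq_iff)
qed

lemma rowcol_antisym_im:
  fixes v w :: "complex^2"
  shows "rowcol (vcnj v) w - rowcol (vcnj w) v = 2 * \<i> * of_real (Im (rowcol (vcnj v) w))"
  by (simp add: complex_eq_iff rowcol_vcnj algebra_simps)

text \<open>\<open>B\<close> is expanded in the identity and the Pauli matrices, with complex
  coefficients; the expectations of the latter are the components of \<open>bloch u\<close>.\<close>

lemma expectation_bloch:
  assumes "norm u = 1"
  shows "rowcol (vcnj u) (B *v u) = trace B / 2 + of_real (bloch u $ 1) * ((B $ 1 $ 2 + B $ 2 $ 1) / 2)
    + of_real (bloch u $ 2) * (\<i> * (B $ 1 $ 2 - B $ 2 $ 1) / 2)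
    + of_real (bloch u $ 3) * ((B $ 1 $ 1 - B $ 2 $ 2) / 2)"
proof -
  let ?r = "(Re (u $ 1))\<^sup>2 + (Im (u $ 1))\<^sup>2 + (Re (u $ 2))\<^sup>2 + (Im (u $ 2))\<^sup>2"
  have "?r = 1" using norm_sq_cvec2[of u] assms by simp
  moreover have e: "2 * rowcol (vcnj u) (B *v u) = of_real ?r * trace B +
    of_real (bloch u $ 1) * (B $ 1 $ 2 + B $ 2 $ 1) + of_real (bloch u $ 2) * (\<i> * (B $ 1 $ 2 - B $ 2 $ 1))
    + of_real (bloch u $ 3) * (B $ 1 $ 1 - B $ 2 $ 2)"
    unfolding complex_eq_iff
    by (simp add: rowcol_vcnj matrix_vector_mult_def sum_2 trace_def bloch_def)
      (simp add: algebra_simps power2_eq_square)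
  ultimately have "(2 * rowcol (vcnj u) (B *v u)) / 2 = trace B / 2 + of_real (bloch u $ 1) * ((B $ 1 $ 2 + B $ 2 $ 1) / 2)
    + of_real (bloch u $ 2) * (\<i> * (B $ 1 $ 2 - B $ 2 $ 1) / 2)
    + of_real (bloch u $ 3) * ((B $ 1 $ 1 - B $ 2 $ 2) / 2)"
    unfolding e by (simp add: add_divide_distrib)
  then show ?thesis by simp
qed

text \<open>Differentiating the normalisation gives the first claim; differentiating
  \<open>\<omega>\<close> as its norm times the Bloch vector of \<open>\<gamma>\<close> gives the
  second. The coefficient \<open>k\<close> may stay unknown, since multiples of the Bloch vector
  drop out of the triple products formed later.\<close>

lemma eigenvector_curve:
  fixes \<gamma> :: "real \<Rightarrow> complex^2" and \<omega> :: "real \<Rightarrow> real^3"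
  assumes \<gamma>: "(\<gamma> has_vector_derivative \<gamma>') (at 0)" and \<omega>: "(\<omega> has_vector_derivative \<omega>') (at 0)"
    and ev: "\<forall>\<^sub>F t in nhds 0. pauli (\<omega> t) *v \<gamma> t = of_real (norm (\<omega> t)) *s \<gamma> t \<and> norm (\<gamma> t) = 1"
  shows "Re (rowcol (vcnj (\<gamma> 0)) \<gamma>') = 0"
    and "\<exists>k. \<omega>' = norm (\<omega> 0) *\<^sub>R bloch_deriv (\<gamma> 0) \<gamma>' + k *\<^sub>R bloch (\<gamma> 0)"
proof -
  define P where "P i t = Re (\<gamma> t $ i)" for i t
  define Q where "Q i t = Im (\<gamma> t $ i)" for i t
  have comp: "(P i has_vector_derivative Re (\<gamma>' $ i)) (at 0)"
    "(Q i has_vector_derivative Im (\<gamma>' $ i)) (at 0)" for i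
    unfolding P_def[abs_def] Q_def[abs_def]
    using bounded_linear.has_vector_derivative[OF bounded_linear_compose[OF bounded_linear_Re bounded_linear_vec_nth] \<gamma>]
      bounded_linear.has_vector_derivative[OF bounded_linear_compose[OF bounded_linear_Im bounded_linear_vec_nth] \<gamma>]
    by auto
  note comp' = comp[unfolded has_real_derivative_iff_has_vector_derivative[symmetric]]
  have ev0: "pauli (\<omega> 0) *v \<gamma> 0 = of_real (norm (\<omega> 0)) *s \<gamma> 0" "norm (\<gamma> 0) = 1"
    using eventually_nhds_x_imp_x[OF ev] by auto
  define N where "N t = (P 1 t)\<^sup>2 + (Q 1 t)\<^sup>2 + (P 2 t)\<^sup>2 + (Q 2 t)\<^sup>2" for t
  have "(N has_real_derivative 2 * Re (rowcol (vcnj (\<gamma> 0)) \<gamma>')) (at 0)"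
    unfolding N_def[abs_def] rowcol_vcnj P_def[symmetric] Q_def[symmetric]
    by (auto intro!: derivative_eq_intros comp' simp: algebra_simps)
  moreover have "(N has_real_derivative 0) (at 0)"
  proof -
    have "\<forall>\<^sub>F t in nhds 0. N t = 1"
      using ev by eventually_elim (simp add: N_def P_def Q_def norm_sq_cvec2[symmetric])
    then show ?thesis using DERIV_cong_ev[of 0 0 N "\<lambda>_. 1" 0 0] by simp
  qed
  ultimately show "Re (rowcol (vcnj (\<gamma> 0)) \<gamma>') = 0" using DERIV_unique by fastforce
  have bl: "((\<lambda>t. bloch (\<gamma> t)) has_vector_derivative bloch_deriv (\<gamma> 0) \<gamma>') (at 0)"
  proof -
    have c: "((\<lambda>t. bloch (\<gamma> t) $ i) has_real_derivative bloch_deriv (\<gamma> 0) \<gamma>' $ i) (at 0)" for i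
      using exhaust_3[of i] unfolding bloch_def bloch_deriv_def P_def[symmetric] Q_def[symmetric]
      by (elim disjE) (simp_all, (auto intro!: derivative_eq_intros comp' simp: algebra_simps)+)
    have "((\<lambda>t. bloch (\<gamma> t) $ i) has_derivative (\<lambda>h. (h *\<^sub>R bloch_deriv (\<gamma> 0) \<gamma>') $ i)) (at 0)" for i
      by (rule has_derivative_eq_rhs[OF c[unfolded has_field_derivative_def]]) (simp add: fun_eq_iff)
    then show ?thesis
      unfolding has_vector_derivative_def has_derivative_componentwise_within[of "\<lambda>t. bloch (\<gamma> t)"]
      by (auto simp: Basis_vec_def inner_axis)
  qed
  \<comment> \<open>Along the curve this inner product equals the norm of \<open>\<omega>\<close>,
    and its derivative follows from the product rule for inner products.\<close>
  define s where "s t = \<omega> t \<bullet> bloch (\<gamma> t)" for t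
  have "((\<lambda>t. s t *\<^sub>R bloch (\<gamma> t)) has_derivative
      (\<lambda>h. s 0 *\<^sub>R (h *\<^sub>R bloch_deriv (\<gamma> 0) \<gamma>') +
        (\<omega> 0 \<bullet> (h *\<^sub>R bloch_deriv (\<gamma> 0) \<gamma>') + (h *\<^sub>R \<omega>') \<bullet> bloch (\<gamma> 0)) *\<^sub>R bloch (\<gamma> 0))) (at 0)"
    unfolding s_def
    by (intro has_derivative_scaleR has_derivative_inner bl[unfolded has_vector_derivative_def]
        \<omega>[unfolded has_vector_derivative_def])
  then have "((\<lambda>t. s t *\<^sub>R bloch (\<gamma> t)) has_vector_derivative
      (s 0 *\<^sub>R bloch_deriv (\<gamma> 0) \<gamma>' +
        (\<omega> 0 \<bullet> bloch_deriv (\<gamma> 0) \<gamma>' + \<omega>' \<bullet> bloch (\<gamma> 0)) *\<^sub>R bloch (\<gamma> 0))) (at 0)"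
    unfolding has_vector_derivative_def by (simp add: algebra_simps)
  moreover have ev2: "\<forall>\<^sub>F t in nhds 0. \<omega> t = s t *\<^sub>R bloch (\<gamma> t)"
    using ev
  proof eventually_elim
    case (elim t)
    then have *: "\<omega> t = norm (\<omega> t) *\<^sub>R bloch (\<gamma> t)" by (intro pauli_eigen_bloch) auto
    have "bloch (\<gamma> t) \<bullet> bloch (\<gamma> t) = 1"
      using elim norm_bloch[of "\<gamma> t"] by (simp add: power2_norm_eq_inner[symmetric])
    then have "s t = norm (\<omega> t)" unfolding s_def by (subst *) simp
    then show ?case using * by simp
  qed
  ultimately have "(\<omega> has_vector_derivative (s 0 *\<^sub>R bloch_deriv (\<gamma> 0) \<gamma>' +
        (\<omega> 0 \<bullet> bloch_deriv (\<gamma> 0) \<gamma>' + \<omega>' \<bullet> bloch (\<gamma> 0)) *\<^sub>R bloch (\<gamma> 0))) (at 0)"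
    using has_vector_derivative_cong_ev[where S=UNIV and x=0 and f=\<omega> and g="\<lambda>t. s t *\<^sub>R bloch (\<gamma> t)"] eventually_nhds_x_imp_x[OF ev2]
    by (simp add: eventually_mono)
  then have "\<omega>' = s 0 *\<^sub>R bloch_deriv (\<gamma> 0) \<gamma>' +
        (\<omega> 0 \<bullet> bloch_deriv (\<gamma> 0) \<gamma>' + \<omega>' \<bullet> bloch (\<gamma> 0)) *\<^sub>R bloch (\<gamma> 0)"
    using vector_derivative_unique_at[OF \<omega>] by blast
  moreover have "s 0 = norm (\<omega> 0)"
  proof -
    have *: "\<omega> 0 = norm (\<omega> 0) *\<^sub>R bloch (\<gamma> 0)" by (intro pauli_eigen_bloch ev0)
    have "bloch (\<gamma> 0) \<bullet> bloch (\<gamma> 0) = 1"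
      using ev0 norm_bloch[of "\<gamma> 0"] by (simp add: power2_norm_eq_inner[symmetric])
    then show ?thesis unfolding s_def by (subst *) simp
  qed
  ultimately show "\<exists>k. \<omega>' = norm (\<omega> 0) *\<^sub>R bloch_deriv (\<gamma> 0) \<gamma>' + k *\<^sub>R bloch (\<gamma> 0)" by metis
qed

section \<open>The integrand of the second coefficient\<close>

lemma has_vector_derivative_line:
  assumes "f differentiable (at z)"
  shows "((\<lambda>t. f (z + t *\<^sub>R e)) has_vector_derivative frechet_derivative f (at z) e) (at 0)"
proof -
  let ?D = "frechet_derivative f (at z)"
  have D: "(f has_derivative ?D) (at (z + 0 *\<^sub>R e))"
    using iffD1[OF frechet_derivative_works assms] by simp
  have "((\<lambda>t. z + t *\<^sub>R e) has_derivative (\<lambda>t. t *\<^sub>R e)) (at 0)"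
    by (auto intro!: derivative_eq_intros)
  from has_derivative_compose[OF this D] show ?thesis
    unfolding has_vector_derivative_def
    by (simp add: linear_scale[OF has_derivative_linear[OF D]])
qed

lemma bounded_linear_vcnj: "bounded_linear (vcnj :: complex^'n \<Rightarrow> complex^'n)"
  by (intro linear_conv_bounded_linear[THEN iffD1] linearI) (simp_all add: vcnj_add vcnj_scaleR)

lemma frechet_derivative_vcnj:
  assumes "f differentiable (at z)"
  shows "frechet_derivative (\<lambda>y. vcnj (f y)) (at z) e = vcnj (frechet_derivative f (at z) e)"
proof -
  have "((\<lambda>y. vcnj (f y)) has_derivative (\<lambda>h. vcnj (frechet_derivative f (at z) h))) (at z)"
    using assms frechet_derivative_works by (intro bounded_linear.has_derivative[OF bounded_linear_vcnj]) blast
  then show ?thesis using frechet_derivative_at by metis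
qed

text \<open>\<open>triple\<close> is alternating, so multiples of \<open>n\<close> in the other two
  slots vanish.\<close>

lemma triple_scale_add:
  "triple (h *\<^sub>R n) (h *\<^sub>R p + k *\<^sub>R n) (h *\<^sub>R q + l *\<^sub>R n) = h ^ 3 * triple n p q"
  by (simp add: triple_expand algebra_simps power3_eq_cube)

locale weyl_symbol =
  fixes A :: "real^3 \<Rightarrow> real^3 \<Rightarrow> complex^2^2" and U :: "(real^3) set" and V :: "real^3 \<Rightarrow> real^3^3"
  assumes open_U: "open U" and smooth_V: "smooth_on V U"
    and symbol: "y \<in> U \<Longrightarrow> A y \<xi> = pauli (V y *v \<xi>)"
    and det_V: "y \<in> U \<Longrightarrow> det (V y) \<noteq> 0"
begin

lemma frame_eq: "y \<in> U \<Longrightarrow> frame A y = V y"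
  by (auto simp: vec_eq_iff frame_def symbol Let_def matrix_vector_mult_basis column_def forall_3)

lemma nonzero: "y \<in> U \<Longrightarrow> \<xi> \<noteq> 0 \<Longrightarrow> V y *v \<xi> \<noteq> 0"
  using det_V[of y] by (metis invertible_det_nz invertible_def matrix_left_invertible_ker)

lemma hplus_eq:
  assumes "y \<in> U" "\<xi> \<noteq> 0" shows "hplus A y \<xi> = norm (V y *v \<xi>)"
  unfolding hplus_def symbol[OF assms(1)]
proof (rule the_equality)
  show "0 < norm (V y *v \<xi>) \<and> (\<exists>u. u \<noteq> 0 \<and> pauli (V y *v \<xi>) *v u = of_real (norm (V y *v \<xi>)) *s u)"
    using ex_pauli_eigenvector nonzero[OF assms] by simp
  fix h assume "h > 0 \<and> (\<exists>u. u \<noteq> 0 \<and> pauli (V y *v \<xi>) *v u = of_real h *s u)"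
  then obtain u where "h > 0" "u \<noteq> 0" "pauli (V y *v \<xi>) *v u = of_real h *s u" by blast
  then show "h = norm (V y *v \<xi>)"
    using pauli_eigenvalue[of "V y *v \<xi>" u h] by (simp add: power2_eq_iff_nonneg)
qed

section \<open>Smooth local eigenvectors of the symbol\<close>

definition dom :: "((real^3) \<times> (real^3)) set" where "dom = U \<times> (- {0})"

lemma open_dom: "open dom"
  unfolding dom_def by (intro open_Times open_U) auto

lemma smooth_on_symbol_vector: "smooth_on (\<lambda>z. V (fst z) *v snd z) dom"
proof -
  have "smooth_on (\<lambda>z. V (fst z)) dom"
    by (rule smooth_on_compose[where f=fst and g=V and T=U, OF open_dom])
      (auto simp: dom_def smooth_V intro!: smooth_on_bounded_linear bounded_linear_fst open_dom[unfolded dom_def])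
  moreover have "smooth_on snd dom"
    by (intro smooth_on_bounded_linear bounded_linear_snd open_dom)
  ultimately show ?thesis
    unfolding matrix_vector_mult_def
    by (intro smooth_on_vec_lambda smooth_on_sum smooth_on_mult smooth_on_vec_nth open_dom)
qed

text \<open>Near \<open>z0\<close> the eigenvector stays nonzero and can be divided by its length,
  which is written as a power of the inner product to keep it visibly smooth.\<close>

lemma ex_normalised_eigenvector_near:
  assumes "open N" "z0 \<in> N" "N \<subseteq> dom" "smooth_on u N" "u z0 \<noteq> 0"
    and ev: "\<And>z. z \<in> N \<Longrightarrow> pauli (V (fst z) *v snd z) *v u z = of_real (norm (V (fst z) *v snd z)) *s u z"
  shows "\<exists>v N. open N \<and> z0 \<in> N \<and> smooth_on v N \<and>
    (\<forall>(y, \<eta>)\<in>N. A y \<eta> *v v (y, \<eta>) = of_real (hplus A y \<eta>) *s v (y, \<eta>) \<and> norm (v (y, \<eta>)) = 1)"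
proof (intro exI conjI)
  let ?N = "N \<inter> u -` (- {0})"
  let ?v = "\<lambda>z. (u z \<bullet> u z) powr (- 1 / 2) *\<^sub>R u z"
  show N: "open ?N"
    using smooth_on_imp_continuous_on[OF assms(4)] assms(1)
    by (simp add: continuous_on_open_vimage Int_commute open_Compl)
  show "z0 \<in> ?N" using assms by simp
  have u: "smooth_on u ?N" by (rule smooth_on_subset[OF assms(4)]) simp
  have "smooth_on (\<lambda>z. u z \<bullet> u z) ?N" by (rule smooth_on_bilinear[OF bounded_bilinear_inner N u u])
  then show "smooth_on ?v ?N"
    by (intro smooth_on_scaleR smooth_on_powr N u) auto
  show "\<forall>(y, \<eta>)\<in>?N. A y \<eta> *v ?v (y, \<eta>) = of_real (hplus A y \<eta>) *s ?v (y, \<eta>) \<and> norm (?v (y, \<eta>)) = 1"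
  proof (intro ballI, unfold split_paired_all case_prod_conv)
    fix y \<eta> assume "(y, \<eta>) \<in> ?N"
    then have *: "(y, \<eta>) \<in> N" "u (y, \<eta>) \<in> - {0}" by auto
    then have d: "y \<in> U" "\<eta> \<noteq> 0" using assms(3) by (auto simp: dom_def)
    have lin: "B *v (r *\<^sub>R v) = r *\<^sub>R (B *v v)" for B :: "complex^2^2" and r v
      by (simp add: vec_eq_iff matrix_vector_mult_def scaleR_right.sum)
    have "A y \<eta> *v ?v (y, \<eta>) = of_real (hplus A y \<eta>) *s ?v (y, \<eta>)"
      using ev[OF *(1)] by (simp add: symbol[OF d(1)] hplus_eq[OF d] lin vec_eq_iff)
    moreover have "norm (?v (y, \<eta>)) = 1"
    proof -
      have "u (y, \<eta>) \<bullet> u (y, \<eta>) = norm (u (y, \<eta>)) powr 2" "norm (u (y, \<eta>)) > 0"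
        using * by (simp_all add: powr_numeral power2_norm_eq_inner)
      then show ?thesis by (simp add: powr_powr powr_minus)
    qed
    ultimately show "A y \<eta> *v ?v (y, \<eta>) = of_real (hplus A y \<eta>) *s ?v (y, \<eta>) \<and> norm (?v (y, \<eta>)) = 1" ..
  qed
qed

text \<open>No single formula works for all directions. \<open>u1\<close> and \<open>u2\<close> are
  the two columns of |w| + \<open>pauli w\<close>; the diagonal entries add up to 2 |w|, so at each
  point at least one column is nonzero.\<close>

lemma ex_vplus_near:
  assumes "x \<in> U" "\<xi> \<noteq> 0"
  shows "\<exists>v N. open N \<and> (x, \<xi>) \<in> N \<and> smooth_on v N \<and>
    (\<forall>(y, \<eta>)\<in>N. A y \<eta> *v v (y, \<eta>) = of_real (hplus A y \<eta>) *s v (y, \<eta>) \<and> norm (v (y, \<eta>)) = 1)"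
proof -
  define \<omega> where "\<omega> z = V (fst z) *v snd z" for z
  define h where "h z = norm (\<omega> z)" for z
  have z0: "(x, \<xi>) \<in> dom" using assms by (simp add: dom_def)
  have \<omega>s: "smooth_on \<omega> dom" unfolding \<omega>_def[abs_def] by (rule smooth_on_symbol_vector)
  have \<omega>0: "\<omega> z \<noteq> 0" if "z \<in> dom" for z using that nonzero by (auto simp: \<omega>_def dom_def)
  have hs: "smooth_on h dom"
  proof (rule smooth_on_cong[OF open_dom])
    show "smooth_on (\<lambda>z. (\<omega> z \<bullet> \<omega> z) powr (1 / 2)) dom"
      by (intro smooth_on_powr smooth_on_bilinear[OF bounded_bilinear_inner] open_dom \<omega>s)
        (use \<omega>0 in auto)
    show "h z = (\<omega> z \<bullet> \<omega> z) powr (1 / 2)" if "z \<in> dom" for z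
      by (simp add: h_def powr_half_sqrt norm_eq_sqrt_inner)
  qed
  note S = smooth_on_add smooth_on_diff smooth_on_scaleR smooth_on_vec_nth open_dom \<omega>s hs smooth_on_const
  define u1 :: "(real^3) \<times> (real^3) \<Rightarrow> complex^2" where "u1 z = (h z + \<omega> z $ 3) *\<^sub>R axis 1 1 + (\<omega> z $ 1) *\<^sub>R axis 2 1 + (\<omega> z $ 2) *\<^sub>R axis 2 \<i>" for z
  define u2 :: "(real^3) \<times> (real^3) \<Rightarrow> complex^2" where "u2 z = (\<omega> z $ 1) *\<^sub>R axis 1 1 + (\<omega> z $ 2) *\<^sub>R axis 1 (- \<i>) + (h z - \<omega> z $ 3) *\<^sub>R axis 2 1" for z
  have hsq: "h z * h z = \<omega> z $ 1 * \<omega> z $ 1 + \<omega> z $ 2 * \<omega> z $ 2 + \<omega> z $ 3 * \<omega> z $ 3" for z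
    using norm_sq_vec3[of "\<omega> z"] by (simp add: h_def power2_eq_square)
  have e1: "pauli (\<omega> z) *v u1 z = of_real (h z) *s u1 z" for z
    unfolding pauli_eigen_iff using hsq[of z] by (simp add: u1_def axis_def algebra_simps)
  have e2: "pauli (\<omega> z) *v u2 z = of_real (h z) *s u2 z" for z
    unfolding pauli_eigen_iff using hsq[of z] by (simp add: u2_def axis_def algebra_simps)
  have s1: "smooth_on u1 dom" unfolding u1_def[abs_def] by (intro S)
  have s2: "smooth_on u2 dom" unfolding u2_def[abs_def] by (intro S)
  have "u1 (x, \<xi>) \<noteq> 0 \<or> u2 (x, \<xi>) \<noteq> 0"
  proof (rule ccontr)
    assume "\<not> ?thesis"
    then have "Re (u1 (x, \<xi>) $ 1) = 0" "Re (u2 (x, \<xi>) $ 2) = 0" by simp_all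
    then have "h (x, \<xi>) = 0" by (simp add: u1_def u2_def axis_def)
    then show False using \<omega>0[OF z0] by (simp add: h_def)
  qed
  then show ?thesis
    using ex_normalised_eigenvector_near[OF open_dom z0 order_refl s1]
      ex_normalised_eigenvector_near[OF open_dom z0 order_refl s2] e1 e2
    unfolding h_def \<omega>_def by blast
qed

text \<open>Turns the choice in \<open>vplus_near\<close> into usable facts. Smoothness, the
  eigenvector equation and the norm are all that is known, so what follows cannot depend on the
  phase.\<close>

lemma vplus_near:
  assumes "x \<in> U" "\<xi> \<noteq> 0"
  obtains N where "open N" "(x, \<xi>) \<in> N" "smooth_on (vplus_near A x \<xi>) N" "N \<subseteq> dom"
    "\<And>y \<eta>. (y, \<eta>) \<in> N \<Longrightarrow> pauli (V y *v \<eta>) *v vplus_near A x \<xi> (y, \<eta>) =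
      of_real (norm (V y *v \<eta>)) *s vplus_near A x \<xi> (y, \<eta>)"
    "\<And>y \<eta>. (y, \<eta>) \<in> N \<Longrightarrow> norm (vplus_near A x \<xi> (y, \<eta>)) = 1"
proof -
  from someI_ex[OF ex_vplus_near[OF assms]] obtain N where N: "open N" "(x, \<xi>) \<in> N"
    "smooth_on (vplus_near A x \<xi>) N"
    "\<forall>(y, \<eta>)\<in>N. A y \<eta> *v vplus_near A x \<xi> (y, \<eta>) = of_real (hplus A y \<eta>) *s vplus_near A x \<xi> (y, \<eta>) \<and>
      norm (vplus_near A x \<xi> (y, \<eta>)) = 1"
    unfolding vplus_near_def[symmetric] by blast
  show ?thesis
  proof (rule that[of "N \<inter> dom"])
    show "open (N \<inter> dom)" using N(1) open_dom by blast
    show "(x, \<xi>) \<in> N \<inter> dom" using N(2) assms by (simp add: dom_def)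
    show "smooth_on (vplus_near A x \<xi>) (N \<inter> dom)" by (rule smooth_on_subset[OF N(3)]) simp
    fix y \<eta> assume *: "(y, \<eta>) \<in> N \<inter> dom"
    then have "y \<in> U" "\<eta> \<noteq> 0" by (auto simp: dom_def)
    then show "pauli (V y *v \<eta>) *v vplus_near A x \<xi> (y, \<eta>) =
      of_real (norm (V y *v \<eta>)) *s vplus_near A x \<xi> (y, \<eta>)"
      using N(4) * by (auto simp: symbol hplus_eq)
    show "norm (vplus_near A x \<xi> (y, \<eta>)) = 1" using N(4) * by auto
  qed simp
qed

text \<open>Let p and q be the derivatives of the eigenvector in x and \<xi>, and I the sum over
  \<alpha> of the imaginary parts of p^H q. The generalised bracket enters with -2hI and the
  ordinary one with -hI. The triple products sum to 4h^3 I, so the total -3hI is -3/4 of their sum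
  over h^2, and the eigenvector is gone.\<close>

lemma b_integrand_eq:
  fixes A0 :: "real^3 \<Rightarrow> complex^2^2"
  assumes x: "x \<in> U" and \<xi>: "\<xi> \<noteq> 0"
  defines "w \<equiv> V x *v \<xi>" and "B \<equiv> subprincipal A A0 x"
  shows "b_integrand A A0 x \<xi> = trace B / 2 + of_real (w $ 1 / norm w) * ((B $ 1 $ 2 + B $ 2 $ 1) / 2)
    + of_real (w $ 2 / norm w) * (\<i> * (B $ 1 $ 2 - B $ 2 $ 1) / 2)
    + of_real (w $ 3 / norm w) * ((B $ 1 $ 1 - B $ 2 $ 2) / 2)
    - of_real (3 / 4 * ((\<Sum>\<alpha>\<in>UNIV. triple w (pderiv_at \<alpha> V x *v \<xi>) (V x *v axis \<alpha> 1)) / (norm w)\<^sup>2))"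
proof -
  define v where "v = vplus_near A x \<xi>"
  obtain N where N: "open N" "(x, \<xi>) \<in> N" "smooth_on v N" "N \<subseteq> dom"
    and ev: "\<And>y \<eta>. (y, \<eta>) \<in> N \<Longrightarrow> pauli (V y *v \<eta>) *v v (y, \<eta>) = of_real (norm (V y *v \<eta>)) *s v (y, \<eta>)"
    and nv: "\<And>y \<eta>. (y, \<eta>) \<in> N \<Longrightarrow> norm (v (y, \<eta>)) = 1"
    unfolding v_def using vplus_near[OF x \<xi>] by blast
  define u where "u = v (x, \<xi>)"
  define h where "h = norm w"
  have h0: "h > 0" using nonzero[OF x \<xi>] by (simp add: h_def w_def)
  have u1: "norm u = 1" using nv N(2) by (simp add: u_def)
  have wu: "w = h *\<^sub>R bloch u"
    using pauli_eigen_bloch[OF ev[OF N(2)] nv[OF N(2)]] by (simp add: w_def h_def u_def)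
  have Dv: "(v has_derivative frechet_derivative v (at (x, \<xi>))) (at (x, \<xi>))"
    by (rule smooth_on_has_derivative[OF N(3,2)])
  have d1: "(\<lambda>y. v (y, \<xi>)) differentiable (at x)"
    using has_derivative_compose[of "\<lambda>y. (y, \<xi>)" "\<lambda>h. (h, 0)" x UNIV v, OF _ Dv]
      has_derivative_Pair[OF has_derivative_ident has_derivative_const[of \<xi>]]
    unfolding differentiable_def by blast
  have d2: "(\<lambda>\<eta>. v (x, \<eta>)) differentiable (at \<xi>)"
    using has_derivative_compose[of "\<lambda>\<eta>. (x, \<eta>)" "\<lambda>h. (0, h)" \<xi> UNIV v, OF _ Dv]
      has_derivative_Pair[OF has_derivative_const[of x] has_derivative_ident]
    unfolding differentiable_def by blast
  define p where "p \<alpha> = dx \<alpha> v x \<xi>" for \<alpha>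
  define q where "q \<alpha> = dxi \<alpha> v x \<xi>" for \<alpha>
  have p': "dx \<alpha> (\<lambda>z. vcnj (v z)) x \<xi> = vcnj (p \<alpha>)" for \<alpha>
    unfolding p_def dx_def pderiv_at_def by (rule frechet_derivative_vcnj[OF d1])
  have q': "dxi \<alpha> (\<lambda>z. vcnj (v z)) x \<xi> = vcnj (q \<alpha>)" for \<alpha>
    unfolding q_def dxi_def pderiv_at_def by (rule frechet_derivative_vcnj[OF d2])
  \<comment> \<open>Moving \<open>x\<close> along a coordinate line moves the symbol vector with
    velocity \<open>pderiv_at \<alpha> V x *v \<xi>\<close>.\<close>
  have P: "Re (rowcol (vcnj u) (p \<alpha>)) = 0 \<and>
      (\<exists>k. pderiv_at \<alpha> V x *v \<xi> = h *\<^sub>R bloch_deriv u (p \<alpha>) + k *\<^sub>R bloch u)" for \<alpha>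
  proof -
    let ?\<gamma> = "\<lambda>t. v (x + t *\<^sub>R axis \<alpha> 1, \<xi>)" and ?\<omega> = "\<lambda>t. V (x + t *\<^sub>R axis \<alpha> 1) *v \<xi>"
    have 1: "(?\<gamma> has_vector_derivative p \<alpha>) (at 0)"
      unfolding p_def dx_def pderiv_at_def by (rule has_vector_derivative_line[OF d1])
    have "((\<lambda>t. V (x + t *\<^sub>R axis \<alpha> 1)) has_vector_derivative pderiv_at \<alpha> V x) (at 0)"
      unfolding pderiv_at_def
      by (rule has_vector_derivative_line)
        (use smooth_on_has_derivative[OF smooth_V x] differentiable_def in blast)
    moreover have "bounded_linear (\<lambda>M. M *v \<xi> :: real^3)"
      by (intro linear_conv_bounded_linear[THEN iffD1] linearI)
        (simp_all add: vec_eq_iff matrix_vector_mult_def sum.distrib sum_distrib_left algebra_simps)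
    ultimately have 2: "(?\<omega> has_vector_derivative pderiv_at \<alpha> V x *v \<xi>) (at 0)"
      using bounded_linear.has_vector_derivative by blast
    have "((\<lambda>t. (x + t *\<^sub>R axis \<alpha> 1, \<xi>)) \<longlongrightarrow> (x + 0 *\<^sub>R axis \<alpha> 1, \<xi>)) (nhds 0)"
      by (intro tendsto_intros filterlim_ident)
    then have "\<forall>\<^sub>F t in nhds 0. (x + t *\<^sub>R axis \<alpha> 1, \<xi>) \<in> N"
      using N(1,2) by (auto dest: topological_tendstoD)
    then have 3: "\<forall>\<^sub>F t in nhds 0. pauli (?\<omega> t) *v ?\<gamma> t = of_real (norm (?\<omega> t)) *s ?\<gamma> t \<and> norm (?\<gamma> t) = 1"
      by eventually_elim (use ev nv in blast)
    show ?thesis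
      using eigenvector_curve[OF 1 2 3] by (simp add: u_def h_def w_def)
  qed
  \<comment> \<open>Moving \<open>\<xi>\<close> instead moves it along a straight line, whose
    velocity is a column of \<open>V x\<close>.\<close>
  have Q: "Re (rowcol (vcnj u) (q \<alpha>)) = 0 \<and>
      (\<exists>k. V x *v axis \<alpha> 1 = h *\<^sub>R bloch_deriv u (q \<alpha>) + k *\<^sub>R bloch u)" for \<alpha>
  proof -
    let ?\<gamma> = "\<lambda>t. v (x, \<xi> + t *\<^sub>R axis \<alpha> 1)" and ?\<omega> = "\<lambda>t. V x *v (\<xi> + t *\<^sub>R axis \<alpha> 1)"
    have 1: "(?\<gamma> has_vector_derivative q \<alpha>) (at 0)"
      unfolding q_def dxi_def pderiv_at_def by (rule has_vector_derivative_line[OF d2])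
    have 2: "(?\<omega> has_vector_derivative V x *v axis \<alpha> 1) (at 0)"
    proof -
      have "((\<lambda>t. V x *v \<xi> + t *\<^sub>R (V x *v axis \<alpha> 1)) has_vector_derivative V x *v axis \<alpha> 1) (at 0)"
        by (auto intro!: derivative_eq_intros)
      then show ?thesis by (simp add: matrix_vector_right_distrib scaleR_matrix_vector_assoc matrix_vector_mult_scaleR)
    qed
    have "((\<lambda>t. (x, \<xi> + t *\<^sub>R axis \<alpha> 1)) \<longlongrightarrow> (x, \<xi> + 0 *\<^sub>R axis \<alpha> 1)) (nhds 0)"
      by (intro tendsto_intros filterlim_ident)
    then have "\<forall>\<^sub>F t in nhds 0. (x, \<xi> + t *\<^sub>R axis \<alpha> 1) \<in> N"
      using N(1,2) by (auto dest: topological_tendstoD)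
    then have 3: "\<forall>\<^sub>F t in nhds 0. pauli (?\<omega> t) *v ?\<gamma> t = of_real (norm (?\<omega> t)) *s ?\<gamma> t \<and> norm (?\<gamma> t) = 1"
      by eventually_elim (use ev nv in blast)
    show ?thesis
      using eigenvector_curve[OF 1 2 3] by (simp add: u_def h_def w_def)
  qed
  define I where "I \<alpha> = Im (rowcol (vcnj (p \<alpha>)) (q \<alpha>))" for \<alpha>
  have T: "triple w (pderiv_at \<alpha> V x *v \<xi>) (V x *v axis \<alpha> 1) = 4 * h ^ 3 * I \<alpha>" for \<alpha>
  proof -
    obtain k where k: "pderiv_at \<alpha> V x *v \<xi> = h *\<^sub>R bloch_deriv u (p \<alpha>) + k *\<^sub>R bloch u" using P by blast
    obtain l where l: "V x *v axis \<alpha> 1 = h *\<^sub>R bloch_deriv u (q \<alpha>) + l *\<^sub>R bloch u" using Q by blast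
    show ?thesis
      unfolding k l wu triple_scale_add I_def
      using triple_bloch[OF u1, of "p \<alpha>" "q \<alpha>"] P Q by simp
  qed
  let ?Q = "\<lambda>(y, \<eta>). A y \<eta> - mat (of_real (hplus A y \<eta>))"
  have Qx: "?Q (x, \<xi>) = pauli (h *\<^sub>R bloch u) - mat (of_real h)"
    by (simp add: symbol[OF x] hplus_eq[OF x \<xi>] w_def[symmetric] h_def[symmetric] wu[symmetric])
  have gp: "gen_poisson (\<lambda>z. vcnj (v z)) ?Q v x \<xi> = (\<Sum>\<alpha>\<in>UNIV. - 4 * \<i> * of_real h * of_real (I \<alpha>))"
    unfolding gen_poisson_def p' q' p_def[symmetric] q_def[symmetric] Qx I_def
    by (intro sum.cong refl pauli_bloch_im u1) (use P Q in auto)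
  have po: "poisson (\<lambda>z. vcnj (v z)) v x \<xi> = (\<Sum>\<alpha>\<in>UNIV. 2 * \<i> * of_real (I \<alpha>))"
    unfolding poisson_def p' q' p_def[symmetric] q_def[symmetric] I_def
    by (intro sum.cong refl rowcol_antisym_im)
  have "b_integrand A A0 x \<xi> = rowcol (vcnj u) (B *v u) - 3 * of_real h * of_real (\<Sum>\<alpha>\<in>UNIV. I \<alpha>)"
    unfolding b_integrand_def Let_def v_def[symmetric] gp po u_def[symmetric] B_def
      hplus_eq[OF x \<xi>] w_def[symmetric] h_def[symmetric]
    by (simp add: sum_distrib_left[symmetric] sum_distrib_right[symmetric] algebra_simps sum_negf)
  also have "\<dots> = rowcol (vcnj u) (B *v u) -
      of_real (3 / 4 * ((\<Sum>\<alpha>\<in>UNIV. triple w (pderiv_at \<alpha> V x *v \<xi>) (V x *v axis \<alpha> 1)) / h\<^sup>2))"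
    unfolding T sum_distrib_left[symmetric] using h0 by (simp add: power3_eq_cube power2_eq_square)
  also have "rowcol (vcnj u) (B *v u) = trace B / 2 + of_real (w $ 1 / norm w) * ((B $ 1 $ 2 + B $ 2 $ 1) / 2)
    + of_real (w $ 2 / norm w) * (\<i> * (B $ 1 $ 2 - B $ 2 $ 1) / 2)
    + of_real (w $ 3 / norm w) * ((B $ 1 $ 1 - B $ 2 $ 2) / 2)"
  proof -
    have "w $ i / norm w = bloch u $ i" for i
      using h0 by (simp add: h_def[symmetric]) (simp add: wu)
    then show ?thesis using expectation_bloch[OF u1] by simp
  qed
  finally show ?thesis by (simp add: h_def)
qed

end

lemma matrix_inv_mult:
  fixes A :: "real^'n^'n"
  assumes "invertible A"
  shows matrix_inv_left: "matrix_inv A ** A = mat 1" and matrix_inv_right: "A ** matrix_inv A = mat 1"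
proof -
  have "A ** matrix_inv A = mat 1 \<and> matrix_inv A ** A = mat 1"
    unfolding matrix_inv_def by (rule someI_ex) (rule assms[unfolded invertible_def])
  then show "matrix_inv A ** A = mat 1" "A ** matrix_inv A = mat 1" by blast+
qed

section \<open>Averages over the unit ball\<close>

text \<open>The image of the domain of integration under \<xi> \<mapsto> w. Functions of the
  direction are continuous on it, but not across the origin.\<close>

definition punctured_ball :: "(real^3) set" where "punctured_ball = {w. w \<noteq> 0 \<and> norm w < 1}"

lemma punctured_ball_lmeasurable: "punctured_ball \<in> lmeasurable"
proof (rule lmeasurable_open)
  have e: "punctured_ball = ball 0 1 - {0}" by (auto simp: punctured_ball_def)
  show "bounded punctured_ball" unfolding e by (rule bounded_subset[OF bounded_ball]) auto
  show "open punctured_ball" unfolding e by (intro open_Diff) auto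
qed

lemma absolutely_integrable_punctured_ball:
  fixes f :: "real^3 \<Rightarrow> real"
  assumes "continuous_on punctured_ball f" "\<And>w. w \<in> punctured_ball \<Longrightarrow> \<bar>f w\<bar> \<le> 1"
  shows "f absolutely_integrable_on punctured_ball"
proof (rule measurable_bounded_by_integrable_imp_absolutely_integrable)
  show "punctured_ball \<in> sets lebesgue" using punctured_ball_lmeasurable by blast
  then show "f \<in> borel_measurable (lebesgue_on punctured_ball)"
    by (intro continuous_imp_measurable_on_sets_lebesgue assms(1))
  show "(\<lambda>w. 1::real) integrable_on punctured_ball"
    by (rule integrable_on_const[OF punctured_ball_lmeasurable])
  show "norm (f w) \<le> 1" if "w \<in> punctured_ball" for w
    using assms(2)[OF that] by simp
qed

lemma has_integral_linear_substitution:
  fixes f :: "real^3 \<Rightarrow> real" and M :: "real^3^3"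
  assumes f: "f absolutely_integrable_on punctured_ball" and M: "det M \<noteq> 0"
  shows "((\<lambda>\<xi>. f (M *v \<xi>)) has_integral (integral punctured_ball f / \<bar>det M\<bar>)) {\<xi>. \<xi> \<noteq> 0 \<and> norm (M *v \<xi>) < 1}"
proof -
  let ?S = "{\<xi>. \<xi> \<noteq> 0 \<and> norm (M *v \<xi>) < 1}"
  have inv: "invertible M" using M by (simp add: invertible_det_nz)
  have inj: "M *v \<xi> = 0 \<longleftrightarrow> \<xi> = 0" for \<xi>
    using inv by (metis invertible_def matrix_left_invertible_ker matrix_vector_mult_0_right)
  have S: "(*v) M ` ?S = punctured_ball"
  proof safe
    fix w assume "w \<in> punctured_ball"
    moreover have "w = M *v (matrix_inv M *v w)"
      using matrix_inv_right[OF inv] by (simp add: matrix_vector_mul_assoc)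
    ultimately show "w \<in> (*v) M ` ?S"
      using inj[of "matrix_inv M *v w"] by (intro image_eqI[of _ _ "matrix_inv M *v w"]) (auto simp: punctured_ball_def)
  qed (auto simp: punctured_ball_def inj)
  \<comment> \<open>The substitution rule applied below concerns functions with values in a
    Cartesian power, so \<open>f\<close> is read as a map into \<open>real^1\<close>.\<close>
  define F :: "real^3 \<Rightarrow> real^1" where "F w = axis 1 (f w)" for w
  have bl: "bounded_linear (axis 1 :: real \<Rightarrow> real^1)"
    by (intro linear_conv_bounded_linear[THEN iffD1] linearI) (auto simp: vec_eq_iff axis_def)
  have F: "F absolutely_integrable_on punctured_ball"
    using absolutely_integrable_linear[OF f bl] by (simp add: F_def[abs_def] o_def)
  have iF: "integral punctured_ball F = axis 1 (integral punctured_ball f)"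
    using integral_linear[OF _ bl, of f punctured_ball] f
    by (simp add: F_def[abs_def] o_def absolutely_integrable_on_def)
  have G: "(\<lambda>x. \<bar>det (matrix ((*v) M))\<bar> *\<^sub>R F (M *v x)) absolutely_integrable_on ?S \<and>
      integral ?S (\<lambda>x. \<bar>det (matrix ((*v) M))\<bar> *\<^sub>R F (M *v x)) = axis 1 (integral punctured_ball f)"
    unfolding has_absolute_integral_change_of_variables_linear[OF matrix_vector_mul_linear] S
    using F iF by blast
  then have "((\<lambda>x. \<bar>det M\<bar> *\<^sub>R F (M *v x)) has_integral axis 1 (integral punctured_ball f)) ?S"
    by (simp add: absolutely_integrable_on_def has_integral_integrable_integral)
  from has_integral_linear[OF this bounded_linear_vec_nth[of 1]]
  have "((\<lambda>x. \<bar>det M\<bar> * f (M *v x)) has_integral integral punctured_ball f) ?S"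
    by (simp add: F_def o_def)
  from has_integral_mult_right[OF this, of "1 / \<bar>det M\<bar>"] show ?thesis using M by simp
qed

text \<open>An orthogonal map preserves the punctured ball and has determinant of modulus 1.\<close>

lemma integral_punctured_ball_orthogonal:
  fixes f :: "real^3 \<Rightarrow> real"
  assumes "f absolutely_integrable_on punctured_ball" "orthogonal_transformation T"
  shows "integral punctured_ball (\<lambda>w. f (T w)) = integral punctured_ball f"
proof -
  have lin: "linear T" and nT: "norm (T w) = norm w" for w
    using assms(2) by (simp_all add: orthogonal_transformation)
  have "orthogonal_matrix (matrix T)" using assms(2) orthogonal_transformation_matrix by blast
  then have d: "\<bar>det (matrix T)\<bar> = 1" using det_orthogonal_matrix by fastforce
  have mT: "matrix T *v w = T w" for w by (simp add: matrix_works lin)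
  have "((\<lambda>\<xi>. f (T \<xi>)) has_integral integral punctured_ball f) punctured_ball"
    using has_integral_linear_substitution[OF assms(1), of "matrix T"] d
    by (auto simp: mT nT punctured_ball_def)
  then show ?thesis by (rule integral_unique)
qed

section \<open>Reflections and swaps of coordinates\<close>

definition reflect_coord :: "3 \<Rightarrow> real^3 \<Rightarrow> real^3"
  where "reflect_coord j w = (\<chi> a. if a = j then - w $ a else w $ a)"

definition swap_coords :: "3 \<Rightarrow> 3 \<Rightarrow> real^3 \<Rightarrow> real^3"
  where "swap_coords j k w = (\<chi> a. w $ (if a = j then k else if a = k then j else a))"

lemma orthogonal_reflect_coord: "orthogonal_transformation (reflect_coord j)"
  unfolding orthogonal_transformation_def
proof (intro conjI allI linearI)
  show "reflect_coord j v \<bullet> reflect_coord j w = v \<bullet> w" for v w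
    by (auto simp: reflect_coord_def inner_vec_def intro!: sum.cong)
qed (auto simp: reflect_coord_def vec_eq_iff)

lemma orthogonal_swap_coords: "orthogonal_transformation (swap_coords j k)"
  unfolding orthogonal_transformation_def
proof (intro conjI allI linearI)
  show "swap_coords j k v \<bullet> swap_coords j k w = v \<bullet> w" for v w
    using exhaust_3[of j] exhaust_3[of k]
    by (auto simp: swap_coords_def inner_vec_def sum_3)
qed (auto simp: swap_coords_def vec_eq_iff)

section \<open>Integrals of functions of the direction\<close>

lemma absolutely_integrable_direction: "(\<lambda>w. w $ j / norm w) absolutely_integrable_on punctured_ball"
proof (rule absolutely_integrable_punctured_ball)
  show "continuous_on punctured_ball (\<lambda>w. w $ j / norm w)"
    by (intro continuous_intros continuous_on_component) (auto simp: punctured_ball_def)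
  show "\<bar>w $ j / norm w\<bar> \<le> 1" for w using component_le_norm_cart[of w j] by (simp add: divide_le_eq)
qed

lemma absolutely_integrable_direction2:
  "(\<lambda>w. w $ j * w $ k / (norm w)\<^sup>2) absolutely_integrable_on punctured_ball"
proof (rule absolutely_integrable_punctured_ball)
  show "continuous_on punctured_ball (\<lambda>w. w $ j * w $ k / (norm w)\<^sup>2)"
    by (intro continuous_intros continuous_on_component) (auto simp: punctured_ball_def)
  show "\<bar>w $ j * w $ k / (norm w)\<^sup>2\<bar> \<le> 1" for w
    using mult_mono[OF component_le_norm_cart[of w j] component_le_norm_cart[of w k]]
    by (simp add: divide_le_eq abs_mult power2_eq_square)
qed

lemma absolutely_integrable_one: "(\<lambda>w. 1::real) absolutely_integrable_on punctured_ball"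
  by (rule absolutely_integrable_punctured_ball) auto

lemma integral_one: "integral punctured_ball (\<lambda>w. 1::real) = 4 / 3 * pi"
proof -
  have "integral punctured_ball (\<lambda>w. 1::real) = integral (ball (0::real^3) 1) (\<lambda>w. 1)"
    by (rule integral_spike_set; rule negligible_subset[OF negligible_sing[of 0]])
      (auto simp: punctured_ball_def)
  also have "\<dots> = measure lebesgue (ball (0::real^3) 1)"
    by (rule lmeasure_integral[symmetric]) simp
  also have "\<dots> = 4 / 3 * pi"
    by (simp add: content_ball measure_completion unit_ball_vol_3)
  finally show ?thesis .
qed

lemma integral_direction: "integral punctured_ball (\<lambda>w. w $ j / norm w) = 0"
proof -
  have "norm (reflect_coord j w) = norm w" for w
    using orthogonal_reflect_coord by (simp add: orthogonal_transformation)
  then have "integral punctured_ball (\<lambda>w. - (w $ j / norm w)) = integral punctured_ball (\<lambda>w. w $ j / norm w)"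
    using integral_punctured_ball_orthogonal[OF absolutely_integrable_direction[of j] orthogonal_reflect_coord[of j]]
    by (simp add: reflect_coord_def)
  then show ?thesis by simp
qed

text \<open>Off the diagonal the integrand is odd under reflecting one coordinate. The diagonal
  integrals agree by swapping coordinates and add up to the volume 4/3 pi, so each is a third of
  it.\<close>

lemma integral_direction2:
  "integral punctured_ball (\<lambda>w. w $ j * w $ k / (norm w)\<^sup>2) = (if j = k then 4 / 9 * pi else 0)"
proof (cases "j = k")
  case False
  have "norm (reflect_coord j w) = norm w" for w
    using orthogonal_reflect_coord by (simp add: orthogonal_transformation)
  then have "integral punctured_ball (\<lambda>w. - (w $ j * w $ k / (norm w)\<^sup>2)) =
      integral punctured_ball (\<lambda>w. w $ j * w $ k / (norm w)\<^sup>2)"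
    using integral_punctured_ball_orthogonal[OF absolutely_integrable_direction2[of j k] orthogonal_reflect_coord[of j]] False
    by (simp add: reflect_coord_def)
  then show ?thesis using False by simp
next
  case True
  let ?I = "\<lambda>l. integral punctured_ball (\<lambda>w. w $ l * w $ l / (norm w)\<^sup>2)"
  have "norm (swap_coords j l w) = norm w" for w l
    using orthogonal_swap_coords by (simp add: orthogonal_transformation)
  then have eq: "?I l = ?I j" for l
    using integral_punctured_ball_orthogonal[OF absolutely_integrable_direction2[of j j] orthogonal_swap_coords[of j l]]
    by (simp add: swap_coords_def)
  have int: "(\<lambda>w. w $ l * w $ l / (norm w)\<^sup>2) integrable_on punctured_ball" for l
    using absolutely_integrable_direction2[of l l] absolutely_integrable_on_def by blast
  have "(\<Sum>l\<in>UNIV. ?I l) = integral punctured_ball (\<lambda>w. \<Sum>l\<in>UNIV. w $ l * w $ l / (norm w)\<^sup>2)"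
    by (rule integral_sum[symmetric]) (use int in auto)
  also have "\<dots> = integral punctured_ball (\<lambda>w. 1)"
  proof (rule integral_cong)
    fix w assume "w \<in> punctured_ball"
    then have "(norm w)\<^sup>2 \<noteq> 0" by (simp add: punctured_ball_def)
    then show "(\<Sum>l\<in>UNIV. w $ l * w $ l / (norm w)\<^sup>2) = 1"
      by (simp add: sum_divide_distrib[symmetric] power2_norm_eq_inner inner_vec_def)
  qed
  finally have "(\<Sum>l\<in>UNIV. ?I l) = 4 / 3 * pi" unfolding integral_one .
  moreover have "(\<Sum>l\<in>UNIV. ?I l) = (\<Sum>l\<in>(UNIV::3 set). ?I j)"
    by (rule sum.cong[OF refl eq])
  ultimately have "3 * ?I j = 4 / 3 * pi" by simp
  then show ?thesis unfolding True[symmetric] by simp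
qed

context weyl_symbol begin

text \<open>The trace of the quadratic form in \<open>w = V \<xi>\<close> that the curvature of the eigenvector contributes
  to the integrand; only the trace survives the average over directions.\<close>

definition chirality :: "real^3 \<Rightarrow> real"
  where "chirality x = (\<Sum>\<alpha>\<in>UNIV. \<Sum>m\<in>UNIV.
    triple (axis m 1) (pderiv_at \<alpha> V x *v (matrix_inv (V x) *v axis m 1)) (V x *v axis \<alpha> 1))"

text \<open>With d = |det V|, the trace term yields -3/(2 pi)^3 times 4 pi/(3 d) times half the
  trace, which is -2/(8 pi^2 d) times the trace. The curvature term yields 3/(2 pi)^3 times 3/4
  times 4 pi/(9 d), which is 1/(8 pi^2 d), times \<open>chirality\<close>. The terms odd in w
  average to 0.\<close>

lemma b_coeff_eq:
  fixes A0 :: "real^3 \<Rightarrow> complex^2^2"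
  assumes x: "x \<in> U"
  shows "b_coeff A A0 x = of_real (1 / (8 * pi\<^sup>2)) *
    ((of_real (chirality x) - 2 * trace (subprincipal A A0 x)) / of_real \<bar>det (V x)\<bar>)"
proof -
  define B where "B = subprincipal A A0 x"
  define S where "S = {\<xi>. \<xi> \<noteq> 0 \<and> norm (V x *v \<xi>) < 1}"
  define Y where "Y = matrix_inv (V x)"
  define d where "d = \<bar>det (V x)\<bar>"
  have d0: "d > 0" using det_V[OF x] by (simp add: d_def)
  have Y: "Y *v (V x *v \<xi>) = \<xi>" for \<xi>
    using det_V[OF x] matrix_inv_left[of "V x"] by (simp add: Y_def matrix_vector_mul_assoc invertible_det_nz)
  \<comment> \<open>The coefficients of the curvature term as a quadratic form in w, after \<xi> has
    been replaced by \<open>Y *v w\<close>.\<close>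
  define q where "q j m = (\<Sum>\<alpha>\<in>UNIV. triple (axis j 1) (pderiv_at \<alpha> V x *v (Y *v axis m 1)) (V x *v axis \<alpha> 1))"
    for j m
  have quad: "(\<Sum>\<alpha>\<in>UNIV. triple w (pderiv_at \<alpha> V x *v (Y *v w)) (V x *v axis \<alpha> 1)) =
      (\<Sum>j\<in>UNIV. \<Sum>m\<in>UNIV. q j m * (w $ j * w $ m))" for w
  proof -
    have lin1: "triple w u v = (\<Sum>j\<in>UNIV. w $ j * triple (axis j 1) u v)" for w u v
      by (simp add: triple_expand sum_3 axis_def algebra_simps)
    have lin2: "triple u (\<Sum>m\<in>UNIV. c m *\<^sub>R f m) v = (\<Sum>m\<in>UNIV. c m * triple u (f m) v)"
      for u v c and f :: "3 \<Rightarrow> real^3"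
      by (simp add: triple_expand sum_3 algebra_simps)
    have e: "pderiv_at \<alpha> V x *v (Y *v w) = (\<Sum>m\<in>UNIV. w $ m *\<^sub>R (pderiv_at \<alpha> V x *v (Y *v axis m 1)))" for \<alpha>
    proof -
      have "M *v w = (\<Sum>m\<in>UNIV. w $ m *\<^sub>R (M *v axis m 1))" for M :: "real^3^3"
        by (subst matrix_mult_sum) (simp only: matrix_vector_mult_basis scalar_mult_eq_scaleR)
      from this[of "pderiv_at \<alpha> V x ** Y"] show ?thesis by (simp add: matrix_vector_mul_assoc)
    qed
    have "(\<Sum>\<alpha>\<in>UNIV. triple w (pderiv_at \<alpha> V x *v (Y *v w)) (V x *v axis \<alpha> 1)) =
        (\<Sum>\<alpha>\<in>UNIV. \<Sum>j\<in>UNIV. \<Sum>m\<in>UNIV. w $ j * (w $ m *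
          triple (axis j 1) (pderiv_at \<alpha> V x *v (Y *v axis m 1)) (V x *v axis \<alpha> 1)))"
      by (subst lin1, subst e, subst lin2) (simp add: sum_distrib_left)
    also have "\<dots> = (\<Sum>j\<in>UNIV. \<Sum>m\<in>UNIV. q j m * (w $ j * w $ m))"
      unfolding q_def sum_distrib_right
      by (subst sum.swap, rule sum.cong[OF refl], subst sum.swap) (simp add: mult_ac)
    finally show ?thesis .
  qed
  have ch: "chirality x = (\<Sum>j\<in>UNIV. q j j)"
    unfolding chirality_def q_def Y_def[symmetric] by (rule sum.swap)
  note sub = has_integral_linear_substitution[OF _ det_V[OF x], folded S_def d_def]
  note J0 = sub[OF absolutely_integrable_one, unfolded integral_one]
  note J1 = sub[OF absolutely_integrable_direction, unfolded integral_direction]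
  note J2 = sub[OF absolutely_integrable_direction2, unfolded integral_direction2]
  have J: "((\<lambda>\<xi>. \<Sum>j\<in>UNIV. \<Sum>m\<in>UNIV. q j m * ((V x *v \<xi>) $ j * (V x *v \<xi>) $ m / (norm (V x *v \<xi>))\<^sup>2))
      has_integral (\<Sum>j\<in>UNIV. \<Sum>m\<in>UNIV. q j m * ((if j = m then 4 / 9 * pi else 0) / d))) S"
    by (intro has_integral_sum finite has_integral_mult_right J2)
  have Jv: "(\<Sum>j\<in>UNIV. \<Sum>m\<in>UNIV. q j m * ((if j = m then 4 / 9 * pi else 0) / d)) = 4 / 9 * pi * chirality x / d"
  proof -
    have "q j m * ((if j = m then 4 / 9 * pi else 0) / d) = (if j = m then 4 / 9 * pi * q j j / d else 0)" for j m
      by simp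
    then show ?thesis by (simp only: sum.delta[OF finite] UNIV_I if_True ch sum_distrib_left
          sum_divide_distrib sum.delta'[OF finite])
  qed
  \<comment> \<open>Factors such as \<open>of_real 1\<close> and \<open>0 / d\<close> are left
    standing so that each summand has the shape of an integration rule.\<close>
  have I0: "((\<lambda>\<xi>. of_real 1 * (trace B / 2) + of_real ((V x *v \<xi>) $ 1 / norm (V x *v \<xi>)) * ((B $ 1 $ 2 + B $ 2 $ 1) / 2)
    + of_real ((V x *v \<xi>) $ 2 / norm (V x *v \<xi>)) * (\<i> * (B $ 1 $ 2 - B $ 2 $ 1) / 2)
    + of_real ((V x *v \<xi>) $ 3 / norm (V x *v \<xi>)) * ((B $ 1 $ 1 - B $ 2 $ 2) / 2)
    - of_real (3 / 4 * (\<Sum>j\<in>UNIV. \<Sum>m\<in>UNIV. q j m * ((V x *v \<xi>) $ j * (V x *v \<xi>) $ m / (norm (V x *v \<xi>))\<^sup>2))))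
    has_integral (of_real (4 / 3 * pi / d) * (trace B / 2) + of_real (0 / d) * ((B $ 1 $ 2 + B $ 2 $ 1) / 2)
    + of_real (0 / d) * (\<i> * (B $ 1 $ 2 - B $ 2 $ 1) / 2) + of_real (0 / d) * ((B $ 1 $ 1 - B $ 2 $ 2) / 2)
    - of_real (3 / 4 * (4 / 9 * pi * chirality x / d)))) S"
    by (intro has_integral_diff has_integral_add has_integral_mult_left has_integral_of_real
        has_integral_mult_right J0 J1 J[unfolded Jv])
  have eq: "of_real 1 * (trace B / 2) + of_real ((V x *v \<xi>) $ 1 / norm (V x *v \<xi>)) * ((B $ 1 $ 2 + B $ 2 $ 1) / 2)
    + of_real ((V x *v \<xi>) $ 2 / norm (V x *v \<xi>)) * (\<i> * (B $ 1 $ 2 - B $ 2 $ 1) / 2)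
    + of_real ((V x *v \<xi>) $ 3 / norm (V x *v \<xi>)) * ((B $ 1 $ 1 - B $ 2 $ 2) / 2)
    - of_real (3 / 4 * (\<Sum>j\<in>UNIV. \<Sum>m\<in>UNIV. q j m * ((V x *v \<xi>) $ j * (V x *v \<xi>) $ m / (norm (V x *v \<xi>))\<^sup>2)))
    = b_integrand A A0 x \<xi>" if "\<xi> \<in> S" for \<xi>
  proof -
    have "(\<Sum>\<alpha>\<in>UNIV. triple (V x *v \<xi>) (pderiv_at \<alpha> V x *v \<xi>) (V x *v axis \<alpha> 1)) / (norm (V x *v \<xi>))\<^sup>2 =
      (\<Sum>j\<in>UNIV. \<Sum>m\<in>UNIV. q j m * ((V x *v \<xi>) $ j * (V x *v \<xi>) $ m / (norm (V x *v \<xi>))\<^sup>2))"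
      using quad[of "V x *v \<xi>"] unfolding Y by (simp only: sum_divide_distrib times_divide_eq_right)
    then show ?thesis
      using that b_integrand_eq[OF x, of \<xi> A0] unfolding S_def B_def by simp
  qed
  \<comment> \<open>Naming the complex images of the real constants leaves a rational identity in
    \<open>p\<close>, \<open>k\<close>, \<open>D\<close> and the trace.\<close>
  define p k D where "p = complex_of_real pi" and "k = complex_of_real (chirality x)" and "D = complex_of_real d"
  have nz: "p \<noteq> 0" "D \<noteq> 0" using d0 by (simp_all add: p_def D_def)
  have "((\<lambda>\<xi>. b_integrand A A0 x \<xi>) has_integral (4 / 3 * p / D * (trace B / 2) - 3 / 4 * (4 / 9 * p * k / D))) S"
    using has_integral_eq[OF eq I0] by (simp add: p_def k_def D_def)
  from has_integral_mult_left[OF this, of "of_real (1 / (2 * pi) ^ 3)"]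
  have "integral S (\<lambda>\<xi>. b_integrand A A0 x \<xi> * of_real (1 / (2 * pi) ^ 3)) =
    (4 / 3 * p / D * (trace B / 2) - 3 / 4 * (4 / 9 * p * k / D)) * of_real (1 / (2 * pi) ^ 3)"
    by (rule integral_unique)
  moreover have "{\<xi>. \<xi> \<noteq> 0 \<and> hplus A x \<xi> < 1} = S"
    using hplus_eq[OF x] by (auto simp: S_def)
  ultimately have "b_coeff A A0 x = - 3 * ((4 / 3 * p / D * (trace B / 2) - 3 / 4 * (4 / 9 * p * k / D)) *
      (1 / (2 * p) ^ 3))"
    unfolding b_coeff_def p_def by simp
  also have "\<dots> = 1 / (8 * p\<^sup>2) * ((k - 2 * trace B) / D)"
    using nz by (simp add: field_simps power2_eq_square power3_eq_cube)
  finally show ?thesis by (simp add: B_def d_def p_def k_def D_def)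
qed

end

section \<open>Metric and torsion\<close>

lemma quadratic_form_inner:
  fixes G :: "real^'n^'n"
  shows "(\<Sum>\<alpha>\<in>UNIV. \<Sum>\<beta>\<in>UNIV. G $ \<alpha> $ \<beta> * \<xi> $ \<alpha> * \<xi> $ \<beta>) = \<xi> \<bullet> (G *v \<xi>)"
  by (simp add: inner_vec_def matrix_vector_mult_def sum_distrib_left mult_ac)

text \<open>Polarisation; it supplies the uniqueness that \<open>THE\<close> requires in
  \<open>metric_contra\<close>.\<close>

lemma symmetric_matrix_eqI:
  fixes G H :: "real^'n^'n"
  assumes "transpose G = G" "transpose H = H" "\<And>\<xi>. \<xi> \<bullet> (G *v \<xi>) = \<xi> \<bullet> (H *v \<xi>)"
  shows "G = H"
proof -
  have entry: "M $ a $ b = axis a 1 \<bullet> (M *v axis b 1)" for M :: "real^'n^'n" and a b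
    by (simp add: matrix_vector_mult_basis column_def inner_axis' )
  have pol: "2 * M $ a $ b = (axis a 1 + axis b 1) \<bullet> (M *v (axis a 1 + axis b 1)) -
      axis a 1 \<bullet> (M *v axis a 1) - axis b 1 \<bullet> (M *v axis b 1)" if "transpose M = M"
    for M :: "real^'n^'n" and a b
  proof -
    have "M $ b $ a = M $ a $ b" using that by (metis transpose_def vec_lambda_beta)
    then show ?thesis
      by (simp add: matrix_vector_right_distrib inner_add_left inner_add_right entry[symmetric])
  qed
  have "2 * G $ a $ b = 2 * H $ a $ b" for a b
    unfolding pol[OF assms(1)] pol[OF assms(2)] assms(3) ..
  then show ?thesis by (simp add: vec_eq_iff)
qed

lemma triple_rows:
  "triple (M $ l) (M $ m) (M $ k) = levi_civita l m k * det (M :: real^3^3)"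
  using exhaust_3[of l] exhaust_3[of m] exhaust_3[of k]
  by (elim disjE) (simp_all add: triple_expand det_3 levi_civita_def algebra_simps)

text \<open>Once the rows of \<open>E ** M\<close> are expanded in those of \<open>M\<close>, every
  triple product is \<open>det M\<close> times a Levi-Civita symbol and otherwise only
  \<open>E\<close> remains. The minus sign is that of the odd permutation between the index orders
  on the two sides.\<close>

lemma triple_rows_sum:
  fixes M E :: "real^3^3"
  shows "(\<Sum>l\<in>UNIV. \<Sum>m\<in>UNIV. v $ l * triple (M $ l) (M $ m) ((E ** M) $ m)) =
    - det M * (\<Sum>j\<in>UNIV. triple (axis j 1) (E *v axis j 1) v)"
proof -
  have "triple a b ((E ** M) $ m) = (\<Sum>k\<in>UNIV. E $ m $ k * triple a b (M $ k))" for a b m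
    by (simp add: triple_expand matrix_matrix_mult_def sum_3 algebra_simps)
  then have "(\<Sum>l\<in>UNIV. \<Sum>m\<in>UNIV. v $ l * triple (M $ l) (M $ m) ((E ** M) $ m)) =
      (\<Sum>l\<in>UNIV. \<Sum>m\<in>UNIV. v $ l * (\<Sum>k\<in>UNIV. E $ m $ k * (levi_civita l m k * det M)))"
    by (simp only: triple_rows)
  also have "\<dots> = - det M * (\<Sum>j\<in>UNIV. triple (axis j 1) (E *v axis j 1) v)"
    unfolding matrix_vector_mult_basis
    by (simp add: sum_3 levi_civita_def triple_expand column_def axis_def algebra_simps)
  finally show ?thesis .
qed

text \<open>Applied three times to a sixfold sum, it brings the inner three sums in front of the
  outer three.\<close>

lemma sum_rotate3:
  "(\<Sum>a\<in>A. \<Sum>b\<in>B. \<Sum>c\<in>C. \<Sum>d\<in>D. f a b c d) = (\<Sum>d\<in>D. \<Sum>a\<in>A. \<Sum>b\<in>B. \<Sum>c\<in>C. f a b c d)"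
proof -
  have 1: "(\<Sum>c\<in>C. \<Sum>d\<in>D. f a b c d) = (\<Sum>d\<in>D. \<Sum>c\<in>C. f a b c d)" for a b by (rule sum.swap)
  have 2: "(\<Sum>b\<in>B. \<Sum>d\<in>D. \<Sum>c\<in>C. f a b c d) = (\<Sum>d\<in>D. \<Sum>b\<in>B. \<Sum>c\<in>C. f a b c d)" for a by (rule sum.swap)
  show ?thesis unfolding 1 2 by (rule sum.swap)
qed

lemma levi_civita_swap: "levi_civita b a c = - levi_civita a b c"
  using exhaust_3[of a] exhaust_3[of b] exhaust_3[of c]
  by (elim disjE) (simp_all add: levi_civita_def)

context weyl_symbol begin

text \<open>The determinant of \<open>pauli w\<close> is -|w|^2, so the metric is the Euclidean one
  pulled back by \<open>V x\<close>.\<close>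

lemma metric_contra_eq:
  assumes "x \<in> U" shows "metric_contra A x = transpose (V x) ** V x"
proof -
  have sym: "transpose (transpose (V x) ** V x) = transpose (V x) ** V x"
    by (simp add: matrix_transpose_mul)
  have quad: "\<xi> \<bullet> ((transpose (V x) ** V x) *v \<xi>) = (norm (V x *v \<xi>))\<^sup>2" for \<xi>
    by (simp add: matrix_vector_mul_assoc[symmetric] dot_lmul_matrix[symmetric] power2_norm_eq_inner
        transpose_matrix_vector inner_commute)
  have det: "det (A x \<xi>) = - of_real ((norm (V x *v \<xi>))\<^sup>2)" for \<xi>
    unfolding symbol[OF assms] norm_sq_vec3
    by (simp add: det_2 complex_eq_iff power2_eq_square)
  show ?thesis
    unfolding metric_contra_def quadratic_form_inner
  proof (rule the_equality)
    show "transpose (transpose (V x) ** V x) = transpose (V x) ** V x \<and>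
      (\<forall>\<xi>. det (A x \<xi>) = - of_real (\<xi> \<bullet> ((transpose (V x) ** V x) *v \<xi>)))"
      using sym by (simp add: quad det)
    fix G assume G: "transpose G = G \<and> (\<forall>\<xi>. det (A x \<xi>) = - of_real (\<xi> \<bullet> (G *v \<xi>)))"
    show "G = transpose (V x) ** V x"
    proof (rule symmetric_matrix_eqI[OF _ sym])
      fix \<xi>
      have "- complex_of_real (\<xi> \<bullet> (G *v \<xi>)) = - of_real ((norm (V x *v \<xi>))\<^sup>2)"
        using G det by metis
      then show "\<xi> \<bullet> (G *v \<xi>) = \<xi> \<bullet> ((transpose (V x) ** V x) *v \<xi>)"
        unfolding quad by (simp only: neg_equal_iff_equal of_real_eq_iff)
    qed (use G in blast)
  qed
qed

lemma sqrt_det_metric_cov: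
  assumes "x \<in> U" shows "sqrt (det (metric_cov A x)) = 1 / \<bar>det (V x)\<bar>"
proof -
  let ?G = "transpose (V x) ** V x"
  have d: "det ?G = (det (V x))\<^sup>2" by (simp add: det_mul det_transpose power2_eq_square)
  then have "invertible ?G" using det_V[OF assms] by (simp add: invertible_det_nz)
  from matrix_inv_right[OF this] have "det ?G * det (matrix_inv ?G) = 1"
    by (metis det_mul det_I)
  then have "det (metric_cov A x) = 1 / (det (V x))\<^sup>2"
    using d det_V[OF assms] by (simp add: metric_cov_def metric_contra_eq[OF assms] field_simps)
  then show ?thesis by (simp add: real_sqrt_divide)
qed

section \<open>The teleparallel connection and its torsion\<close>

lemma pderiv_frame:
  assumes "x \<in> U" shows "pderiv_at \<mu> (\<lambda>y. frame A y $ j $ \<alpha>) x = pderiv_at \<mu> V x $ j $ \<alpha>"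
proof -
  let ?D = "frechet_derivative V (at x)"
  have "(V has_derivative ?D) (at x)" by (rule smooth_on_has_derivative[OF smooth_V assms])
  then have "((\<lambda>y. V y $ j $ \<alpha>) has_derivative (\<lambda>h. ?D h $ j $ \<alpha>)) (at x)"
    by (intro bounded_linear.has_derivative[OF bounded_linear_vec_nth])
  then have "frechet_derivative (\<lambda>y. V y $ j $ \<alpha>) (at x) = (\<lambda>h. ?D h $ j $ \<alpha>)"
    using frechet_derivative_at by metis
  moreover have "frechet_derivative (\<lambda>y. frame A y $ j $ \<alpha>) (at x) = frechet_derivative (\<lambda>y. V y $ j $ \<alpha>) (at x)"
    by (rule frechet_derivative_cong_open[OF open_U assms]) (simp add: frame_eq)
  ultimately show ?thesis by (simp add: pderiv_at_def)
qed

lemma V_inverse: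
  assumes "x \<in> U"
  shows "matrix_inv (V x) *v (V x *v \<xi>) = \<xi>" "V x *v (matrix_inv (V x) *v \<xi>) = \<xi>"
    "matrix_inv (V x) ** V x = mat 1"
proof -
  have "invertible (V x)" using det_V[OF assms] by (simp add: invertible_det_nz)
  note matrix_inv_left[OF this] matrix_inv_right[OF this]
  then show "matrix_inv (V x) *v (V x *v \<xi>) = \<xi>" "V x *v (matrix_inv (V x) *v \<xi>) = \<xi>"
    "matrix_inv (V x) ** V x = mat 1"
    by (simp_all add: matrix_vector_mul_assoc)
qed

text \<open>For fixed \<open>\<alpha>\<close> and \<open>\<mu>\<close>, parallelism of the three
  fields is a linear system for the numbers \<open>\<Gamma> \<alpha> \<mu> \<beta>\<close> with
  matrix \<open>V x\<close>; invertibility gives existence and uniqueness.\<close>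

lemma teleparallel_eq:
  assumes x: "x \<in> U"
  shows "teleparallel A x = (\<lambda>\<alpha> \<mu> \<beta>. (matrix_inv (V x) *v (\<chi> j. - pderiv_at \<mu> V x $ j $ \<alpha>)) $ \<beta>)"
proof -
  have flat: "covariant_deriv \<Gamma> \<mu> (\<lambda>y. frame A y $ j) x \<alpha> =
      pderiv_at \<mu> V x $ j $ \<alpha> + (V x *v (\<chi> \<beta>. \<Gamma> \<alpha> \<mu> \<beta>)) $ j" for \<Gamma> \<mu> j \<alpha>
    unfolding covariant_deriv_def pderiv_frame[OF x]
    by (simp add: frame_eq[OF x] matrix_vector_mult_def mult.commute)
  show ?thesis
    unfolding teleparallel_def
  proof (rule the_equality)
    show "\<forall>\<mu> j \<alpha>. covariant_deriv (\<lambda>\<alpha> \<mu> \<beta>. (matrix_inv (V x) *v (\<chi> j. - pderiv_at \<mu> V x $ j $ \<alpha>)) $ \<beta>)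
        \<mu> (\<lambda>y. frame A y $ j) x \<alpha> = 0"
      unfolding flat by (simp add: vec_lambda_eta V_inverse[OF x])
    fix \<Gamma> assume \<Gamma>: "\<forall>\<mu> j \<alpha>. covariant_deriv \<Gamma> \<mu> (\<lambda>y. frame A y $ j) x \<alpha> = 0"
    show "\<Gamma> = (\<lambda>\<alpha> \<mu> \<beta>. (matrix_inv (V x) *v (\<chi> j. - pderiv_at \<mu> V x $ j $ \<alpha>)) $ \<beta>)"
    proof (intro ext)
      fix \<alpha> \<mu> \<beta>
      have "V x *v (\<chi> \<beta>. \<Gamma> \<alpha> \<mu> \<beta>) = (\<chi> j. - pderiv_at \<mu> V x $ j $ \<alpha>)"
        using \<Gamma> unfolding flat vec_eq_iff by (simp add: eq_neg_iff_add_eq_0 add.commute)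
      then have "matrix_inv (V x) *v (\<chi> j. - pderiv_at \<mu> V x $ j $ \<alpha>) = (\<chi> \<beta>. \<Gamma> \<alpha> \<mu> \<beta>)"
        using V_inverse(1)[OF x] by metis
      then show "\<Gamma> \<alpha> \<mu> \<beta> = (matrix_inv (V x) *v (\<chi> j. - pderiv_at \<mu> V x $ j $ \<alpha>)) $ \<beta>" by simp
    qed
  qed
qed

text \<open>The antisymmetry of the torsion doubles the contraction with the Levi-Civita symbol and
  cancels the 1/2 of the dualisation. What remains are triple products of two rows of
  \<open>V x\<close> and a row of its derivative, which \<open>triple_rows_sum\<close> rewrites from
  coordinate to frame indices.\<close>

lemma trace_dual_torsion:
  assumes x: "x \<in> U"
  shows "trace (dual_torsion A x) = det (V x) / \<bar>det (V x)\<bar> * chirality x"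
proof -
  define D where "D \<mu> = pderiv_at \<mu> V x" for \<mu>
  define g where "g = metric_contra A x"
  define \<Gamma> where "\<Gamma> = teleparallel A x"
  define X where "X \<alpha> \<gamma> \<delta> = (\<Sum>\<mu>\<in>UNIV. \<Sum>\<nu>\<in>UNIV. g $ \<gamma> $ \<mu> * g $ \<delta> $ \<nu> * \<Gamma> \<alpha> \<mu> \<nu>)" for \<alpha> \<gamma> \<delta>
  have raised: "torsion_raised A x \<alpha> \<gamma> \<delta> = X \<alpha> \<gamma> \<delta> - X \<alpha> \<delta> \<gamma>" for \<alpha> \<gamma> \<delta>
  proof -
    have "torsion_raised A x \<alpha> \<gamma> \<delta> = X \<alpha> \<gamma> \<delta> - (\<Sum>\<mu>\<in>UNIV. \<Sum>\<nu>\<in>UNIV. g $ \<gamma> $ \<mu> * g $ \<delta> $ \<nu> * \<Gamma> \<alpha> \<nu> \<mu>)"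
      unfolding torsion_raised_def torsion_def X_def g_def \<Gamma>_def
      by (simp add: sum_subtractf[symmetric] right_diff_distrib)
    also have "(\<Sum>\<mu>\<in>UNIV. \<Sum>\<nu>\<in>UNIV. g $ \<gamma> $ \<mu> * g $ \<delta> $ \<nu> * \<Gamma> \<alpha> \<nu> \<mu>) = X \<alpha> \<delta> \<gamma>"
      unfolding X_def by (subst sum.swap) (simp add: mult_ac)
    finally show ?thesis .
  qed
  have antisym: "(\<Sum>\<gamma>\<in>UNIV. \<Sum>\<delta>\<in>UNIV. torsion_raised A x \<alpha> \<gamma> \<delta> * levi_civita \<gamma> \<delta> \<alpha>) =
      2 * (\<Sum>\<gamma>\<in>UNIV. \<Sum>\<delta>\<in>UNIV. X \<alpha> \<gamma> \<delta> * levi_civita \<gamma> \<delta> \<alpha>)" for \<alpha>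
  proof -
    have "(\<Sum>\<gamma>\<in>UNIV. \<Sum>\<delta>\<in>UNIV. X \<alpha> \<delta> \<gamma> * levi_civita \<gamma> \<delta> \<alpha>) =
        - (\<Sum>\<gamma>\<in>UNIV. \<Sum>\<delta>\<in>UNIV. X \<alpha> \<gamma> \<delta> * levi_civita \<gamma> \<delta> \<alpha>)"
    proof -
      have "(\<Sum>\<gamma>\<in>UNIV. \<Sum>\<delta>\<in>UNIV. X \<alpha> \<delta> \<gamma> * levi_civita \<gamma> \<delta> \<alpha>) =
          (\<Sum>\<gamma>\<in>UNIV. \<Sum>\<delta>\<in>UNIV. X \<alpha> \<gamma> \<delta> * levi_civita \<delta> \<gamma> \<alpha>)"
        by (rule sum.swap)
      also have "\<dots> = (\<Sum>\<gamma>\<in>UNIV. \<Sum>\<delta>\<in>UNIV. - (X \<alpha> \<gamma> \<delta> * levi_civita \<gamma> \<delta> \<alpha>))"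
        by (intro sum.cong refl) (metis levi_civita_swap mult_minus_right)
      finally show ?thesis by (simp only: sum_negf)
    qed
    then show ?thesis by (simp add: raised left_diff_distrib sum_subtractf)
  qed
  \<comment> \<open>One factor of the metric absorbs the inverse in the connection, as V^T V V^-1 =
    V^T; the other is expanded into frame fields. No inverse matrix is left.\<close>
  have X: "X \<alpha> \<gamma> \<delta> = (\<Sum>\<mu>\<in>UNIV. \<Sum>l\<in>UNIV. \<Sum>m\<in>UNIV.
      - (V x $ l $ \<mu> * (V x $ l $ \<gamma> * V x $ m $ \<delta> * D \<mu> $ m $ \<alpha>)))" for \<alpha> \<gamma> \<delta>
  proof -
    have "(\<Sum>\<nu>\<in>UNIV. g $ \<delta> $ \<nu> * \<Gamma> \<alpha> \<mu> \<nu>) = - (\<Sum>m\<in>UNIV. V x $ m $ \<delta> * D \<mu> $ m $ \<alpha>)" for \<mu>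
    proof -
      have "(\<Sum>\<nu>\<in>UNIV. g $ \<delta> $ \<nu> * \<Gamma> \<alpha> \<mu> \<nu>) = (g *v (matrix_inv (V x) *v (\<chi> j. - D \<mu> $ j $ \<alpha>))) $ \<delta>"
        unfolding \<Gamma>_def teleparallel_eq[OF x] D_def
        by (subst (2) matrix_vector_mult_def) simp
      also have "\<dots> = (transpose (V x) *v (\<chi> j. - D \<mu> $ j $ \<alpha>)) $ \<delta>"
        unfolding g_def metric_contra_eq[OF x] matrix_vector_mul_assoc[symmetric] V_inverse(2)[OF x] ..
      finally show ?thesis by (simp add: matrix_vector_mult_def transpose_def sum_negf)
    qed
    then have "X \<alpha> \<gamma> \<delta> = (\<Sum>\<mu>\<in>UNIV. g $ \<gamma> $ \<mu> * - (\<Sum>m\<in>UNIV. V x $ m $ \<delta> * D \<mu> $ m $ \<alpha>))"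
      unfolding X_def by (simp only: mult.assoc sum_distrib_left[symmetric])
    moreover have "g $ \<gamma> $ \<mu> = (\<Sum>l\<in>UNIV. V x $ l $ \<gamma> * V x $ l $ \<mu>)" for \<mu>
      by (simp add: g_def metric_contra_eq[OF x] matrix_matrix_mult_def transpose_def)
    ultimately show ?thesis
      by (simp add: sum_distrib_left sum_distrib_right sum_negf mult_ac)
  qed
  have "(\<Sum>\<alpha>\<in>UNIV. \<Sum>\<gamma>\<in>UNIV. \<Sum>\<delta>\<in>UNIV. X \<alpha> \<gamma> \<delta> * levi_civita \<gamma> \<delta> \<alpha>) =
      (\<Sum>\<mu>\<in>UNIV. \<Sum>l\<in>UNIV. \<Sum>m\<in>UNIV. \<Sum>\<alpha>\<in>UNIV. \<Sum>\<gamma>\<in>UNIV. \<Sum>\<delta>\<in>UNIV.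
        - (V x $ l $ \<mu> * (V x $ l $ \<gamma> * V x $ m $ \<delta> * D \<mu> $ m $ \<alpha>)) * levi_civita \<gamma> \<delta> \<alpha>)"
    unfolding X sum_distrib_right
    by (subst sum_rotate3, rule sum.cong[OF refl], subst sum_rotate3, rule sum.cong[OF refl],
        subst sum_rotate3, rule refl)
  also have "\<dots> = - (\<Sum>\<mu>\<in>UNIV. \<Sum>l\<in>UNIV. \<Sum>m\<in>UNIV. V x $ l $ \<mu> * triple (V x $ l) (V x $ m) (D \<mu> $ m))"
  proof -
    have "(\<Sum>\<alpha>\<in>UNIV. \<Sum>\<gamma>\<in>UNIV. \<Sum>\<delta>\<in>UNIV. - (v * (a $ \<gamma> * b $ \<delta> * d $ \<alpha>)) * levi_civita \<gamma> \<delta> \<alpha>) =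
        - (v * triple a b d)" for v and a b d :: "real^3"
      by (simp add: sum_3 triple_expand levi_civita_def algebra_simps)
    then show ?thesis by (simp only: sum_negf)
  qed
  also have "\<dots> = - (\<Sum>\<mu>\<in>UNIV. - det (V x) *
      (\<Sum>j\<in>UNIV. triple (axis j 1) (D \<mu> *v (matrix_inv (V x) *v axis j 1)) (V x *v axis \<mu> 1)))"
  proof -
    have "(\<Sum>l\<in>UNIV. \<Sum>m\<in>UNIV. V x $ l $ \<mu> * triple (V x $ l) (V x $ m) (D \<mu> $ m)) =
      - det (V x) * (\<Sum>j\<in>UNIV. triple (axis j 1) (D \<mu> *v (matrix_inv (V x) *v axis j 1)) (V x *v axis \<mu> 1))" for \<mu>
    proof -
      \<comment> \<open>Inserting V^-1 V presents the derivative of the frame as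
        \<open>E ** M\<close>, with the logarithmic derivative in the place of
        \<open>E\<close>.\<close>
      have "(D \<mu> ** matrix_inv (V x)) ** V x = D \<mu>"
        by (simp add: matrix_mul_assoc[symmetric] V_inverse(3)[OF x])
      then show ?thesis
        using triple_rows_sum[of "V x *v axis \<mu> 1" "V x" "D \<mu> ** matrix_inv (V x)"]
        by (simp add: matrix_vector_mult_basis[of "V x"] column_def matrix_vector_mul_assoc)
    qed
    then show ?thesis by simp
  qed
  also have "\<dots> = det (V x) * chirality x"
    by (simp add: chirality_def D_def sum_negf sum_distrib_left)
  finally have sum: "(\<Sum>\<alpha>\<in>UNIV. \<Sum>\<gamma>\<in>UNIV. \<Sum>\<delta>\<in>UNIV. X \<alpha> \<gamma> \<delta> * levi_civita \<gamma> \<delta> \<alpha>) = det (V x) * chirality x" .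
  have "trace (dual_torsion A x) = (\<Sum>\<alpha>\<in>UNIV. (\<Sum>\<gamma>\<in>UNIV. \<Sum>\<delta>\<in>UNIV. X \<alpha> \<gamma> \<delta> * levi_civita \<gamma> \<delta> \<alpha>)) / \<bar>det (V x)\<bar>"
    unfolding trace_def dual_torsion_def vec_lambda_beta antisym sqrt_det_metric_cov[OF x]
    by (subst sum_divide_distrib, rule sum.cong[OF refl]) simp
  then show ?thesis unfolding sum by simp
qed

theorem b_coeff_torsion:
  fixes A0 :: "real^3 \<Rightarrow> complex^2^2"
  assumes x: "x \<in> U"
  shows "b_coeff A A0 x = of_real (1 / (8 * pi\<^sup>2)) *
      ((of_real (rel_orientation A x * trace (dual_torsion A x)) - 2 * trace (subprincipal A A0 x))
       * of_real (sqrt (det (metric_cov A x))))"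
proof -
  \<comment> \<open>The sign in \<open>rel_orientation\<close> and the sign left over by the
    dualisation multiply to 1.\<close>
  have "rel_orientation A x * trace (dual_torsion A x) = chirality x"
    using det_V[OF x] by (simp add: trace_dual_torsion[OF x] rel_orientation_def frame_eq[OF x] sgn_if abs_if)
  then show ?thesis
    unfolding b_coeff_eq[OF x] sqrt_det_metric_cov[OF x] by simp
qed

end

section \<open>The principal symbol of the operator\<close>

lemma principal_symbol_nth:
  "principal_symbol Fc x \<xi> $ a $ b = (\<Sum>\<alpha>\<in>UNIV. \<i> * of_real (\<xi> $ \<alpha>) * Fc \<alpha> x $ a $ b)"
  by (simp add: principal_symbol_def cscale_def)

lemma principal_symbol_axis_nth: "principal_symbol Fc x (axis \<alpha> 1) $ a $ b = \<i> * Fc \<alpha> x $ a $ b"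
proof -
  have "\<i> * complex_of_real (axis \<alpha> 1 $ \<beta>) * Fc \<beta> x $ a $ b = (if \<beta> = \<alpha> then \<i> * Fc \<alpha> x $ a $ b else 0)" for \<beta>
    by (auto simp: axis_def)
  then show ?thesis by (simp add: principal_symbol_nth)
qed

text \<open>The factor \<open>\<i>\<close> turns skew-Hermitian coefficients into Hermitian ones;
  being trace-free, each has three real parameters, the frame components. A nonzero vector in the
  kernel of the frame would make the symbol \<open>pauli 0\<close>, with determinant 0, against
  ellipticity.\<close>

lemma weyl_symbolI:
  fixes Fc :: "3 \<Rightarrow> real^3 \<Rightarrow> complex^2^2"
  assumes U: "open U" and smooth: "\<And>\<alpha>. smooth_on (Fc \<alpha>) U"
    and skew: "\<And>\<alpha> x i j. x \<in> U \<Longrightarrow> Fc \<alpha> x $ j $ i + cnj (Fc \<alpha> x $ i $ j) = 0"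
    and tr: "\<And>x \<xi>. x \<in> U \<Longrightarrow> trace (principal_symbol Fc x \<xi>) = 0"
    and ell: "\<And>x \<xi>. x \<in> U \<Longrightarrow> \<xi> \<noteq> 0 \<Longrightarrow> det (principal_symbol Fc x \<xi>) \<noteq> 0"
  shows "weyl_symbol (principal_symbol Fc) U (frame (principal_symbol Fc))"
proof
  let ?A = "principal_symbol Fc"
  \<comment> \<open>Multiplication by \<open>\<i>\<close> exchanges real and imaginary parts, whence
    these signs.\<close>
  have fr: "frame ?A y = (\<chi> j \<alpha>. if j = 1 then - Im (Fc \<alpha> y $ 1 $ 2) else if j = 2 then - Re (Fc \<alpha> y $ 1 $ 2)
      else - Im (Fc \<alpha> y $ 1 $ 1))" for y
    by (auto simp: frame_def Let_def principal_symbol_axis_nth vec_eq_iff)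
  show "open U" by (rule U)
  show "smooth_on (frame ?A) U"
  proof -
    have re: "smooth_on (\<lambda>y. - Re (Fc \<alpha> y $ a $ b)) U" and im: "smooth_on (\<lambda>y. - Im (Fc \<alpha> y $ a $ b)) U" for \<alpha> a b
      by (intro smooth_on_uminus smooth_on_linear_compose[OF U bounded_linear_Re]
          smooth_on_linear_compose[OF U bounded_linear_Im] smooth_on_vec_nth U smooth)+
    have "smooth_on (\<lambda>y. if j = 1 then - Im (Fc \<alpha> y $ 1 $ 2) else if j = 2 then - Re (Fc \<alpha> y $ 1 $ 2)
      else - Im (Fc \<alpha> y $ 1 $ 1)) U" for j :: 3 and \<alpha>
      by (cases "j = 1"; cases "j = 2") (simp_all add: re im)
    then show ?thesis unfolding fr by (intro smooth_on_vec_lambda U)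
  qed
  show sym: "?A y \<xi> = pauli (frame ?A y *v \<xi>)" if y: "y \<in> U" for y \<xi>
  proof -
    have "Fc \<alpha> y $ 2 $ 2 = - Fc \<alpha> y $ 1 $ 1" for \<alpha>
    proof -
      have "\<i> * (Fc \<alpha> y $ 1 $ 1 + Fc \<alpha> y $ 2 $ 2) = 0"
        using tr[OF y, of "axis \<alpha> 1"] by (simp add: trace_def sum_2 principal_symbol_axis_nth algebra_simps)
      then show ?thesis by (simp add: add_eq_0_iff2)
    qed
    moreover have "Fc \<alpha> y $ 2 $ 1 = - cnj (Fc \<alpha> y $ 1 $ 2)" for \<alpha>
      using skew[OF y, of \<alpha> 2 1] by (simp add: eq_neg_iff_add_eq_0)
    moreover have "Re (Fc \<alpha> y $ 1 $ 1) = 0" for \<alpha>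
      using skew[OF y, of \<alpha> 1 1] by (simp add: complex_eq_iff)
    ultimately show ?thesis
      by (simp add: vec_eq_iff forall_2 complex_eq_iff principal_symbol_nth fr matrix_vector_mult_def
          sum_negf mult.commute)
  qed
  show "det (frame ?A y) \<noteq> 0" if y: "y \<in> U" for y
  proof -
    have "\<xi> = 0" if "frame ?A y *v \<xi> = 0" for \<xi>
    proof (rule ccontr)
      assume "\<xi> \<noteq> 0"
      then have "det (pauli 0) \<noteq> 0" using ell[OF y] sym[OF y] that by metis
      then show False by (simp add: det_2 complex_eq_iff)
    qed
    then show ?thesis
      using matrix_left_invertible_ker invertible_left_inverse invertible_det_nz by metis
  qed
qed

theorem mainTheorem7:
  fixes M :: "'m::t2_space set"
    and \<A> \<O> :: "'m chart set"
    and F :: "'m chart \<Rightarrow> 3 \<Rightarrow> real^3 \<Rightarrow> complex^2^2"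
    and G :: "'m chart \<Rightarrow> real^3 \<Rightarrow> complex^2^2"
    and c :: "'m chart"
    and x :: "real^3"
  assumes "compact M" and "connected M"
    and "smooth_structure M \<A>"
    and "orientation M \<A> \<O>"
    and "first_order_operator \<A> F G"
    and "elliptic \<A> F"
    and "self_adjoint M \<A> F G"
    and "trace_free_symbol \<A> F"
    and "c \<in> \<O>" and "x \<in> cod c"
  defines "A1 \<equiv> principal_symbol (F c)"
    and "A0 \<equiv> G c"
  shows "b_coeff A1 A0 x =
    of_real (1 / (8 * pi\<^sup>2)) *
      ((of_real (rel_orientation A1 x * trace (dual_torsion A1 x))
          - 2 * trace (subprincipal A1 A0 x))
       * of_real (sqrt (det (metric_cov A1 x))))"
proof -
  interpret manifold3 M \<A> by standard (rule assms(3))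
  have c: "c \<in> \<A>" using assms(4,9) by (auto simp: orientation_def)
  \<comment> \<open>The matrix field \<open>V\<close> of the locale is the frame itself.\<close>
  interpret weyl_symbol A1 "cod c" "frame A1"
    unfolding A1_def
  proof (rule weyl_symbolI)
    show "open (cod c)" by (rule open_cod[OF c])
    show "smooth_on (F c \<alpha>) (cod c)" for \<alpha>
      using assms(5) c by (simp add: first_order_operator_def)
    show "F c \<alpha> y $ j $ i + cnj (F c \<alpha> y $ i $ j) = 0" if "y \<in> cod c" for \<alpha> y i j
      by (rule self_adjoint_imp_skew_hermitian[OF assms(1,5,7) c that])
    show "trace (principal_symbol (F c) y \<xi>) = 0" if "y \<in> cod c" for y \<xi>
      using assms(8) c that by (simp add: trace_free_symbol_def)
    show "det (principal_symbol (F c) y \<xi>) \<noteq> 0" if "y \<in> cod c" "\<xi> \<noteq> 0" for y \<xi>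
      using assms(6) c that by (simp add: elliptic_def)
  qed
  show ?thesis by (rule b_coeff_torsion[OF assms(10)])
qed

end
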